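(* Let $\nu$ be an almost invariant measure on $S$ for which there exists a scalar positive (measurable) function $f(s)$ on $S$ satisfying the following conditions: (i) $\int_S f(s)^2\,d\nu(s)=\infty$; (ii) $\int_S |f(ss_0)-f(s)|^2\,d\nu(s)<\infty$ for every $s_0\in S$; (iii) $\int_S \bigl(1-\operatorname{Re} e^{\operatorname{tr}(s(n_0-\frac12 z_0z_0^* )s^* )}\bigr) f(s)^2\, d\nu(s)<\infty$ for every $(n_0,z_0)\in N$. Then the representation $T$ of the Iwasawa group $P$ associated with the measure $\nu$ has a nontrivial $1$-cocycle of the form $$\beta(g)=T(g)\,(f\mathbf 1)-f\mathbf 1,\qquad g\in P,$$ where $f\mathbf 1$ denotes the $K$-valued function $s\mapsto f(s)\mathbf 1$; thus $T$ is a special representation.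
   Context: Let $q\ge p\ge 1$ be integers. $A$ is the additive group of skew-Hermitian $p\times p$ matrices, $Z$ is the additive group of complex $p\times(q-p)$ matrices, and $N$ (the Heisenberg group) is the set of pairs $(n,z)$, $n\in A$, $z\in Z$, with $(n_1,z_1)(n_2,z_2)=(n_1+n_2-\frac12(z_1z_2^*-z_2z_1^* ),\,z_1+z_2)$; $*$ is the conjugate transpose. $S$ is the group of complex lower triangular $p\times p$ matrices with real positive diagonal entries; it acts on $N$ by automorphisms $(n,z)\mapsto (n,z)^s=(sns^*,sz)$. The Iwasawa group is the semidirect product $P$ of $S$ and $N$ (with $s(n,z)s^{-1}=(n,z)^s$). Let $\mu(dz)=e^{-\operatorname{tr}zz^*}dz$ be the Gaussian measure on $Z$ ($dz$ is Lebesgue measure normalized so that $\mu$ is a probability measure). $K$ is the Bargmann space: the subspace of holomorphic functions in $L^2(Z,\mu)$, with vacuum vector $\mathbf 1$ (the constant function $1$). $N$ acts on $K$ by the unitary operators $T^{1}(n^0,z^0)f(z)=\exp\bigl(\operatorname{tr}n^0-\frac12\operatorname{tr} z^0z^{0*}-\operatorname{tr}zz^{0*}\bigr)f(z+z^0)$ (this is the case $\epsilon=(1,\dots,1)$). For $s\in S$, let $T_s(g)=T^{1}(g^s)$, $g\in N$, acting on $K_s=K$. A measure $\nu$ on $S$ is almost invariant if it is quasi-invariant under the right translations $s\mapsto ss_0$, $s_0\in S$, and the derivative $\frac{d\nu(ss_0)}{d\nu(s)}$ is a bounded function of $s$ for every $s_0\in S$. The representation $T$ of $P$ associated with $\nu$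 acts in the direct integral $\mathcal K=\int_S^{\oplus}K_s\,d\nu(s)$, i.e. $L^2(S,\nu;K)$, by $(T(g)F)(s)=T_s(g)F(s)$ for $g\in N$ and $(T(s_0)F)(s)=F(ss_0)$ for $s_0\in S$. The same formulas define $T(g)$ on all measurable $K$-valued functions on $S$ (such as $f\mathbf 1$, which need not lie in $\mathcal K$). A ($1$-)cocycle of a (not necessarily unitary) representation $T$ of a locally compact group $G$ in a Hilbert space $H$ is a continuous map $\beta:G\to H$ with $\beta(g_1g_2)=T(g_1)\beta(g_2)+\beta(g_1)$; it is nontrivial if it is not of the form $\beta(g)=T(g)\xi-\xi$ with $\xi\in H$. $T$ is special if it has a nontrivial $1$-cocycle. *)

theory Defs
  imports
    "HOL-Analysis.Analysis"
    "HOL-Algebra.Group"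
    "HOL-Library.Function_Algebras"
begin

subsection \<open>Matrices of variable size\<close>

text \<open>
  An \<open>m \<times> n\<close> matrix is a function \<open>nat \<Rightarrow> nat \<Rightarrow> complex\<close> vanishing outside \<open>{..<m} \<times> {..<n}\<close>.
  In contrast to index types this allows \<open>n = 0\<close> (needed for \<open>q = p\<close>), and function types carry
  the library's product topology and Borel structure, which restrict to the Euclidean ones on
  \<open>mats m n\<close>.  Addition and subtraction (of matrices and of functions on matrices) are the
  pointwise ones of \<open>Function_Algebras\<close>; the pointwise product of functions is never used.
\<close>

type_synonym cmat = "nat \<Rightarrow> nat \<Rightarrow> complex"

definition mats :: "nat \<Rightarrow> nat \<Rightarrow> cmat set" where
  "mats m n = {A. \<forall>i j. \<not> (i < m \<and> j < n) \<longrightarrow> A i j = 0}"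

text \<open>\<open>mmul r A B\<close> is the product \<open>AB\<close> with inner dimension \<open>r\<close>.\<close>

definition mmul :: "nat \<Rightarrow> cmat \<Rightarrow> cmat \<Rightarrow> cmat" where
  "mmul r A B = (\<lambda>i j. \<Sum>k<r. A i k * B k j)"

definition madj :: "cmat \<Rightarrow> cmat" where
  "madj A = (\<lambda>i j. cnj (A j i))"

definition mscale :: "complex \<Rightarrow> cmat \<Rightarrow> cmat" where
  "mscale c A = (\<lambda>i j. c * A i j)"

definition mtrace :: "nat \<Rightarrow> cmat \<Rightarrow> complex" where
  "mtrace p A = (\<Sum>i<p. A i i)"

definition mone :: "nat \<Rightarrow> cmat" where
  "mone p = (\<lambda>i j. if i < p \<and> i = j then 1 else 0)"


subsection \<open>The groups\<close>

definition lower_triangular_group :: "nat \<Rightarrow> cmat monoid" where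
  "lower_triangular_group p =
    \<lparr>carrier = {s \<in> mats p p. (\<forall>i j. i < j \<longrightarrow> s i j = 0) \<and>
                              (\<forall>i<p. s i i \<in> \<real> \<and> 0 < Re (s i i))},
     mult = mmul p, one = mone p\<rparr>"

definition heisenberg_group :: "nat \<Rightarrow> nat \<Rightarrow> (cmat \<times> cmat) monoid" where
  "heisenberg_group p q =
    \<lparr>carrier = {n \<in> mats p p. madj n = - n} \<times> mats p (q - p),
     mult = (\<lambda>(n1, z1) (n2, z2).
       (n1 + n2 - mscale (1/2) (mmul (q - p) z1 (madj z2) - mmul (q - p) z2 (madj z1)), z1 + z2)),
     one = (0, 0)\<rparr>"

definition heisenberg_act :: "nat \<Rightarrow> cmat \<Rightarrow> cmat \<times> cmat \<Rightarrow> cmat \<times> cmat" where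
  "heisenberg_act p s = (\<lambda>(n, z). (mmul p (mmul p s n) (madj s), mmul p s z))"

text \<open>
  The pair \<open>(g, s)\<close> stands for the product \<open>g s\<close> of \<open>g \<in> N\<close> and \<open>s \<in> S\<close>, so that
  \<open>s g s\<^sup>-\<^sup>1 = heisenberg_act p s g\<close>.
\<close>

definition iwasawa_group :: "nat \<Rightarrow> nat \<Rightarrow> ((cmat \<times> cmat) \<times> cmat) monoid" where
  "iwasawa_group p q =
    \<lparr>carrier = carrier (heisenberg_group p q) \<times> carrier (lower_triangular_group p),
     mult = (\<lambda>(g1, s1) (g2, s2).
       (g1 \<otimes>\<^bsub>heisenberg_group p q\<^esub> heisenberg_act p s1 g2, s1 \<otimes>\<^bsub>lower_triangular_group p\<^esub> s2)),
     one = (\<one>\<^bsub>heisenberg_group p q\<^esub>, \<one>\<^bsub>lower_triangular_group p\<^esub>)\<rparr>"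


subsection \<open>Representations and cocycles\<close>

text \<open>
  A Hilbert space of functions is presented by its vectors before passing to the quotient by the
  vectors of norm zero; equality in the Hilbert space is therefore \<open>veq\<close>.
\<close>

record 'h hilbert =
  vectors :: "'h set"
  scale :: "complex \<Rightarrow> 'h \<Rightarrow> 'h"
  inner_prod :: "'h \<Rightarrow> 'h \<Rightarrow> complex"

definition vnorm :: "'h hilbert \<Rightarrow> 'h \<Rightarrow> real" where
  "vnorm H x = sqrt (Re (inner_prod H x x))"

definition veq :: "('h::ab_group_add) hilbert \<Rightarrow> 'h \<Rightarrow> 'h \<Rightarrow> bool" where
  "veq H x y \<longleftrightarrow> x - y \<in> vectors H \<and> vnorm H (x - y) = 0"

definition continuous_into ::
    "('g::topological_space, 'b) monoid_scheme \<Rightarrow> ('h::ab_group_add) hilbert \<Rightarrow> ('g \<Rightarrow> 'h) \<Rightarrow> bool" where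
  "continuous_into G H \<beta> \<longleftrightarrow>
    (\<forall>g\<in>carrier G. ((\<lambda>h. vnorm H (\<beta> h - \<beta> g)) \<longlongrightarrow> 0) (at g within carrier G))"

definition representation ::
    "('g::topological_space, 'b) monoid_scheme \<Rightarrow> ('h::ab_group_add) hilbert \<Rightarrow> ('g \<Rightarrow> 'h \<Rightarrow> 'h) \<Rightarrow> bool" where
  "representation G H T \<longleftrightarrow>
    (\<forall>g\<in>carrier G.
       (\<forall>x\<in>vectors H. T g x \<in> vectors H) \<and>
       (\<forall>x\<in>vectors H. \<forall>y\<in>vectors H. veq H (T g (x + y)) (T g x + T g y)) \<and>
       (\<forall>c. \<forall>x\<in>vectors H. veq H (T g (scale H c x)) (scale H c (T g x))) \<and>
       (\<exists>C. \<forall>x\<in>vectors H. vnorm H (T g x) \<le> C * vnorm H x)) \<and>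
    (\<forall>x\<in>vectors H. veq H (T \<one>\<^bsub>G\<^esub> x) x) \<and>
    (\<forall>g\<in>carrier G. \<forall>h\<in>carrier G. \<forall>x\<in>vectors H. veq H (T (g \<otimes>\<^bsub>G\<^esub> h) x) (T g (T h x))) \<and>
    (\<forall>x\<in>vectors H. continuous_into G H (\<lambda>g. T g x))"

definition cocycle ::
    "('g::topological_space, 'b) monoid_scheme \<Rightarrow> ('h::ab_group_add) hilbert \<Rightarrow> ('g \<Rightarrow> 'h \<Rightarrow> 'h) \<Rightarrow>
     ('g \<Rightarrow> 'h) \<Rightarrow> bool" where
  "cocycle G H T \<beta> \<longleftrightarrow>
    (\<forall>g\<in>carrier G. \<beta> g \<in> vectors H) \<and>
    continuous_into G H \<beta> \<and>
    (\<forall>g\<in>carrier G. \<forall>h\<in>carrier G. veq H (\<beta> (g \<otimes>\<^bsub>G\<^esub> h)) (T g (\<beta> h) + \<beta> g))"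

definition nontrivial_cocycle ::
    "('g::topological_space, 'b) monoid_scheme \<Rightarrow> ('h::ab_group_add) hilbert \<Rightarrow> ('g \<Rightarrow> 'h \<Rightarrow> 'h) \<Rightarrow>
     ('g \<Rightarrow> 'h) \<Rightarrow> bool" where
  "nontrivial_cocycle G H T \<beta> \<longleftrightarrow>
    cocycle G H T \<beta> \<and> \<not> (\<exists>\<xi>\<in>vectors H. \<forall>g\<in>carrier G. veq H (\<beta> g) (T g \<xi> - \<xi>))"

definition special_representation ::
    "('g::topological_space, 'b) monoid_scheme \<Rightarrow> ('h::ab_group_add) hilbert \<Rightarrow> ('g \<Rightarrow> 'h \<Rightarrow> 'h) \<Rightarrow> bool" where
  "special_representation G H T \<longleftrightarrow>
    representation G H T \<and> (\<exists>\<beta>. nontrivial_cocycle G H T \<beta>)"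


subsection \<open>The Bargmann space\<close>

text \<open>
  Lebesgue measure on \<open>Z = mats p r\<close> is the image of the product of the Lebesgue measures of the
  \<open>pr\<close> coordinate planes.  Since \<open>e\<^sup>-\<^sup>|\<^sup>w\<^sup>|\<^sup>2\<close> has integral \<open>\<pi>\<close> over the plane, the factor
  \<open>1 / \<pi>\<^sup>p\<^sup>r\<close> is the one that makes the Gaussian measure a probability measure.
\<close>

definition lebesgue_mats :: "nat \<Rightarrow> nat \<Rightarrow> cmat measure" where
  "lebesgue_mats p r =
    distr (Pi\<^sub>M ({..<p} \<times> {..<r}) (\<lambda>_. lborel :: complex measure)) (restrict_space borel (mats p r))
      (\<lambda>x i j. if i < p \<and> j < r then x (i, j) else 0)"

definition gaussian_mats :: "nat \<Rightarrow> nat \<Rightarrow> cmat measure" where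
  "gaussian_mats p r =
    density (lebesgue_mats p r)
      (\<lambda>z. ennreal (exp (- Re (mtrace p (mmul r z (madj z)))) / pi ^ (p * r)))"

text \<open>Holomorphic in several variables: continuous, and holomorphic in each matrix entry.\<close>

definition holomorphic_mats :: "nat \<Rightarrow> nat \<Rightarrow> (cmat \<Rightarrow> complex) \<Rightarrow> bool" where
  "holomorphic_mats p r \<phi> \<longleftrightarrow>
    continuous_on (mats p r) \<phi> \<and>
    (\<forall>z\<in>mats p r. \<forall>i<p. \<forall>j<r. (\<lambda>w. \<phi> (z(i := (z i)(j := w)))) holomorphic_on UNIV)"

definition bargmann :: "nat \<Rightarrow> nat \<Rightarrow> (cmat \<Rightarrow> complex) hilbert" where
  "bargmann p q =
    \<lparr>vectors = {\<phi>. holomorphic_mats p (q - p) \<phi> \<and>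
                   integrable (gaussian_mats p (q - p)) (\<lambda>z. (cmod (\<phi> z))\<^sup>2)},
     scale = (\<lambda>c \<phi> z. c * \<phi> z),
     inner_prod = (\<lambda>\<phi> \<psi>. \<integral>z. \<phi> z * cnj (\<psi> z) \<partial>gaussian_mats p (q - p))\<rparr>"

definition heisenberg_rep ::
    "nat \<Rightarrow> nat \<Rightarrow> cmat \<times> cmat \<Rightarrow> (cmat \<Rightarrow> complex) \<Rightarrow> (cmat \<Rightarrow> complex)" where
  "heisenberg_rep p q = (\<lambda>(n0, z0) \<phi> z.
     exp (mtrace p n0 - 1/2 * mtrace p (mmul (q - p) z0 (madj z0)) - mtrace p (mmul (q - p) z (madj z0)))
       * \<phi> (z + z0))"


subsection \<open>Almost invariant measures and the associated representation\<close>

text \<open>The measure \<open>d\<nu>(s s0)\<close>, i.e. \<open>E \<mapsto> \<nu>(E s0)\<close>.\<close>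

definition right_translate :: "nat \<Rightarrow> cmat measure \<Rightarrow> cmat \<Rightarrow> cmat measure" where
  "right_translate p \<nu> s0 =
    distr \<nu> \<nu> (\<lambda>s. s \<otimes>\<^bsub>lower_triangular_group p\<^esub> inv\<^bsub>lower_triangular_group p\<^esub> s0)"

definition almost_invariant :: "nat \<Rightarrow> cmat measure \<Rightarrow> bool" where
  "almost_invariant p \<nu> \<longleftrightarrow>
    (\<forall>s0\<in>carrier (lower_triangular_group p).
       absolutely_continuous \<nu> (right_translate p \<nu> s0) \<and>
       absolutely_continuous (right_translate p \<nu> s0) \<nu> \<and>
       (\<exists>C::real. AE s in \<nu>. RN_deriv \<nu> (right_translate p \<nu> s0) s \<le> ennreal C))"

text \<open>
  \<open>L\<^sup>2(S, \<nu>; K)\<close> for the Bargmann space \<open>K\<close>; since \<open>K\<close> is separable, measurability of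
  \<open>K\<close>-valued functions may be taken in the weak sense.
\<close>

definition K_measurable :: "nat \<Rightarrow> nat \<Rightarrow> cmat measure \<Rightarrow> (cmat \<Rightarrow> cmat \<Rightarrow> complex) \<Rightarrow> bool" where
  "K_measurable p q \<nu> F \<longleftrightarrow>
    (\<forall>s\<in>space \<nu>. F s \<in> vectors (bargmann p q)) \<and>
    (\<forall>\<phi>\<in>vectors (bargmann p q). (\<lambda>s. inner_prod (bargmann p q) (F s) \<phi>) \<in> borel_measurable \<nu>)"

definition L2_bargmann :: "nat \<Rightarrow> nat \<Rightarrow> cmat measure \<Rightarrow> (cmat \<Rightarrow> cmat \<Rightarrow> complex) hilbert" where
  "L2_bargmann p q \<nu> =
    \<lparr>vectors = {F. K_measurable p q \<nu> F \<and> integrable \<nu> (\<lambda>s. (vnorm (bargmann p q) (F s))\<^sup>2)},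
     scale = (\<lambda>c F s z. c * F s z),
     inner_prod = (\<lambda>F G. \<integral>s. inner_prod (bargmann p q) (F s) (G s) \<partial>\<nu>)\<rparr>"

text \<open>
  For \<open>g \<in> N\<close> and \<open>s0 \<in> S\<close> this is \<open>T(g s0) = T(g) T(s0)\<close>; it does not depend on \<open>\<nu>\<close> and is
  defined on all functions \<open>F\<close>, square integrable or not.
\<close>

definition iwasawa_rep ::
    "nat \<Rightarrow> nat \<Rightarrow> (cmat \<times> cmat) \<times> cmat \<Rightarrow> (cmat \<Rightarrow> cmat \<Rightarrow> complex) \<Rightarrow> (cmat \<Rightarrow> cmat \<Rightarrow> complex)" where
  "iwasawa_rep p q = (\<lambda>(g, s0) F s.
     heisenberg_rep p q (heisenberg_act p s g) (F (s \<otimes>\<^bsub>lower_triangular_group p\<^esub> s0)))"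

definition vacuum_field :: "(cmat \<Rightarrow> real) \<Rightarrow> (cmat \<Rightarrow> cmat \<Rightarrow> complex)" where
  "vacuum_field f = (\<lambda>s z. complex_of_real (f s))"

end

theory Submission
  imports Defs "HOL-Complex_Analysis.Complex_Analysis" "HOL-Probability.Probability"
begin

text \<open>
  Write \<open>\<mu>\<close> for the Gaussian measure on \<open>Z\<close>.  By means of the reproducing kernel
  \<open>exp (tr z w*)\<close> of the Bargmann space, a weakly measurable field \<open>F\<close> of Bargmann functions is
  jointly measurable in \<open>(s, z)\<close>, so that \<open>L\<^sup>2(S, \<nu>; K)\<close> becomes a subspace of the scalar space
  \<open>L\<^sup>2(S \<times> Z, \<nu> \<otimes> \<mu>)\<close> (\<open>H_vectors\<close>).  On the latter, \<open>N\<close> acts isometrically because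
  translations of \<open>Z\<close> change \<open>\<mu>\<close> by exactly the modulus squared of the multiplier of \<open>T\<^sup>1\<close>
  (\<open>gaussian_translate\<close>), and \<open>S\<close> acts by operators that are bounded because \<open>\<nu>\<close> is almost
  invariant (\<open>iwasawa_rep_bounded\<close>).

  The map \<open>\<beta>(g) = T(g)(f\<one>) - f\<one>\<close> is formally a coboundary, hence a cocycle as soon as its
  values are square integrable.  For \<open>g s\<^sub>0\<close> with \<open>g \<in> N\<close>, \<open>s\<^sub>0 \<in> S\<close>, it is the sum of
  \<open>T(g)\<close> applied to \<open>(f(s s\<^sub>0) - f(s))\<one>\<close>, which is controlled by the hypothesis on translates
  of \<open>f\<close>, and of \<open>f(s)(T\<^sub>s(g)\<one> - \<one>)\<close>.  Since \<open>T\<^sub>s(g)\<close> is unitary, the square of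
  \<open>\<parallel>T\<^sub>s(g)\<one> - \<one>\<parallel>\<close> is \<open>2 (1 - Re \<langle>T\<^sub>s(g)\<one>, \<one>\<rangle>)\<close>, and \<open>\<langle>T\<^sub>s(g)\<one>, \<one>\<rangle>\<close> is the value of the
  holomorphic function \<open>T\<^sub>s(g)\<one>\<close> at the origin, by the mean value property
  (\<open>gaussian_mean_value\<close>).  This is the exponential in the remaining hypothesis
  (\<open>vacuum_displacement\<close>).

  The hypotheses give no continuity of \<open>\<beta>\<close>, nor local boundedness of the norms of \<open>T(g)\<close>.
  Both representation and cocycle are, however, Borel measurable functions of \<open>g\<close> by Fubini's theorem, and
  the Iwasawa group is completely metrizable and the Hilbert space separable.  A Baire category
  argument in the manner of Pettis then makes every measurable cocycle continuous
  (\<open>pettis\<close>, \<open>automatic_continuity\<close>, \<open>cocycle_tends_to_0\<close>); applied to the coboundaries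
  \<open>T(g)F - F\<close> it gives strong continuity of \<open>T\<close>, applied to \<open>\<beta>\<close> continuity of the cocycle.

  If \<open>\<beta>(g) = T(g)\<xi> - \<xi>\<close> for all \<open>g\<close>, then \<open>f\<one> - \<xi>\<close> is fixed by the centre of \<open>N\<close>.  The
  element \<open>(i t 1, 0)\<close> acts on the fibre over \<open>s\<close> as multiplication by
  \<open>exp (i t tr s s*)\<close>, and \<open>tr s s* > 0\<close>, so \<open>f\<one> = \<xi>\<close> almost everywhere
  (\<open>fixed_by_center_imp_0\<close>).  This contradicts the divergence of the integral of \<open>f\<^sup>2\<close>.
\<close>


section \<open>Automatic continuity on completely metrizable groups\<close>

text \<open>
  Meagre subsets of a topological space: those covered by countably many closed sets with empty
  interior.
\<close>

definition meagre_in :: "'a topology \<Rightarrow> 'a set \<Rightarrow> bool" where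
  "meagre_in X A \<longleftrightarrow>
    (\<exists>\<G>. countable \<G> \<and> (\<forall>T\<in>\<G>. closedin X T \<and> X interior_of T = {}) \<and> A \<subseteq> \<Union>\<G>)"

lemma meagre_in_subset: "meagre_in X A \<Longrightarrow> B \<subseteq> A \<Longrightarrow> meagre_in X B"
  unfolding meagre_in_def by (meson subset_trans)

lemma meagre_in_empty: "meagre_in X {}"
  unfolding meagre_in_def by (intro exI[of _ "{}"]) auto

lemma meagre_in_UN:
  assumes "countable I" "\<And>i. i \<in> I \<Longrightarrow> meagre_in X (A i)"
  shows "meagre_in X (\<Union>i\<in>I. A i)"
proof -
  have "\<forall>i\<in>I. \<exists>\<G>. countable \<G> \<and> (\<forall>T\<in>\<G>. closedin X T \<and> X interior_of T = {}) \<and> A i \<subseteq> \<Union>\<G>"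
    using assms(2) by (simp add: meagre_in_def)
  from bchoice[OF this] obtain g where g: "\<forall>i\<in>I. countable (g i) \<and>
      (\<forall>T\<in>g i. closedin X T \<and> X interior_of T = {}) \<and> A i \<subseteq> \<Union>(g i)"
    by (elim exE)
  show ?thesis
    unfolding meagre_in_def
  proof (intro exI[of _ "\<Union>i\<in>I. g i"] conjI)
    show "countable (\<Union>i\<in>I. g i)" using g assms(1) by simp
    show "\<forall>T\<in>\<Union>i\<in>I. g i. closedin X T \<and> X interior_of T = {}" using g by simp
    show "(\<Union>i\<in>I. A i) \<subseteq> \<Union>(\<Union>i\<in>I. g i)" using g by fastforce
  qed
qed

lemma meagre_in_Un: "meagre_in X A \<Longrightarrow> meagre_in X B \<Longrightarrow> meagre_in X (A \<union> B)"
  using meagre_in_UN[of "{True, False}" X "\<lambda>b. if b then A else B"] by (auto simp: Un_commute)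

lemma meagre_in_nowhere_dense:
  "closedin X T \<Longrightarrow> X interior_of T = {} \<Longrightarrow> meagre_in X T"
  unfolding meagre_in_def by (intro exI[of _ "{T}"]) auto

lemma meagre_in_homeomorphic_image:
  assumes "homeomorphic_map X X g" "meagre_in X A"
  shows "meagre_in X (g ` A)"
proof -
  obtain \<G> where \<G>: "countable \<G>" "\<And>T. T \<in> \<G> \<Longrightarrow> closedin X T \<and> X interior_of T = {}" "A \<subseteq> \<Union>\<G>"
    using assms(2) unfolding meagre_in_def by blast
  have "closedin X (g ` T) \<and> X interior_of (g ` T) = {}" if "T \<in> \<G>" for T
  proof -
    have "T \<subseteq> topspace X" using \<G>(2)[OF that] closedin_subset by blast
    then show ?thesis
      using \<G>(2)[OF that] homeomorphic_map_closedness[OF assms(1)]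
        homeomorphic_map_interior_of[OF assms(1)] by auto
  qed
  then show ?thesis
    unfolding meagre_in_def by (intro exI[of _ "(`) g ` \<G>"]) (use \<G> in \<open>auto, fast\<close>)
qed

lemma not_meagre_in_open:
  assumes "completely_metrizable_space X" "openin X U" "U \<noteq> {}"
  shows "\<not> meagre_in X U"
proof
  assume "meagre_in X U"
  then obtain \<G> where \<G>: "countable \<G>" "\<And>T. T \<in> \<G> \<Longrightarrow> closedin X T \<and> X interior_of T = {}" "U \<subseteq> \<Union>\<G>"
    unfolding meagre_in_def by blast
  have "X interior_of \<Union>\<G> = {}"
    using Baire_category_alt[of X \<G>] assms(1) \<G> by blast
  then show False
    using interior_of_maximal[OF \<G>(3) assms(2)] assms(3) by auto
qed

text \<open>
  Sets with the Baire property, that is, sets that differ from an open set by a meagre set.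
\<close>

definition almost_open :: "'a topology \<Rightarrow> 'a set \<Rightarrow> bool" where
  "almost_open X A \<longleftrightarrow> (\<exists>U. openin X U \<and> meagre_in X ((A - U) \<union> (U - A)))"

lemma almost_open_openin: "openin X A \<Longrightarrow> almost_open X A"
  unfolding almost_open_def by (intro exI[of _ A]) (auto simp: meagre_in_empty)

lemma almost_open_compl:
  assumes "almost_open X A"
  shows "almost_open X (topspace X - A)"
proof -
  obtain U where U: "openin X U" "meagre_in X ((A - U) \<union> (U - A))"
    using assms unfolding almost_open_def by blast
  define C where "C = topspace X - U"
  have C: "closedin X C" using U(1) by (auto simp: C_def)
  define V where "V = X interior_of C"
  have V: "openin X V" "V \<subseteq> C" by (auto simp: V_def interior_of_subset)
  \<comment> \<open>The complement of an open set differs from its own interior by a nowhere dense set.\<close>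
  have "closedin X (C - V)" using C V by blast
  moreover have "X interior_of (C - V) = {}"
  proof -
    have "X interior_of (C - V) \<subseteq> V"
      unfolding V_def by (intro interior_of_mono) auto
    moreover have "X interior_of (C - V) \<subseteq> C - V" by (rule interior_of_subset)
    ultimately show ?thesis by blast
  qed
  ultimately have "meagre_in X (C - V)" by (rule meagre_in_nowhere_dense)
  then have "meagre_in X (((A - U) \<union> (U - A)) \<union> (C - V))" using U(2) by (rule meagre_in_Un[rotated])
  then have "meagre_in X (((topspace X - A) - V) \<union> (V - (topspace X - A)))"
    by (rule meagre_in_subset) (use V U(1)[THEN openin_subset] in \<open>auto simp: C_def\<close>)
  then show ?thesis unfolding almost_open_def using V by blast
qed

lemma almost_open_UN:
  assumes "\<And>i::nat. almost_open X (A i)"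
  shows "almost_open X (\<Union>i. A i)"
proof -
  have "\<forall>i. \<exists>U. openin X U \<and> meagre_in X ((A i - U) \<union> (U - A i))"
    using assms by (simp add: almost_open_def)
  from choice[OF this] obtain U where
    U: "\<forall>i. openin X (U i) \<and> meagre_in X ((A i - U i) \<union> (U i - A i))"
    by (elim exE)
  have "meagre_in X (\<Union>i. (A i - U i) \<union> (U i - A i))"
    by (rule meagre_in_UN) (use U in auto)
  then have "meagre_in X (((\<Union>i. A i) - (\<Union>i. U i)) \<union> ((\<Union>i. U i) - (\<Union>i. A i)))"
    by (rule meagre_in_subset) auto
  moreover have "openin X (\<Union>i. U i)" using U by (intro openin_Union) auto
  ultimately show ?thesis unfolding almost_open_def by (intro exI conjI)
qed

text \<open>
  Borel sets have the Baire property, since the sets with this property form a sigma algebra that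
  contains the open sets.
\<close>

lemma almost_open_borel:
  fixes C :: "'a::topological_space set"
  assumes "A \<in> sets (restrict_space borel C)"
  shows "almost_open (top_of_set C) A"
proof -
  obtain B where B: "A = C \<inter> B" "B \<in> sigma_sets UNIV {S. open S}"
    using assms by (auto simp: sets_restrict_space borel_def)
  have "almost_open (top_of_set C) (C \<inter> B)"
    using B(2)
  proof (induction rule: sigma_sets.induct)
    case (Basic a)
    then show ?case by (intro almost_open_openin) auto
  next
    case Empty
    show ?case by (intro almost_open_openin) auto
  next
    case (Compl a)
    moreover have "C \<inter> (UNIV - a) = C - C \<inter> a" by auto
    ultimately show ?case using almost_open_compl[of "top_of_set C" "C \<inter> a"] by simp
  next
    case (Union a)
    then have "almost_open (top_of_set C) (\<Union>i. C \<inter> a i)" by (intro almost_open_UN)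
    then show ?case by (simp only: Int_UN_distrib)
  qed
  then show ?thesis by (simp only: B(1))
qed

text \<open>
  The form of Pettis' lemma used here: if countably many Borel sets cover a completely metrizable
  group, then for one of them, \<open>E\<close> say, the quotients \<open>b\<^sup>-\<^sup>1 a\<close> with \<open>a, b \<in> E\<close> fill a
  neighbourhood of the unit.  Indeed, some \<open>E\<close> is not meagre and agrees with a nonempty open
  set \<open>U\<close> up to a meagre set.  For \<open>x\<close> close to the unit \<open>U\<close> meets its right translate
  \<open>U x\<^sup>-\<^sup>1\<close> in a nonempty open set, which by Baire's theorem is not contained in the exceptional
  meagre set.
\<close>

lemma pettis:
  fixes G (structure) and E :: "nat \<Rightarrow> 'g::topological_space set"
  assumes "group G"
    and compl: "completely_metrizable_space (top_of_set (carrier G))"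
    and contl: "\<And>x. x \<in> carrier G \<Longrightarrow> continuous_on (carrier G) (\<lambda>b. x \<otimes> b)"
    and contr: "\<And>x. x \<in> carrier G \<Longrightarrow> continuous_on (carrier G) (\<lambda>b. b \<otimes> x)"
    and meas: "\<And>k. E k \<in> sets (restrict_space borel (carrier G))"
    and cover: "carrier G \<subseteq> (\<Union>k. E k)"
  shows "\<exists>k U. openin (top_of_set (carrier G)) U \<and> \<one> \<in> U \<and> (\<forall>x\<in>U. \<exists>b\<in>E k. b \<otimes> x \<in> E k)"
proof -
  interpret group G by fact
  let ?X = "top_of_set (carrier G)"
  obtain k where k: "\<not> meagre_in ?X (E k)"
  proof (rule ccontr)
    assume "\<not> thesis"
    then have "meagre_in ?X (\<Union>k. E k)" by (intro meagre_in_UN) (use that in auto)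
    then have "meagre_in ?X (carrier G)" using cover meagre_in_subset by blast
    moreover have "\<not> meagre_in ?X (carrier G)"
      by (rule not_meagre_in_open[OF compl]) auto
    ultimately show False by blast
  qed
  obtain U where U: "openin ?X U" "meagre_in ?X ((E k - U) \<union> (U - E k))"
    using almost_open_borel[OF meas[of k]] unfolding almost_open_def by blast
  have "U \<noteq> {}" using U(2) k by auto
  then obtain u where u: "u \<in> U" by blast
  have UC: "U \<subseteq> carrier G" using openin_subset[OF U(1)] by simp
  have uC: "u \<in> carrier G" using u UC by blast
  define V where "V = {x \<in> carrier G. u \<otimes> x \<in> U}"
  have "continuous_map ?X ?X (\<lambda>x. u \<otimes> x)"
    using contl[OF uC] uC by (auto simp: continuous_map_in_subtopology)
  then have V: "openin ?X V"
    unfolding V_def using openin_continuous_map_preimage[of ?X ?X "\<lambda>x. u \<otimes> x" U] U(1) by simp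
  have 1: "\<one> \<in> V" using u uC by (simp add: V_def)
  have "\<exists>b\<in>E k. b \<otimes> x \<in> E k" if x: "x \<in> V" for x
  proof -
    have xC: "x \<in> carrier G" and ux: "u \<otimes> x \<in> U" using x by (auto simp: V_def)
    have contx: "continuous_map ?X ?X (\<lambda>b. b \<otimes> y)" if "y \<in> carrier G" for y
      using contr[OF that] that by (auto simp: continuous_map_in_subtopology)
    have hom: "homeomorphic_map ?X ?X (\<lambda>b. b \<otimes> inv x)"
      unfolding homeomorphic_map_maps
      by (rule exI[of _ "\<lambda>b. b \<otimes> x"])
        (use xC contx[OF xC] contx[of "inv x"] in \<open>simp add: homeomorphic_maps_def m_assoc\<close>)
    define O' where "O' = U \<inter> {b \<in> carrier G. b \<otimes> x \<in> U}"
    have "openin ?X {b \<in> carrier G. b \<otimes> x \<in> U}"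
      using openin_continuous_map_preimage[OF contx[OF xC], of U] U(1) by simp
    then have "openin ?X O'" unfolding O'_def using U(1) by blast
    moreover have "O' \<noteq> {}" using u uC ux by (auto simp: O'_def)
    ultimately have nm: "\<not> meagre_in ?X O'" by (rule not_meagre_in_open[OF compl])
    define D where "D = (E k - U) \<union> (U - E k)"
    have "meagre_in ?X (D \<union> (\<lambda>b. b \<otimes> inv x) ` D)"
      using U(2) meagre_in_homeomorphic_image[OF hom] by (intro meagre_in_Un) (auto simp: D_def)
    then have "\<not> O' \<subseteq> D \<union> (\<lambda>b. b \<otimes> inv x) ` D" using nm meagre_in_subset by blast
    then obtain b where b: "b \<in> O'" "b \<notin> D" "b \<notin> (\<lambda>b. b \<otimes> inv x) ` D" by blast
    have bC: "b \<in> carrier G" using b(1) UC by (auto simp: O'_def)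
    have "b = (b \<otimes> x) \<otimes> inv x" using bC xC by (simp add: m_assoc)
    then have "b \<otimes> x \<notin> D" using b(3) by blast
    then show ?thesis using b(1,2) by (auto simp: O'_def D_def)
  qed
  then show ?thesis using V 1 by blast
qed

text \<open>
  The abstract form of the statement that measurable cocycles are continuous at the unit.
  In the application \<open>n x\<close> is the size of \<open>\<beta>(x)\<close> and \<open>\<delta> a b\<close> that of \<open>\<beta>(a) - \<beta>(b)\<close>.  The cocycle
  identity \<open>\<beta>(b x) - \<beta>(b) = T(b) \<beta>(x)\<close> gives the hypothesis \<open>bound\<close> on the set \<open>W m\<close> of those \<open>b\<close>
  for which \<open>T(b)\<close> has a lower bound depending on \<open>m\<close> only, and separability of the Hilbert space gives the hypothesis
  \<open>small\<close>.
\<close>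

lemma automatic_continuity:
  fixes G (structure) and W :: "nat \<Rightarrow> 'g::topological_space set"
    and \<delta> :: "'g \<Rightarrow> 'g \<Rightarrow> real" and n :: "'g \<Rightarrow> real"
  assumes "group G"
    and compl: "completely_metrizable_space (top_of_set (carrier G))"
    and contl: "\<And>x. x \<in> carrier G \<Longrightarrow> continuous_on (carrier G) (\<lambda>b. x \<otimes> b)"
    and contr: "\<And>x. x \<in> carrier G \<Longrightarrow> continuous_on (carrier G) (\<lambda>b. b \<otimes> x)"
    and W: "\<And>m. W m \<in> sets (restrict_space borel (carrier G))" "carrier G \<subseteq> (\<Union>m. W m)"
    and bound: "\<And>m b x. b \<in> W m \<Longrightarrow> x \<in> carrier G \<Longrightarrow> n x \<le> real m * \<delta> (b \<otimes> x) b"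
    and small: "\<And>e. 0 < e \<Longrightarrow> \<exists>E::nat \<Rightarrow> 'g set. (\<forall>k. E k \<in> sets (restrict_space borel (carrier G))) \<and>
        carrier G \<subseteq> (\<Union>k. E k) \<and> (\<forall>k. \<forall>a\<in>E k. \<forall>b\<in>E k. \<delta> a b \<le> e)"
    and nonneg: "\<And>x. 0 \<le> n x"
  shows "(n \<longlongrightarrow> 0) (at \<one> within carrier G)"
proof (rule tendstoI)
  interpret group G by fact
  fix e :: real assume e: "0 < e"
  \<comment> \<open>The mesh of the second cover depends on \<open>m\<close>, so that a single use of Pettis' lemma suffices.\<close>
  define \<epsilon> where "\<epsilon> m = e / (2 * (real m + 1))" for m
  have "\<forall>m. \<exists>E::nat \<Rightarrow> 'g set. (\<forall>k. E k \<in> sets (restrict_space borel (carrier G))) \<and>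
        carrier G \<subseteq> (\<Union>k. E k) \<and> (\<forall>k. \<forall>a\<in>E k. \<forall>b\<in>E k. \<delta> a b \<le> \<epsilon> m)"
    using e by (intro allI small) (auto simp: \<epsilon>_def)
  then obtain E :: "nat \<Rightarrow> nat \<Rightarrow> 'g set" where E:
    "\<And>m k. E m k \<in> sets (restrict_space borel (carrier G))"
    "\<And>m. carrier G \<subseteq> (\<Union>k. E m k)" "\<And>m k a b. a \<in> E m k \<Longrightarrow> b \<in> E m k \<Longrightarrow> \<delta> a b \<le> \<epsilon> m"
    by metis
  define D where "D j = (case prod_decode j of (m, k) \<Rightarrow> W m \<inter> E m k)" for j
  have cov: "carrier G \<subseteq> (\<Union>j. D j)"
  proof
    fix g assume g: "g \<in> carrier G"
    obtain m where m: "g \<in> W m" using W(2) g by blast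
    obtain k where k: "g \<in> E m k" using E(2) g by blast
    have "g \<in> D (prod_encode (m, k))" using m k by (simp add: D_def)
    then show "g \<in> (\<Union>j. D j)" by blast
  qed
  have "D j \<in> sets (restrict_space borel (carrier G))" for j
    unfolding D_def using W(1) E(1) by (cases "prod_decode j") auto
  from pettis[OF assms(1) compl contl contr this cov] obtain j U where
    U: "openin (top_of_set (carrier G)) U" "\<one> \<in> U" "\<And>x. x \<in> U \<Longrightarrow> \<exists>b\<in>D j. b \<otimes> x \<in> D j"
    by blast
  obtain m k where mk: "prod_decode j = (m, k)" by force
  have "n x < e" if x: "x \<in> U" for x
  proof -
    obtain b where b: "b \<in> D j" "b \<otimes> x \<in> D j" using U(3)[OF x] by blast
    have "x \<in> carrier G" using openin_subset[OF U(1)] x by auto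
    then have "n x \<le> real m * \<delta> (b \<otimes> x) b" using bound[of b m x] b mk by (auto simp: D_def)
    also have "\<dots> \<le> real m * \<epsilon> m"
      using b mk E(3)[of "b \<otimes> x" m k b] by (intro mult_left_mono) (auto simp: D_def)
    also have "\<dots> < e" using e mult_nonneg_nonneg[of e "real m"] by (simp add: \<epsilon>_def field_simps del: mult_nonneg_nonneg)
    finally show ?thesis .
  qed
  then have *: "\<And>x. x \<in> U \<Longrightarrow> dist (n x) 0 < e" using nonneg by simp
  obtain T where T: "open T" "U = carrier G \<inter> T"
    using U(1) unfolding openin_open by auto
  show "\<forall>\<^sub>F x in at \<one> within carrier G. dist (n x) 0 < e"
    unfolding eventually_at_topological
  proof (intro exI[of _ T] conjI ballI impI)
    show "\<one> \<in> T" using T(2) U(2) by simp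
    show "dist (n x) 0 < e" if "x \<in> T" "x \<in> carrier G" for x
      using that T(2) by (intro *) simp
  qed (rule T(1))
qed

section \<open>The space of square integrable functions\<close>

text \<open>
  Square integrable complex functions, before the passage to classes modulo null functions, and
  the square of their norm.  The inequality \<open>\<parallel>f + g\<parallel>\<^sup>2 \<le> 2\<parallel>f\<parallel>\<^sup>2 + 2\<parallel>g\<parallel>\<^sup>2\<close> replaces the triangle
  inequality throughout.
\<close>

definition L2 :: "'a measure \<Rightarrow> ('a \<Rightarrow> complex) set" where
  "L2 M = {f \<in> borel_measurable M. integrable M (\<lambda>x. (cmod (f x))\<^sup>2)}"

definition sqnorm :: "'a measure \<Rightarrow> ('a \<Rightarrow> complex) \<Rightarrow> real" where
  "sqnorm M f = (\<integral>x. (cmod (f x))\<^sup>2 \<partial>M)"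

lemma L2_measurable [measurable_dest]: "f \<in> L2 M \<Longrightarrow> f \<in> borel_measurable M"
  by (simp add: L2_def)

lemma L2_integrable: "f \<in> L2 M \<Longrightarrow> integrable M (\<lambda>x. (cmod (f x))\<^sup>2)"
  by (simp add: L2_def)

lemma sqnorm_nonneg: "0 \<le> sqnorm M f"
  by (simp add: sqnorm_def)

lemma L2_cong: "(\<And>x. x \<in> space M \<Longrightarrow> f x = g x) \<Longrightarrow> f \<in> L2 M \<longleftrightarrow> g \<in> L2 M"
  unfolding L2_def by (auto cong: measurable_cong Bochner_Integration.integrable_cong)

lemma sqnorm_cong: "(\<And>x. x \<in> space M \<Longrightarrow> f x = g x) \<Longrightarrow> sqnorm M f = sqnorm M g"
  unfolding sqnorm_def by (auto cong: Bochner_Integration.integral_cong)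

lemma cmod_add_squared_le: "(cmod (a + b))\<^sup>2 \<le> 2 * (cmod a)\<^sup>2 + 2 * (cmod b)\<^sup>2"
proof -
  have "(cmod (a + b))\<^sup>2 \<le> (cmod a + cmod b)\<^sup>2"
    by (intro power_mono norm_triangle_ineq) auto
  also have "\<dots> \<le> 2 * (cmod a)\<^sup>2 + 2 * (cmod b)\<^sup>2"
    using sum_squares_ge_zero[of "cmod a - cmod b" 0] by (simp add: power2_eq_square algebra_simps)
  finally show ?thesis .
qed

lemma L2_dominated:
  assumes "f \<in> borel_measurable M" "integrable M h" "\<And>x. x \<in> space M \<Longrightarrow> (cmod (f x))\<^sup>2 \<le> h x"
  shows "f \<in> L2 M" "sqnorm M f \<le> (\<integral>x. h x \<partial>M)"
proof -
  have "integrable M (\<lambda>x. (cmod (f x))\<^sup>2)"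
    by (rule Bochner_Integration.integrable_bound[OF assms(2)])
      (use assms(1) in measurable, use assms(3) in \<open>auto intro!: order_trans[OF assms(3)]\<close>)
  then show "f \<in> L2 M" "sqnorm M f \<le> (\<integral>x. h x \<partial>M)"
    using assms unfolding L2_def sqnorm_def by (auto intro!: integral_mono)
qed

lemma L2_add:
  assumes "f \<in> L2 M" "g \<in> L2 M"
  shows "(\<lambda>x. f x + g x) \<in> L2 M"
    "sqnorm M (\<lambda>x. f x + g x) \<le> 2 * sqnorm M f + 2 * sqnorm M g"
proof -
  have m: "(\<lambda>x. f x + g x) \<in> borel_measurable M"
    using assms by (auto simp: L2_def)
  have i: "integrable M (\<lambda>x. 2 * (cmod (f x))\<^sup>2 + 2 * (cmod (g x))\<^sup>2)"
    using assms by (auto simp: L2_def)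
  note * = L2_dominated[OF m i cmod_add_squared_le]
  show "(\<lambda>x. f x + g x) \<in> L2 M" by (rule *(1))
  show "sqnorm M (\<lambda>x. f x + g x) \<le> 2 * sqnorm M f + 2 * sqnorm M g"
    using *(2) assms by (simp add: L2_def sqnorm_def)
qed

lemma L2_scale:
  assumes "f \<in> L2 M"
  shows "(\<lambda>x. c * f x) \<in> L2 M" "sqnorm M (\<lambda>x. c * f x) = (cmod c)\<^sup>2 * sqnorm M f"
  using assms by (auto simp: L2_def sqnorm_def norm_mult power_mult_distrib)

lemma L2_diff:
  assumes "f \<in> L2 M" "g \<in> L2 M"
  shows "(\<lambda>x. f x - g x) \<in> L2 M"
    "sqnorm M (\<lambda>x. f x - g x) \<le> 2 * sqnorm M f + 2 * sqnorm M g"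
  using L2_add[OF assms(1) L2_scale(1)[OF assms(2), of "-1"]] L2_scale(2)[OF assms(2), of "-1"]
  by simp_all

lemma sqnorm_minus_commute: "sqnorm M (\<lambda>x. f x - g x) = sqnorm M (\<lambda>x. g x - f x)"
  by (simp add: sqnorm_def norm_minus_commute)

lemma sqnorm_diff_triangle:
  assumes "f \<in> L2 M" "g \<in> L2 M" "h \<in> L2 M"
  shows "sqnorm M (\<lambda>x. f x - h x) \<le> 2 * sqnorm M (\<lambda>x. f x - g x) + 2 * sqnorm M (\<lambda>x. g x - h x)"
  using L2_add(2)[OF L2_diff(1)[OF assms(1,2)] L2_diff(1)[OF assms(2,3)]] by simp

lemma sqnorm_dominated_convergence:
  assumes f: "f \<in> L2 M" and g: "\<And>i. g i \<in> borel_measurable M"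
    and le: "\<And>i x. x \<in> space M \<Longrightarrow> cmod (g i x) \<le> K * cmod (f x)"
    and lim: "\<And>x. x \<in> space M \<Longrightarrow> (\<lambda>i::nat. g i x) \<longlonglongrightarrow> f x"
  shows "(\<lambda>i. sqnorm M (\<lambda>x. f x - g i x)) \<longlonglongrightarrow> 0"
proof -
  have [measurable]: "f \<in> borel_measurable M" "\<And>i. g i \<in> borel_measurable M"
    using f g by (auto simp: L2_def)
  have "(\<lambda>i. \<integral>x. (cmod (f x - g i x))\<^sup>2 \<partial>M) \<longlonglongrightarrow> (\<integral>x. 0 \<partial>M)"
  proof (rule integral_dominated_convergence[where w = "\<lambda>x. (1 + K)\<^sup>2 * (cmod (f x))\<^sup>2"])
    show "integrable M (\<lambda>x. (1 + K)\<^sup>2 * (cmod (f x))\<^sup>2)" using f by (auto simp: L2_def)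
    show "AE x in M. (\<lambda>i. (cmod (f x - g i x))\<^sup>2) \<longlonglongrightarrow> 0"
    proof (rule AE_I2)
      fix x assume "x \<in> space M"
      then have "(\<lambda>i. (cmod (f x - g i x))\<^sup>2) \<longlonglongrightarrow> (cmod (f x - f x))\<^sup>2"
        by (intro tendsto_intros lim)
      then show "(\<lambda>i. (cmod (f x - g i x))\<^sup>2) \<longlonglongrightarrow> 0" by simp
    qed
    show "AE x in M. norm ((cmod (f x - g i x))\<^sup>2) \<le> (1 + K)\<^sup>2 * (cmod (f x))\<^sup>2" for i
    proof (rule AE_I2)
      fix x assume "x \<in> space M"
      then have "cmod (f x - g i x) \<le> (1 + K) * cmod (f x)"
        using norm_triangle_ineq4[of "f x" "g i x"] le[of x i] by (simp add: algebra_simps)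
      then show "norm ((cmod (f x - g i x))\<^sup>2) \<le> (1 + K)\<^sup>2 * (cmod (f x))\<^sup>2"
        by (simp add: power_mono flip: power_mult_distrib)
    qed
  qed auto
  then show ?thesis by (simp add: sqnorm_def)
qed

text \<open>
  Separability of \<open>L\<^sup>2\<close> over a sigma finite measure whose sigma algebra is countably generated.
  A countable dense set is given by the finite sums of \<open>c 1\<^bsub>A \<inter> \<Omega>\<^sub>n\<^esub>\<close> with \<open>A\<close> in the generator,
  \<open>c\<close> in a countable dense set of scalars, and \<open>\<Omega>\<^sub>n\<close> an increasing exhaustion by sets of finite
  measure.  Its closure contains \<open>c 1\<^bsub>A \<inter> \<Omega>\<^sub>n\<^esub>\<close> for all measurable \<open>A\<close> by Dynkin's \<open>\<pi>\<close>-\<open>\<lambda>\<close> theorem, hence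
  all simple functions cut off to some \<open>\<Omega>\<^sub>n\<close>, hence everything by dominated convergence.
\<close>

lemma L2_separable:
  fixes M :: "'a measure"
  assumes "sigma_finite_measure M" and \<A>: "countable \<A>" "Int_stable \<A>" "\<A> \<subseteq> Pow (space M)"
    and sets: "sets M = sigma_sets (space M) \<A>" and top: "space M \<in> \<A>"
  shows "\<exists>D. countable D \<and> D \<subseteq> L2 M \<and>
    (\<forall>f\<in>L2 M. \<forall>e>0. \<exists>d\<in>D. sqnorm M (\<lambda>x. f x - d x) < e)"
proof -
  interpret sigma_finite_measure M by fact
  obtain \<Omega> :: "nat \<Rightarrow> 'a set" where \<Omega>: "range \<Omega> \<subseteq> sets M" "(\<Union>i. \<Omega> i) = space M"
    "\<And>i. emeasure M (\<Omega> i) \<noteq> \<infinity>" "incseq \<Omega>"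
    using sigma_finite_incseq by blast
  have \<Omega>_sets [measurable]: "\<Omega> n \<in> sets M" for n using \<Omega>(1) by auto
  obtain Q :: "complex set" where Q: "countable Q" "\<And>X. open X \<Longrightarrow> X \<noteq> {} \<Longrightarrow> \<exists>d\<in>Q. d \<in> X"
    using countable_dense_setE by blast
  define D where "D = (\<lambda>l x. \<Sum>(c, A, n)\<leftarrow>l. c * indicator (A \<inter> \<Omega> n) x) ` lists (Q \<times> \<A> \<times> (UNIV :: nat set))"
  have "countable D"
    unfolding D_def using Q(1) \<A>(1) by (intro countable_image countable_lists countable_SIGMA) auto
  have \<A>_sets: "A \<in> sets M" if "A \<in> \<A>" for A using that sets by auto
  have ind: "(\<lambda>x. c * indicator (A \<inter> \<Omega> n) x) \<in> L2 M \<and>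
      sqnorm M (\<lambda>x. c * indicator (A \<inter> \<Omega> n) x) \<le> (cmod c)\<^sup>2 * measure M (\<Omega> n)"
    if A: "A \<in> sets M" for A n and c :: complex
  proof -
    have i: "integrable M (\<lambda>x. (cmod c)\<^sup>2 * indicator (\<Omega> n) x :: real)"
      using \<Omega>(3)[of n] by (auto simp: top.not_eq_extremum)
    have "(\<lambda>x. c * indicator (A \<inter> \<Omega> n) x) \<in> borel_measurable M" using A by measurable
    moreover have "(cmod (c * indicator (A \<inter> \<Omega> n) x))\<^sup>2 \<le> (cmod c)\<^sup>2 * indicator (\<Omega> n) x" for x
      by (simp add: indicator_def)
    moreover have "(\<integral>x. (cmod c)\<^sup>2 * indicator (\<Omega> n) x \<partial>M) = (cmod c)\<^sup>2 * measure M (\<Omega> n)"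
      by simp
    ultimately show ?thesis using L2_dominated[OF _ i] by metis
  qed
  have D_E: "\<exists>l\<in>lists (Q \<times> \<A> \<times> UNIV). d = (\<lambda>x. \<Sum>(c, A, n)\<leftarrow>l. c * indicator (A \<inter> \<Omega> n) x)" if "d \<in> D" for d
    using that unfolding D_def image_iff .
  have D0: "(\<lambda>x. 0) \<in> D"
    unfolding D_def by (rule image_eqI[of _ _ "[]"]) auto
  have D_add: "(\<lambda>x. d x + d' x) \<in> D" if "d \<in> D" "d' \<in> D" for d d'
  proof -
    obtain l where "l \<in> lists (Q \<times> \<A> \<times> UNIV)" "d = (\<lambda>x. \<Sum>(c, A, n)\<leftarrow>l. c * indicator (A \<inter> \<Omega> n) x)"
      using D_E[OF \<open>d \<in> D\<close>] by (elim bexE)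
    moreover obtain l' where "l' \<in> lists (Q \<times> \<A> \<times> UNIV)" "d' = (\<lambda>x. \<Sum>(c, A, n)\<leftarrow>l'. c * indicator (A \<inter> \<Omega> n) x)"
      using D_E[OF \<open>d' \<in> D\<close>] by (elim bexE)
    ultimately show ?thesis unfolding D_def by (intro image_eqI[of _ _ "l @ l'"]) auto
  qed
  have D_single: "(\<lambda>x. c * indicator (A \<inter> \<Omega> n) x) \<in> D" if "c \<in> Q" "A \<in> \<A>" for c A n
    unfolding D_def by (rule image_eqI[of _ _ "[(c, A, n)]"]) (use that in auto)
  have D_L2: "D \<subseteq> L2 M"
  proof
    fix d assume "d \<in> D"
    obtain l where l: "l \<in> lists (Q \<times> \<A> \<times> UNIV)" "d = (\<lambda>x. \<Sum>(c, A, n)\<leftarrow>l. c * indicator (A \<inter> \<Omega> n) x)"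
      using D_E[OF \<open>d \<in> D\<close>] by (elim bexE)
    from l(1) have "(\<lambda>x. \<Sum>(c, A, n)\<leftarrow>l. c * indicator (A \<inter> \<Omega> n) x :: complex) \<in> L2 M"
    proof (induction l)
      case Nil
      then show ?case by (simp add: L2_def)
    next
      case (Cons a l)
      obtain c A n where a: "a = (c, A, n)" by (cases a)
      show ?case using Cons \<A>_sets L2_add(1)[OF conjunct1[OF ind[of A c n]]] by (auto simp: a)
    qed
    then show "d \<in> L2 M" using l(2) by simp
  qed
  \<comment> \<open>\<open>V\<close> is the closure of \<open>D\<close>.\<close>
  define V where "V f \<longleftrightarrow> f \<in> L2 M \<and> (\<forall>e>0. \<exists>d\<in>D. sqnorm M (\<lambda>x. f x - d x) < e)" for f
  have V_cong: "V g" if eq: "\<And>x. x \<in> space M \<Longrightarrow> f x = g x" and "V f" for f g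
  proof -
    have "sqnorm M (\<lambda>x. g x - d x) = sqnorm M (\<lambda>x. f x - d x)" for d
      by (rule sqnorm_cong) (simp add: eq)
    moreover have "g \<in> L2 M \<longleftrightarrow> f \<in> L2 M" by (rule L2_cong) (simp add: eq)
    ultimately show ?thesis using \<open>V f\<close> by (simp add: V_def)
  qed
  have V_E: "\<exists>d\<in>D. sqnorm M (\<lambda>x. f x - d x) < e" if "V f" "0 < e" for f e
    using that by (simp add: V_def)
  have V_lim: "V f" if f: "f \<in> L2 M" and g: "\<And>i::nat. V (g i)"
    and lim: "(\<lambda>i. sqnorm M (\<lambda>x. f x - g i x)) \<longlonglongrightarrow> 0" for f g
    unfolding V_def
  proof (intro conjI f allI impI)
    fix e :: real assume "0 < e"
    then have "\<forall>\<^sub>F i in sequentially. sqnorm M (\<lambda>x. f x - g i x) < e / 4"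
      using order_tendstoD(2)[OF lim, of "e/4"] by simp
    then obtain i where i: "sqnorm M (\<lambda>x. f x - g i x) < e / 4"
      by (auto simp: eventually_sequentially)
    obtain d where d: "d \<in> D" "sqnorm M (\<lambda>x. g i x - d x) < e / 4"
      using V_E[OF g[of i], of "e / 4"] \<open>0 < e\<close> by auto
    show "\<exists>d\<in>D. sqnorm M (\<lambda>x. f x - d x) < e"
      using sqnorm_diff_triangle[of f M "g i" d] f g[of i] D_L2 d i by (intro bexI[of _ d]) (auto simp: V_def)
  qed
  have V_add: "V (\<lambda>x. f x + g x)" if "V f" "V g" for f g
    unfolding V_def
  proof (intro conjI allI impI)
    show "(\<lambda>x. f x + g x) \<in> L2 M" using that by (auto simp: V_def intro: L2_add)
    fix e :: real assume "0 < e"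
    then have e4: "0 < e / 4" by simp
    obtain d where d: "d \<in> D" "sqnorm M (\<lambda>x. f x - d x) < e / 4"
      using V_E[OF \<open>V f\<close> e4] by (elim bexE)
    obtain d' where d': "d' \<in> D" "sqnorm M (\<lambda>x. g x - d' x) < e / 4"
      using V_E[OF \<open>V g\<close> e4] by (elim bexE)
    have "sqnorm M (\<lambda>x. (f x - d x) + (g x - d' x)) \<le> 2 * sqnorm M (\<lambda>x. f x - d x) + 2 * sqnorm M (\<lambda>x. g x - d' x)"
      using that d(1) d'(1) D_L2 by (intro L2_add L2_diff) (auto simp: V_def)
    also have "\<dots> < e" using d(2) d'(2) by linarith
    finally show "\<exists>d\<in>D. sqnorm M (\<lambda>x. (f x + g x) - d x) < e"
      by (intro bexI[OF _ D_add[OF d(1) d'(1)]]) (simp add: algebra_simps)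
  qed
  have V_0: "V (\<lambda>x. 0)"
    unfolding V_def using D0 by (auto simp: L2_def sqnorm_def intro!: bexI[of _ "\<lambda>x. 0"])
  have V_base: "V (\<lambda>x. c * indicator (A \<inter> \<Omega> n) x)" if A: "A \<in> \<A>" for A c n
    unfolding V_def
  proof (intro conjI allI impI)
    show "(\<lambda>x. c * indicator (A \<inter> \<Omega> n) x) \<in> L2 M" using ind \<A>_sets[OF A] by blast
    fix e :: real assume e: "0 < e"
    define r where "r = sqrt (e / (measure M (\<Omega> n) + 1))"
    have r: "0 < r" "r\<^sup>2 * measure M (\<Omega> n) < e"
    proof -
      have m: "0 < measure M (\<Omega> n) + 1" by (simp add: add_nonneg_pos)
      then show "0 < r" using e by (simp add: r_def)
      have "r\<^sup>2 = e / (measure M (\<Omega> n) + 1)" using e m by (simp add: r_def)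
      then have "r\<^sup>2 * measure M (\<Omega> n) = e - r\<^sup>2" using e m by (simp add: field_simps)
      moreover have "0 < r\<^sup>2" using \<open>0 < r\<close> by simp
      ultimately show "r\<^sup>2 * measure M (\<Omega> n) < e" by linarith
    qed
    obtain q where q: "q \<in> Q" "q \<in> ball c r"
      using Q(2)[of "ball c r"] r by auto
    have "sqnorm M (\<lambda>x. (c - q) * indicator (A \<inter> \<Omega> n) x) \<le> (cmod (c - q))\<^sup>2 * measure M (\<Omega> n)"
      using ind \<A>_sets[OF A] by blast
    also have "\<dots> \<le> r\<^sup>2 * measure M (\<Omega> n)"
      using q(2) by (intro mult_right_mono power_mono) (auto simp: dist_norm)
    also note r(2)
    finally show "\<exists>d\<in>D. sqnorm M (\<lambda>x. c * indicator (A \<inter> \<Omega> n) x - d x) < e"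
      by (intro bexI[OF _ D_single[OF q(1) A]]) (simp add: left_diff_distrib)
  qed
  have V_set: "V (\<lambda>x. c * indicator (A \<inter> \<Omega> n) x)" if "A \<in> sets M" for A c n
  proof -
    from that have "A \<in> sigma_sets (space M) \<A>" using sets by simp
    with \<A>(2,3) show ?thesis
    proof (induction arbitrary: c n rule: sigma_sets_induct_disjoint)
      case (basic A)
      then show ?case by (rule V_base)
    next
      case empty
      then show ?case using V_0 by simp
    next
      case (compl A)
      have "V (\<lambda>x. c * indicator (space M \<inter> \<Omega> n) x + (- c) * indicator (A \<inter> \<Omega> n) x)"
        by (intro V_add V_base[OF top] compl)
      also have "(\<lambda>x. c * indicator (space M \<inter> \<Omega> n) x + (- c) * indicator (A \<inter> \<Omega> n) x) =
          (\<lambda>x. c * indicator ((space M - A) \<inter> \<Omega> n) x)"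
        using sigma_sets_into_sp[OF \<A>(3) compl(1)] \<Omega>(2) by (auto simp: fun_eq_iff indicator_def)
      finally show ?case .
    next
      case (union A)
      have As: "A i \<in> sets M" for i using union(2) sets by auto
      have Vk: "V (\<lambda>x. c * indicator ((\<Union>i<k. A i) \<inter> \<Omega> n) x)" for k :: nat
      proof (induction k)
        case 0
        then show ?case using V_0 by simp
      next
        case (Suc k)
        have "V (\<lambda>x. c * indicator ((\<Union>i<k. A i) \<inter> \<Omega> n) x + c * indicator (A k \<inter> \<Omega> n) x)"
          by (intro V_add Suc union)
        also have "(\<lambda>x. c * indicator ((\<Union>i<k. A i) \<inter> \<Omega> n) x + c * indicator (A k \<inter> \<Omega> n) x) =
          (\<lambda>x. c * indicator ((\<Union>i<Suc k. A i) \<inter> \<Omega> n) x)"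
        proof
          fix x
          have "\<not> (x \<in> A k \<and> x \<in> (\<Union>i<k. A i))"
            using union(1) by (auto simp: disjoint_family_on_def) (metis disjoint_iff less_irrefl)
          then show "c * indicator ((\<Union>i<k. A i) \<inter> \<Omega> n) x + c * indicator (A k \<inter> \<Omega> n) x =
            c * indicator ((\<Union>i<Suc k. A i) \<inter> \<Omega> n) x"
            by (auto simp: indicator_def less_Suc_eq)
        qed
        finally show ?case .
      qed
      show ?case
      proof (rule V_lim[OF _ Vk])
        show L: "(\<lambda>x. c * indicator (\<Union> (range A) \<inter> \<Omega> n) x) \<in> L2 M"
          by (intro conjunct1[OF ind]) (use As in auto)
        show "(\<lambda>i. sqnorm M (\<lambda>x. c * indicator (\<Union> (range A) \<inter> \<Omega> n) x -
            c * indicator (\<Union> (A ` {..<i}) \<inter> \<Omega> n) x)) \<longlonglongrightarrow> 0"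
        proof (rule sqnorm_dominated_convergence[OF L, where K = 1])
          show "(\<lambda>x. c * indicator (\<Union> (A ` {..<i}) \<inter> \<Omega> n) x) \<in> borel_measurable M" for i
            using Vk[of i] by (simp add: V_def L2_def)
          show "cmod (c * indicator (\<Union> (A ` {..<i}) \<inter> \<Omega> n) x) \<le>
              1 * cmod (c * indicator (\<Union> (range A) \<inter> \<Omega> n) x)" for i x
            by (auto simp: indicator_def)
          show "(\<lambda>i. c * indicator (\<Union> (A ` {..<i}) \<inter> \<Omega> n) x) \<longlonglongrightarrow>
              c * indicator (\<Union> (range A) \<inter> \<Omega> n) x" for x
            unfolding indicator_inter_arith by (intro tendsto_intros LIMSEQ_indicator_UN)
        qed
      qed
    qed
  qed
  have V_simple: "V (\<lambda>x. s x * indicator (\<Omega> n) x)" if s: "simple_function M s" for s n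
  proof -
    have fin: "finite (s ` space M)" using s by (simp add: simple_function_def)
    have sum: "V (\<lambda>x. \<Sum>y\<in>Y. y * indicator ((s -` {y} \<inter> space M) \<inter> \<Omega> n) x)" if "finite Y" "Y \<subseteq> s ` space M" for Y
      using that
    proof (induction Y rule: finite_induct)
      case empty
      then show ?case using V_0 by simp
    next
      case (insert y Y)
      have "s -` {y} \<inter> space M \<in> sets M" using s insert by (auto simp: simple_function_def)
      then have "V (\<lambda>x. y * indicator ((s -` {y} \<inter> space M) \<inter> \<Omega> n) x +
          (\<Sum>y\<in>Y. y * indicator ((s -` {y} \<inter> space M) \<inter> \<Omega> n) x))"
        using insert by (intro V_add V_set) blast+
      then show ?case by (simp only: sum.insert[OF insert(1,2)])
    qed
    have eq: "(\<Sum>y\<in>s ` space M. y * indicator ((s -` {y} \<inter> space M) \<inter> \<Omega> n) x) = s x * indicator (\<Omega> n) x"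
      if "x \<in> space M" for x
    proof -
      have "(\<Sum>y\<in>s ` space M. y * indicator ((s -` {y} \<inter> space M) \<inter> \<Omega> n) x) =
          (\<Sum>y\<in>s ` space M. if y = s x then s x * indicator (\<Omega> n) x else 0)"
        using that by (intro sum.cong) (auto simp: indicator_def)
      then show ?thesis using fin that by simp
    qed
    show ?thesis
      by (rule V_cong[OF eq sum[OF fin order_refl]])
  qed
  have "V f" if f: "f \<in> L2 M" for f
  proof -
    have [measurable]: "f \<in> borel_measurable M" using f by (simp add: L2_def)
    obtain s where s: "\<And>i. simple_function M (s i)" "\<And>x. x \<in> space M \<Longrightarrow> (\<lambda>i. s i x) \<longlonglongrightarrow> f x"
      "\<And>i x. x \<in> space M \<Longrightarrow> dist (s i x) 0 \<le> 2 * dist (f x) 0"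
      using borel_measurable_implies_sequence_metric[of f M 0] by fastforce
    show ?thesis
    proof (rule V_lim[OF f V_simple[OF s(1)]])
      show "(\<lambda>i. sqnorm M (\<lambda>x. f x - s i x * indicator (\<Omega> i) x)) \<longlonglongrightarrow> 0"
      proof (rule sqnorm_dominated_convergence[OF f, where K = 2])
        show "(\<lambda>x. s i x * indicator (\<Omega> i) x) \<in> borel_measurable M" for i
          using borel_measurable_simple_function[OF s(1)] by measurable
        show "cmod (s i x * indicator (\<Omega> i) x) \<le> 2 * cmod (f x)" if "x \<in> space M" for i x
          using s(3)[OF that, of i] by (auto simp: indicator_def)
        show "(\<lambda>i. s i x * indicator (\<Omega> i) x) \<longlonglongrightarrow> f x" if "x \<in> space M" for x
        proof -
          have "(\<lambda>i. indicator (\<Omega> i) x :: complex) \<longlonglongrightarrow> indicator (\<Union>i. \<Omega> i) x"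
            by (rule LIMSEQ_indicator_incseq[OF \<Omega>(4)])
          then have "(\<lambda>i. s i x * indicator (\<Omega> i) x) \<longlonglongrightarrow> f x * indicator (\<Union>i. \<Omega> i) x"
            by (intro tendsto_intros s(2) that)
          then show ?thesis using that \<Omega>(2) by simp
        qed
      qed
    qed
  qed
  then show ?thesis using \<open>countable D\<close> D_L2 unfolding V_def by (intro exI[of _ D]) blast
qed

section \<open>Matrices and the groups\<close>

text \<open>
  The Hilbert-Schmidt pairing \<open>tr z w*\<close> of \<open>p \<times> r\<close> matrices.
\<close>

abbreviation hs :: "nat \<Rightarrow> nat \<Rightarrow> cmat \<Rightarrow> cmat \<Rightarrow> complex" where
  "hs p r z w \<equiv> mtrace p (mmul r z (madj w))"

lemma mmul_assoc: "mmul n (mmul m A B) C = mmul m A (mmul n B C)"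
proof (intro ext)
  fix i j
  have "mmul n (mmul m A B) C i j = (\<Sum>k<n. \<Sum>l<m. A i l * B l k * C k j)"
    by (simp add: mmul_def sum_distrib_right)
  also have "\<dots> = (\<Sum>l<m. \<Sum>k<n. A i l * B l k * C k j)" by (rule sum.swap)
  also have "\<dots> = mmul m A (mmul n B C) i j"
    by (simp add: mmul_def sum_distrib_left mult.assoc)
  finally show "mmul n (mmul m A B) C i j = mmul m A (mmul n B C) i j" .
qed

lemma mmul_add_left: "mmul r (A + B) C = mmul r A C + mmul r B C"
  by (simp add: mmul_def fun_eq_iff distrib_right sum.distrib)

lemma mmul_add_right: "mmul r A (B + C) = mmul r A B + mmul r A C"
  by (simp add: mmul_def fun_eq_iff distrib_left sum.distrib)

lemma mmul_diff_left: "mmul r (A - B) C = mmul r A C - mmul r B C"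
  by (simp add: mmul_def fun_eq_iff left_diff_distrib sum_subtractf)

lemma mmul_diff_right: "mmul r A (B - C) = mmul r A B - mmul r A C"
  by (simp add: mmul_def fun_eq_iff right_diff_distrib sum_subtractf)

lemma mmul_uminus_left: "mmul r (- A) B = - mmul r A B"
  by (simp add: mmul_def fun_eq_iff sum_negf)

lemma mmul_uminus_right: "mmul r A (- B) = - mmul r A B"
  by (simp add: mmul_def fun_eq_iff sum_negf)

lemma mmul_zero: "mmul r 0 A = 0" "mmul r A 0 = 0"
  by (simp_all add: mmul_def fun_eq_iff)

lemma mmul_mscale_left: "mmul r (mscale c A) B = mscale c (mmul r A B)"
  by (simp add: mmul_def mscale_def fun_eq_iff sum_distrib_left mult.assoc)

lemma mmul_mscale_right: "mmul r A (mscale c B) = mscale c (mmul r A B)"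
  by (simp add: mmul_def mscale_def fun_eq_iff sum_distrib_left mult.left_commute)

lemma madj_mmul: "madj (mmul r A B) = mmul r (madj B) (madj A)"
  by (simp add: mmul_def madj_def fun_eq_iff mult.commute)

lemma madj_simps [simp]:
  "madj (madj A) = A" "madj (A + B) = madj A + madj B" "madj (A - B) = madj A - madj B"
  "madj (- A) = - madj A" "madj 0 = 0" "madj (mscale c A) = mscale (cnj c) (madj A)"
  by (simp_all add: madj_def mscale_def fun_eq_iff)

lemma mscale_simps:
  "mscale c (A + B) = mscale c A + mscale c B" "mscale c (A - B) = mscale c A - mscale c B"
  "mscale c (- A) = - mscale c A" "mscale c 0 = 0"
  by (simp_all add: mscale_def fun_eq_iff algebra_simps)

lemma mtrace_simps [simp]:
  "mtrace p (A + B) = mtrace p A + mtrace p B" "mtrace p (A - B) = mtrace p A - mtrace p B"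
  "mtrace p (- A) = - mtrace p A" "mtrace p 0 = 0" "mtrace p (mscale c A) = c * mtrace p A"
  by (simp_all add: mtrace_def mscale_def sum.distrib sum_subtractf sum_negf sum_distrib_left)

lemma mtrace_madj: "mtrace p (madj A) = cnj (mtrace p A)"
  by (simp add: mtrace_def madj_def)

lemma hs_sum: "hs p r z w = (\<Sum>i<p. \<Sum>j<r. z i j * cnj (w i j))"
  by (simp add: mtrace_def mmul_def madj_def)

lemma hs_cnj: "cnj (hs p r z w) = hs p r w z"
  by (simp add: hs_sum mult.commute)

lemma hs_self: "hs p r z z = complex_of_real (\<Sum>i<p. \<Sum>j<r. (cmod (z i j))\<^sup>2)"
  by (simp add: hs_sum complex_norm_square del: of_real_power)

lemma mtrace_skew:
  assumes "madj n = - n"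
  shows "Re (mtrace p n) = 0"
proof -
  have "cnj (mtrace p n) = - mtrace p n" using mtrace_madj[of p n] assms by simp
  then have "Re (cnj (mtrace p n)) = Re (- mtrace p n)" by simp
  then show ?thesis by simp
qed

lemma mats_iff: "A \<in> mats m n \<longleftrightarrow> (\<forall>i j. m \<le> i \<or> n \<le> j \<longrightarrow> A i j = 0)"
  by (auto simp: mats_def not_less)

lemma mats_add: "A \<in> mats m n \<Longrightarrow> B \<in> mats m n \<Longrightarrow> A + B \<in> mats m n"
  by (auto simp: mats_iff)

lemma mats_diff: "A \<in> mats m n \<Longrightarrow> B \<in> mats m n \<Longrightarrow> A - B \<in> mats m n"
  by (auto simp: mats_iff)

lemma mats_uminus: "A \<in> mats m n \<Longrightarrow> - A \<in> mats m n"
  by (auto simp: mats_iff)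

lemma mats_0: "0 \<in> mats m n"
  by (auto simp: mats_iff)

lemma mats_mscale: "A \<in> mats m n \<Longrightarrow> mscale c A \<in> mats m n"
  by (auto simp: mats_iff mscale_def)

lemma mats_madj: "A \<in> mats m n \<Longrightarrow> madj A \<in> mats n m"
  by (auto simp: mats_iff madj_def)

lemma mats_mmul: "A \<in> mats m k \<Longrightarrow> B \<in> mats l n \<Longrightarrow> mmul r A B \<in> mats m n"
  unfolding mats_iff mmul_def by (intro allI impI sum.neutral) auto

lemmas mats_intros = mats_add mats_diff mats_uminus mats_0 mats_mscale mats_madj mats_mmul

lemma mats_upd: "z \<in> mats p r \<Longrightarrow> i < p \<Longrightarrow> j < r \<Longrightarrow> z(i := (z i)(j := w)) \<in> mats p r"
  by (auto simp: mats_def)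

lemma mone_mats: "mone p \<in> mats p p"
  by (auto simp: mats_def mone_def)

lemma mmul_mone_left: "A \<in> mats p n \<Longrightarrow> mmul p (mone p) A = A"
proof (intro ext)
  fix i j assume A: "A \<in> mats p n"
  have "mmul p (mone p) A i j = (\<Sum>k<p. if k = i then A i j else 0)"
    unfolding mmul_def mone_def by (intro sum.cong) auto
  then show "mmul p (mone p) A i j = A i j" using A by (auto simp: mats_iff)
qed

lemma mmul_mone_right: "A \<in> mats m p \<Longrightarrow> mmul p A (mone p) = A"
  by (auto simp: mats_iff mmul_def mone_def fun_eq_iff if_distrib[of "\<lambda>x. _ * x"] cong: if_cong conj_cong)

text \<open>
  The groups \<open>S\<close>, \<open>N\<close> and \<open>P\<close>.
\<close>

abbreviation SG :: "nat \<Rightarrow> cmat monoid" where "SG p \<equiv> lower_triangular_group p"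
abbreviation NG :: "nat \<Rightarrow> nat \<Rightarrow> (cmat \<times> cmat) monoid" where "NG p q \<equiv> heisenberg_group p q"
abbreviation PG :: "nat \<Rightarrow> nat \<Rightarrow> ((cmat \<times> cmat) \<times> cmat) monoid" where "PG p q \<equiv> iwasawa_group p q"

lemma SG_simps [simp]: "x \<otimes>\<^bsub>SG p\<^esub> y = mmul p x y" "\<one>\<^bsub>SG p\<^esub> = mone p"
  by (simp_all add: lower_triangular_group_def)

lemma SG_carrier: "s \<in> carrier (SG p) \<longleftrightarrow>
    s \<in> mats p p \<and> (\<forall>i j. i < j \<longrightarrow> s i j = 0) \<and> (\<forall>i<p. Im (s i i) = 0 \<and> 0 < Re (s i i))"
  by (auto simp: lower_triangular_group_def complex_is_Real_iff)

lemma SG_mats: "s \<in> carrier (SG p) \<Longrightarrow> s \<in> mats p p"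
  by (simp add: SG_carrier)

lemma lower_triangular_mmul_diag:
  assumes "\<And>i j. i < j \<Longrightarrow> s i j = 0" "\<And>i j. i < j \<Longrightarrow> t i j = 0" "i < p"
  shows "mmul p s t i i = s i i * t i i"
proof -
  have "mmul p s t i i = (\<Sum>k<p. if k = i then s i i * t i i else 0)"
    unfolding mmul_def
  proof (intro sum.cong refl)
    fix k
    show "s i k * t k i = (if k = i then s i i * t i i else 0)"
      using assms(1)[of i k] assms(2)[of k i] by (cases k i rule: linorder_cases) auto
  qed
  then show ?thesis using assms(3) by simp
qed

lemma lower_triangular_mmul:
  assumes "\<And>i j. i < j \<Longrightarrow> s i j = 0" "\<And>i j. i < j \<Longrightarrow> t i j = 0" "i < j"
  shows "mmul p s t i j = 0"
  unfolding mmul_def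
proof (intro sum.neutral ballI)
  fix k
  show "s i k * t k j = 0"
    using assms(1)[of i k] assms(2)[of k j] assms(3) by (cases "i < k") auto
qed

lemma SG_mmul: "s \<in> carrier (SG p) \<Longrightarrow> t \<in> carrier (SG p) \<Longrightarrow> mmul p s t \<in> carrier (SG p)"
  using lower_triangular_mmul_diag[of s t _ p] lower_triangular_mmul[of s t _ _ p]
  by (auto simp: SG_carrier intro: mats_mmul)

lemma SG_mone: "mone p \<in> carrier (SG p)"
  by (auto simp: SG_carrier mone_mats) (auto simp: mone_def)

text \<open>
  The inverse of an invertible lower triangular matrix by forward substitution, row by row.
\<close>

function solve_lower :: "nat \<Rightarrow> cmat \<Rightarrow> cmat" where
  "solve_lower p s i j = (if i < p \<and> j < p then
      ((if i = j then 1 else 0) - (\<Sum>k\<in>{..<i}. s i k * solve_lower p s k j)) / s i i else 0)"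
  by pat_completeness auto
termination by (relation "inv_image less_than (\<lambda>(p, s, i, j). i)") auto

declare solve_lower.simps [simp del]

lemma SG_right_inverse:
  assumes s: "s \<in> carrier (SG p)"
  shows "\<exists>t\<in>carrier (SG p). mmul p s t = mone p"
proof (intro bexI)
  let ?t = "solve_lower p s"
  have s': "\<And>i j. i < j \<Longrightarrow> s i j = 0" "\<And>i. i < p \<Longrightarrow> s i i \<noteq> 0" "s \<in> mats p p"
    "\<And>i. i < p \<Longrightarrow> Im (s i i) = 0" "\<And>i. i < p \<Longrightarrow> 0 < Re (s i i)"
    using s by (auto simp: SG_carrier)
  have up: "?t i j = 0" if "i < j" for i j
    using that
  proof (induction i rule: less_induct)
    case (less i)
    then show ?case by (subst solve_lower.simps) auto
  qed
  have diag: "?t i i = 1 / s i i" if "i < p" for i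
    using that by (subst solve_lower.simps) (simp add: up)
  show "mmul p s ?t = mone p"
  proof (intro ext)
    fix i j
    show "mmul p s ?t i j = mone p i j"
    proof (cases "i < p \<and> j < p")
      case True
      have "mmul p s ?t i j = (\<Sum>k<Suc i. s i k * ?t k j)"
        unfolding mmul_def using True s'(1) by (intro sum.mono_neutral_right) auto
      also have "\<dots> = (\<Sum>k<i. s i k * ?t k j) + s i i * ?t i j" by simp
      also have "s i i * ?t i j = (if i = j then 1 else 0) - (\<Sum>k<i. s i k * ?t k j)"
        using True s'(2) by (subst (1) solve_lower.simps) simp
      finally show ?thesis using True by (simp add: mone_def)
    next
      case False
      have "?t k j = 0" if "\<not> j < p" for k using that by (subst solve_lower.simps) simp
      then show ?thesis using False s'(3) by (auto simp: mone_def mmul_def mats_iff)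
    qed
  qed
  show "?t \<in> carrier (SG p)"
    unfolding SG_carrier mats_iff
  proof (intro conjI allI impI)
    show "?t i j = 0" if "p \<le> i \<or> p \<le> j" for i j using that by (subst solve_lower.simps) auto
    show "?t i j = 0" if "i < j" for i j using that by (rule up)
    fix i assume i: "i < p"
    have r: "s i i = of_real (Re (s i i))" using s'(4)[OF i] by (simp add: complex_eq_iff)
    show "Im (?t i i) = 0" "0 < Re (?t i i)"
      using s'(5)[OF i] by (simp_all only: diag[OF i], subst r, simp, subst r, simp)
  qed
qed

text \<open>
  In a monoid where every element has a right inverse, right inverses are also left inverses.
\<close>

lemma group_SG: "group (SG p)"
proof -
  have c: "mmul p x y \<in> carrier (SG p)" if "x \<in> carrier (SG p)" "y \<in> carrier (SG p)" for x y
    using that by (rule SG_mmul)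
  show ?thesis
  proof (rule groupI)
    fix x assume x: "x \<in> carrier (SG p)"
    obtain y where y: "y \<in> carrier (SG p)" "mmul p x y = mone p" using SG_right_inverse[OF x] by blast
    obtain z where z: "z \<in> carrier (SG p)" "mmul p y z = mone p" using SG_right_inverse[OF y(1)] by blast
    have "z = mmul p (mmul p x y) z" using z y by (simp add: mmul_mone_left[of _ p p] SG_mats)
    also have "\<dots> = mmul p x (mmul p y z)" by (rule mmul_assoc)
    also have "\<dots> = x" using z x by (simp add: mmul_mone_right[of _ p p] SG_mats)
    finally have "mmul p y x = mone p" using z by simp
    then show "\<exists>y\<in>carrier (SG p). y \<otimes>\<^bsub>SG p\<^esub> x = \<one>\<^bsub>SG p\<^esub>" using y by auto
  qed (auto simp: SG_mmul SG_mone mmul_assoc mmul_mone_left[of _ p p] SG_mats)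
qed

lemma NG_simps [simp]:
  "(n1, z1) \<otimes>\<^bsub>NG p q\<^esub> (n2, z2) =
     (n1 + n2 - mscale (1/2) (mmul (q - p) z1 (madj z2) - mmul (q - p) z2 (madj z1)), z1 + z2)"
  "\<one>\<^bsub>NG p q\<^esub> = (0, 0)"
  by (simp_all add: heisenberg_group_def)

lemma NG_carrier: "(n, z) \<in> carrier (NG p q) \<longleftrightarrow> n \<in> mats p p \<and> madj n = - n \<and> z \<in> mats p (q - p)"
  by (auto simp: heisenberg_group_def)

lemma group_NG: "group (NG p q)"
proof (rule groupI)
  fix x y assume "x \<in> carrier (NG p q)" "y \<in> carrier (NG p q)"
  then show "x \<otimes>\<^bsub>NG p q\<^esub> y \<in> carrier (NG p q)"
    by (cases x; cases y) (auto simp: NG_carrier madj_mmul mscale_simps intro!: mats_intros)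
next
  show "\<one>\<^bsub>NG p q\<^esub> \<in> carrier (NG p q)" by (simp add: NG_carrier mats_0)
next
  fix x y z assume "x \<in> carrier (NG p q)" "y \<in> carrier (NG p q)" "z \<in> carrier (NG p q)"
  then show "x \<otimes>\<^bsub>NG p q\<^esub> y \<otimes>\<^bsub>NG p q\<^esub> z = x \<otimes>\<^bsub>NG p q\<^esub> (y \<otimes>\<^bsub>NG p q\<^esub> z)"
    by (cases x; cases y; cases z) (simp add: mmul_add_left mmul_add_right mscale_simps algebra_simps)
next
  fix x assume "x \<in> carrier (NG p q)"
  then show "\<one>\<^bsub>NG p q\<^esub> \<otimes>\<^bsub>NG p q\<^esub> x = x"
    by (cases x) (simp add: mmul_zero mscale_simps)
next
  fix x assume x: "x \<in> carrier (NG p q)"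
  obtain n z where [simp]: "x = (n, z)" by (cases x)
  show "\<exists>y\<in>carrier (NG p q). y \<otimes>\<^bsub>NG p q\<^esub> x = \<one>\<^bsub>NG p q\<^esub>"
    using x by (intro bexI[of _ "(- n, - z)"])
      (auto simp: NG_carrier mmul_uminus_left mmul_uminus_right mscale_simps intro: mats_intros)
qed

lemma act_closed:
  assumes "s \<in> carrier (SG p)" "g \<in> carrier (NG p q)"
  shows "heisenberg_act p s g \<in> carrier (NG p q)"
  using assms
  by (cases g) (auto simp: heisenberg_act_def NG_carrier madj_mmul mmul_assoc mmul_uminus_right
      mmul_uminus_left intro!: mats_intros intro: SG_mats)

lemma act_mult:
  "heisenberg_act p s (g \<otimes>\<^bsub>NG p q\<^esub> h) = heisenberg_act p s g \<otimes>\<^bsub>NG p q\<^esub> heisenberg_act p s h"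
  by (cases g; cases h)
    (simp add: heisenberg_act_def madj_mmul mmul_assoc mmul_add_left mmul_add_right mmul_diff_left
      mmul_diff_right mmul_mscale_left mmul_mscale_right)

lemma act_act: "heisenberg_act p s (heisenberg_act p t g) = heisenberg_act p (mmul p s t) g"
  by (cases g) (simp add: heisenberg_act_def madj_mmul mmul_assoc)

lemma act_mone: "g \<in> carrier (NG p q) \<Longrightarrow> heisenberg_act p (mone p) g = g"
proof (cases g)
  case (Pair n z)
  have "madj (mone p) = mone p" by (auto simp: madj_def mone_def fun_eq_iff)
  moreover assume "g \<in> carrier (NG p q)"
  ultimately show ?thesis
    using Pair by (simp add: heisenberg_act_def NG_carrier mmul_mone_left[of _ p p] mmul_mone_left[of _ p "q - p"] mmul_mone_right[of _ p p])
qed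

lemma act_one: "heisenberg_act p s (0, 0) = (0, 0)"
  by (simp add: heisenberg_act_def mmul_zero)

lemma PG_simps [simp]:
  "(g, s) \<otimes>\<^bsub>PG p q\<^esub> (h, t) = (g \<otimes>\<^bsub>NG p q\<^esub> heisenberg_act p s h, mmul p s t)"
  "\<one>\<^bsub>PG p q\<^esub> = ((0, 0), mone p)"
  "carrier (PG p q) = carrier (NG p q) \<times> carrier (SG p)"
  by (simp_all add: iwasawa_group_def)

lemma group_PG: "group (PG p q)"
proof -
  interpret N: group "NG p q" by (rule group_NG)
  interpret S: group "SG p" by (rule group_SG)
  show ?thesis
  proof (rule groupI)
    fix x y assume "x \<in> carrier (PG p q)" "y \<in> carrier (PG p q)"
    then show "x \<otimes>\<^bsub>PG p q\<^esub> y \<in> carrier (PG p q)"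
      by (cases x; cases y) (auto simp: act_closed SG_mmul)
  next
    show "\<one>\<^bsub>PG p q\<^esub> \<in> carrier (PG p q)" using N.one_closed by (simp add: SG_mone)
  next
    fix x y z assume "x \<in> carrier (PG p q)" "y \<in> carrier (PG p q)" "z \<in> carrier (PG p q)"
    then show "x \<otimes>\<^bsub>PG p q\<^esub> y \<otimes>\<^bsub>PG p q\<^esub> z = x \<otimes>\<^bsub>PG p q\<^esub> (y \<otimes>\<^bsub>PG p q\<^esub> z)"
      by (cases x; cases y; cases z)
        (auto simp: act_mult act_act N.m_assoc act_closed SG_mmul mmul_assoc simp del: NG_simps)
  next
    fix x assume "x \<in> carrier (PG p q)"
    then show "\<one>\<^bsub>PG p q\<^esub> \<otimes>\<^bsub>PG p q\<^esub> x = x"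
      using N.l_one by (cases x) (auto simp: act_mone mmul_mone_left[of _ p p] SG_mats simp del: NG_simps(1))
  next
    fix x assume x: "x \<in> carrier (PG p q)"
    obtain g s where [simp]: "x = (g, s)" by (cases x)
    have g: "g \<in> carrier (NG p q)" "s \<in> carrier (SG p)" using x by auto
    let ?t = "inv\<^bsub>SG p\<^esub> s"
    have t: "?t \<in> carrier (SG p)" "mmul p ?t s = mone p" using g S.l_inv by auto
    have "heisenberg_act p ?t (inv\<^bsub>NG p q\<^esub> g) \<otimes>\<^bsub>NG p q\<^esub> heisenberg_act p ?t g = \<one>\<^bsub>NG p q\<^esub>"
      using g by (simp add: act_mult[symmetric] act_one del: NG_simps(1))
    then show "\<exists>y\<in>carrier (PG p q). y \<otimes>\<^bsub>PG p q\<^esub> x = \<one>\<^bsub>PG p q\<^esub>"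
      using g t by (intro bexI[of _ "(heisenberg_act p ?t (inv\<^bsub>NG p q\<^esub> g), ?t)"])
        (auto simp: act_closed simp del: NG_simps(1))
  qed
qed

text \<open>
  The multiplication law of \<open>N\<close> is the one that makes \<open>T\<^sup>1\<close> multiplicative; the identity holds
  for arbitrary pairs of matrices and arbitrary functions \<open>\<phi>\<close>.
\<close>

lemma heisenberg_rep_mult:
  "heisenberg_rep p q (g \<otimes>\<^bsub>NG p q\<^esub> h) \<phi> z = heisenberg_rep p q g (heisenberg_rep p q h \<phi>) z"
proof (cases g; cases h)
  fix n1 z1 n2 z2 assume [simp]: "g = (n1, z1)" "h = (n2, z2)"
  show ?thesis
    by (simp add: heisenberg_rep_def mmul_add_left mmul_add_right add_ac flip: exp_add mult.assoc)
      (simp add: field_simps)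
qed


text \<open>
  The topology of the type of matrices is the product topology, so continuity is continuity of
  the entries.
\<close>

lemma continuous_on_mat_entry:
  fixes f :: "'a::topological_space \<Rightarrow> cmat"
  assumes "continuous_on S f"
  shows "continuous_on S (\<lambda>x. f x i j)"
  by (rule continuous_on_product_then_coordinatewise)
    (rule continuous_on_product_then_coordinatewise[OF assms])

lemma continuous_on_mat:
  fixes f :: "'a::topological_space \<Rightarrow> cmat"
  assumes "\<And>i j. continuous_on S (\<lambda>x. f x i j)"
  shows "continuous_on S f"
  by (intro continuous_on_coordinatewise_then_product assms)

lemma continuous_on_mat_binary:
  fixes f g :: "'a::topological_space \<Rightarrow> cmat"
  assumes f: "continuous_on S f" and g: "continuous_on S g"
  shows "continuous_on S (\<lambda>x. mmul r (f x) (g x))"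
    "continuous_on S (\<lambda>x. f x + g x)" "continuous_on S (\<lambda>x. f x - g x)"
proof -
  note e = continuous_on_mat_entry[OF f] continuous_on_mat_entry[OF g]
  show "continuous_on S (\<lambda>x. mmul r (f x) (g x))"
    unfolding mmul_def
    by (rule continuous_on_mat) (intro continuous_on_sum continuous_on_mult e)
  show "continuous_on S (\<lambda>x. f x + g x)"
    unfolding plus_fun_def by (rule continuous_on_mat) (intro continuous_on_add e)
  show "continuous_on S (\<lambda>x. f x - g x)"
    unfolding fun_diff_def by (rule continuous_on_mat) (intro continuous_on_diff e)
qed

lemma continuous_on_mat_unary:
  fixes f :: "'a::topological_space \<Rightarrow> cmat"
  assumes f: "continuous_on S f"
  shows "continuous_on S (\<lambda>x. madj (f x))" "continuous_on S (\<lambda>x. mscale c (f x))"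
    "continuous_on S (\<lambda>x. - f x)" "continuous_on S (\<lambda>x. mtrace p (f x))"
proof -
  note e = continuous_on_mat_entry[OF f]
  show "continuous_on S (\<lambda>x. madj (f x))"
    unfolding madj_def by (rule continuous_on_mat) (intro continuous_on_cnj e)
  show "continuous_on S (\<lambda>x. mscale c (f x))"
    unfolding mscale_def by (rule continuous_on_mat) (intro continuous_on_mult continuous_on_const e)
  show "continuous_on S (\<lambda>x. - f x)"
    unfolding fun_Compl_def by (rule continuous_on_mat) (intro continuous_on_minus e)
  show "continuous_on S (\<lambda>x. mtrace p (f x))"
    unfolding mtrace_def by (intro continuous_on_sum e)
qed

lemmas mat_continuous_intros = continuous_on_mat_binary continuous_on_mat_unary continuous_on_fst continuous_on_snd
  continuous_on_Pair continuous_on_id continuous_on_const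

lemma continuous_on_act:
  fixes f :: "'a::topological_space \<Rightarrow> cmat" and g :: "'a \<Rightarrow> cmat \<times> cmat"
  assumes "continuous_on S f" "continuous_on S g"
  shows "continuous_on S (\<lambda>x. heisenberg_act p (f x) (g x))"
  unfolding heisenberg_act_def case_prod_beta by (intro mat_continuous_intros assms)

lemma continuous_on_PG_mult:
  fixes f g :: "'a::topological_space \<Rightarrow> (cmat \<times> cmat) \<times> cmat"
  assumes "continuous_on S f" "continuous_on S g"
  shows "continuous_on S (\<lambda>x. f x \<otimes>\<^bsub>PG p q\<^esub> g x)"
proof -
  have "(\<lambda>x. f x \<otimes>\<^bsub>PG p q\<^esub> g x) = (\<lambda>x. let a = fst (f x); b = heisenberg_act p (snd (f x)) (fst (g x)) in
      ((fst a + fst b - mscale (1/2) (mmul (q - p) (snd a) (madj (snd b)) - mmul (q - p) (snd b) (madj (snd a))),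
       snd a + snd b), mmul p (snd (f x)) (snd (g x))))"
    by (simp add: iwasawa_group_def heisenberg_group_def case_prod_beta Let_def)
  then show ?thesis
    by (simp only: Let_def) (intro mat_continuous_intros continuous_on_act assms)
qed

lemma closed_Collect_entries:
  fixes f :: "'a::topological_space \<Rightarrow> cmat"
  assumes "continuous_on UNIV f"
  shows "closed {x. \<forall>i j. P i j \<longrightarrow> f x i j = 0}"
  by (intro closed_Collect_all closed_Collect_imp closed_Collect_eq open_Collect_const
      continuous_on_mat_entry[OF assms] continuous_on_const)

text \<open>
  The carrier of \<open>P\<close> is closed in the open set given by positivity of the diagonal entries of \<open>s\<close>.
\<close>

lemma completely_metrizable_PG: "completely_metrizable_space (top_of_set (carrier (PG p q)))"
proof -
  let ?C = "{x::(cmat \<times> cmat) \<times> cmat. fst (fst x) \<in> mats p p \<and> madj (fst (fst x)) = - fst (fst x) \<and>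
    snd (fst x) \<in> mats p (q - p) \<and> snd x \<in> mats p p \<and> (\<forall>i j. i < j \<longrightarrow> snd x i j = 0) \<and>
    (\<forall>i. i < p \<longrightarrow> Im (snd x i i) = 0)}"
  let ?O = "{x::(cmat \<times> cmat) \<times> cmat. \<forall>i\<in>{..<p}. 0 < Re (snd x i i)}"
  have c: "continuous_on UNIV (\<lambda>x::(cmat \<times> cmat) \<times> cmat. fst (fst x))"
    "continuous_on UNIV (\<lambda>x::(cmat \<times> cmat) \<times> cmat. snd (fst x))"
    "continuous_on UNIV (\<lambda>x::(cmat \<times> cmat) \<times> cmat. snd x)"
    by (intro mat_continuous_intros)+
  note e = continuous_on_mat_entry[OF c(3)]
  have "closed {x::(cmat \<times> cmat) \<times> cmat. madj (fst (fst x)) = - fst (fst x)}"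
    unfolding fun_eq_iff
    by (intro closed_Collect_all closed_Collect_eq continuous_on_mat_entry mat_continuous_intros c)
  moreover have "closed {x::(cmat \<times> cmat) \<times> cmat. \<forall>i. i < p \<longrightarrow> Im (snd x i i) = 0}"
    by (intro closed_Collect_all closed_Collect_imp closed_Collect_eq
        open_Collect_const continuous_on_Im e continuous_on_const)
  ultimately have C: "closed ?C"
    unfolding mats_def mem_Collect_eq
    by (intro closed_Collect_conj closed_Collect_entries c)
  have "open {x::(cmat \<times> cmat) \<times> cmat. 0 < Re (snd x i i)}" for i
    by (intro open_Collect_less continuous_on_Re e continuous_on_const)
  then have "open (\<Inter>i\<in>{..<p}. {x::(cmat \<times> cmat) \<times> cmat. 0 < Re (snd x i i)})"
    by (intro open_INT) auto
  moreover have "(\<Inter>i\<in>{..<p}. {x::(cmat \<times> cmat) \<times> cmat. 0 < Re (snd x i i)}) = ?O" by auto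
  ultimately have "open ?O" by simp
  then have "completely_metrizable_space (top_of_set ?O)"
    by (intro completely_metrizable_space_openin completely_metrizable_space_euclidean) auto
  then have "completely_metrizable_space (subtopology (top_of_set ?O) (?O \<inter> ?C))"
    by (rule completely_metrizable_space_closedin) (use C in \<open>simp add: closedin_closed_Int\<close>)
  moreover have "subtopology (top_of_set ?O) (?O \<inter> ?C) = top_of_set (carrier (PG p q))"
  proof -
    have "x \<in> carrier (PG p q) \<longleftrightarrow> x \<in> ?O \<inter> ?C" for x
      by (cases x) (auto simp: NG_carrier SG_carrier heisenberg_group_def)
    then have "carrier (PG p q) = ?O \<inter> ?C" by blast
    then show ?thesis by (simp add: subtopology_subtopology)
  qed
  ultimately show ?thesis by simp
qed

section \<open>Rotation invariance of planar Lebesgue measure\<close>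

lemma distr_lborel_comp:
  assumes "f \<in> borel_measurable borel" "g \<in> borel_measurable borel"
    "distr lborel borel f = (lborel :: 'a::euclidean_space measure)" "distr lborel borel g = (lborel :: 'a measure)"
  shows "distr lborel borel (\<lambda>x. f (g x)) = (lborel :: 'a measure)"
proof -
  have "distr lborel borel (\<lambda>x. f (g x)) = distr (distr lborel borel g) borel f"
    using assms(1,2) by (subst distr_distr) (auto simp: comp_def)
  then show ?thesis using assms(3,4) by simp
qed

lemma measurable_Complex: "(\<lambda>(x, y). Complex x y) \<in> borel_measurable (lborel \<Otimes>\<^sub>M lborel :: (real \<times> real) measure)"
proof -
  have "(\<lambda>p::real \<times> real. Complex (fst p) (snd p)) \<in> borel_measurable borel"
    by (intro borel_measurable_continuous_onI continuous_intros)
  then show ?thesis by (simp add: lborel_prod case_prod_beta)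
qed

text \<open>
  Under the identification of the complex numbers with pairs of reals, planar Lebesgue measure is
  the product measure.
\<close>

lemma lborel_complex_eq: "lborel = distr (lborel \<Otimes>\<^sub>M lborel :: (real \<times> real) measure) borel (\<lambda>(x, y). Complex x y)"
proof (rule lborel_eqI)
  have m: "(\<lambda>(x, y). Complex x y) \<in> borel_measurable (lborel \<Otimes>\<^sub>M lborel :: (real \<times> real) measure)"
    by (rule measurable_Complex)
  fix l u :: complex assume le: "\<And>b. b \<in> Basis \<Longrightarrow> l \<bullet> b \<le> u \<bullet> b"
  have "(\<lambda>(x, y). Complex x y) -` box l u \<inter> space (lborel \<Otimes>\<^sub>M lborel) =
      {Re l<..<Re u} \<times> {Im l<..<Im u}"
    by (auto simp: lborel_prod in_box_complex_iff)
  then have "emeasure (distr (lborel \<Otimes>\<^sub>M lborel) borel (\<lambda>(x, y). Complex x y)) (box l u) =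
      emeasure (lborel \<Otimes>\<^sub>M lborel) ({Re l<..<Re u} \<times> {Im l<..<Im u})"
    by (simp add: emeasure_distr[OF m])
  also have "\<dots> = ennreal (Re u - Re l) * ennreal (Im u - Im l)"
    using le[of 1] le[of \<i>] by (subst lborel.emeasure_pair_measure_Times) (auto simp: Basis_complex_def)
  also have "\<dots> = ennreal (\<Prod>b\<in>Basis. (u - l) \<bullet> b)"
    using le[of 1] le[of \<i>] by (simp add: Basis_complex_def ennreal_mult)
  finally show "emeasure (distr (lborel \<Otimes>\<^sub>M lborel) borel (\<lambda>(x, y). Complex x y)) (box l u) = (\<Prod>b\<in>Basis. (u - l) \<bullet> b)" .
qed simp

lemma emeasure_lborel_translate:
  fixes A :: "real set"
  assumes "A \<in> sets borel"
  shows "emeasure lborel ((\<lambda>x. c + x) -` A) = emeasure lborel A"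
proof -
  have "emeasure lborel A = emeasure (distr lborel borel ((+) c)) A" by (simp add: lborel_distr_plus)
  also have "\<dots> = emeasure lborel ((\<lambda>x. c + x) -` A)"
    using assms by (subst emeasure_distr) auto
  finally show ?thesis by simp
qed

lemma emeasure_lborel_complex:
  assumes A: "A \<in> sets borel"
  shows "emeasure lborel A = (\<integral>\<^sup>+ y. emeasure lborel {x. Complex x y \<in> A} \<partial>lborel)"
    "emeasure lborel A = (\<integral>\<^sup>+ x. emeasure lborel {y. Complex x y \<in> A} \<partial>lborel)"
proof -
  let ?P = "lborel \<Otimes>\<^sub>M lborel :: (real \<times> real) measure"
  have m: "(\<lambda>(x, y). Complex x y) \<in> borel_measurable ?P"
    by (rule measurable_Complex)
  define B where "B = (\<lambda>(x, y). Complex x y) -` A \<inter> space ?P"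
  have B: "B \<in> sets ?P" unfolding B_def by (rule measurable_sets[OF m A])
  have "emeasure lborel A = emeasure ?P B"
    using A by (subst lborel_complex_eq, subst emeasure_distr[OF m]) (auto simp: B_def)
  then show "emeasure lborel A = (\<integral>\<^sup>+ y. emeasure lborel {x. Complex x y \<in> A} \<partial>lborel)"
    "emeasure lborel A = (\<integral>\<^sup>+ x. emeasure lborel {y. Complex x y \<in> A} \<partial>lborel)"
    using lborel_pair.emeasure_pair_measure_alt2[OF B] lborel.emeasure_pair_measure_alt[OF B]
    by (simp_all add: B_def vimage_def space_pair_measure)
qed

text \<open>
  Horizontal shears translate every horizontal line, and so preserve Lebesgue measure.
\<close>

lemma lborel_shear_Re: "distr lborel borel (\<lambda>w. Complex (a * Im w + Re w) (Im w)) = lborel"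
proof (rule measure_eqI)
  let ?h = "\<lambda>w. Complex (a * Im w + Re w) (Im w)"
  have h: "?h \<in> borel_measurable borel"
    by (intro borel_measurable_continuous_onI continuous_intros)
  fix A assume "A \<in> sets (distr lborel borel ?h)"
  then have A: "A \<in> sets borel" by simp
  have hA: "?h -` A \<in> sets borel" using measurable_sets[OF h A] by simp
  have "emeasure (distr lborel borel ?h) A = emeasure lborel (?h -` A)"
    using h A by (simp add: emeasure_distr)
  also have "\<dots> = (\<integral>\<^sup>+ y. emeasure lborel {x. Complex x y \<in> ?h -` A} \<partial>lborel)"
    by (rule emeasure_lborel_complex[OF hA])
  also have "\<dots> = (\<integral>\<^sup>+ y. emeasure lborel {x. Complex x y \<in> A} \<partial>lborel)"
  proof (intro nn_integral_cong)
    fix y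
    have "(\<lambda>x. Complex x y) \<in> borel_measurable borel"
      by (intro borel_measurable_continuous_onI continuous_intros)
    from measurable_sets[OF this A] have "{x. Complex x y \<in> A} \<in> sets borel" by (simp add: vimage_def)
    from emeasure_lborel_translate[OF this, of "a * y"]
    show "emeasure lborel {x. Complex x y \<in> ?h -` A} = emeasure lborel {x. Complex x y \<in> A}"
      by (simp add: vimage_def)
  qed
  also have "\<dots> = emeasure lborel A" by (rule emeasure_lborel_complex[OF A, symmetric])
  finally show "emeasure (distr lborel borel ?h) A = emeasure lborel A" .
qed simp

lemma lborel_shear_Im: "distr lborel borel (\<lambda>w. Complex (Re w) (a * Re w + Im w)) = lborel"
proof (rule measure_eqI)
  let ?h = "\<lambda>w. Complex (Re w) (a * Re w + Im w)"
  have h: "?h \<in> borel_measurable borel"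
    by (intro borel_measurable_continuous_onI continuous_intros)
  fix A assume "A \<in> sets (distr lborel borel ?h)"
  then have A: "A \<in> sets borel" by simp
  have hA: "?h -` A \<in> sets borel" using measurable_sets[OF h A] by simp
  have "emeasure (distr lborel borel ?h) A = emeasure lborel (?h -` A)"
    using h A by (simp add: emeasure_distr)
  also have "\<dots> = (\<integral>\<^sup>+ x. emeasure lborel {y. Complex x y \<in> ?h -` A} \<partial>lborel)"
    by (rule emeasure_lborel_complex[OF hA])
  also have "\<dots> = (\<integral>\<^sup>+ x. emeasure lborel {y. Complex x y \<in> A} \<partial>lborel)"
  proof (intro nn_integral_cong)
    fix x
    have "(\<lambda>y. Complex x y) \<in> borel_measurable borel"
      by (intro borel_measurable_continuous_onI continuous_intros)
    from measurable_sets[OF this A] have "{y. Complex x y \<in> A} \<in> sets borel" by (simp add: vimage_def)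
    from emeasure_lborel_translate[OF this, of "a * x"]
    show "emeasure lborel {y. Complex x y \<in> ?h -` A} = emeasure lborel {y. Complex x y \<in> A}"
      by (simp add: vimage_def)
  qed
  also have "\<dots> = emeasure lborel A" by (rule emeasure_lborel_complex[OF A, symmetric])
  finally show "emeasure (distr lborel borel ?h) A = emeasure lborel A" .
qed simp

text \<open>
  A rotation other than the half turn is a product of three shears, and the half turn is the
  square of a quarter turn.
\<close>

lemma lborel_rotate: "distr lborel borel (\<lambda>w. cis \<theta> * w) = lborel"
proof -
  have *: "distr lborel borel (\<lambda>w. cis \<theta> * w) = lborel" if "cos \<theta> \<noteq> -1" for \<theta>
  proof -
    define t where "t = - sin \<theta> / (1 + cos \<theta>)"
    have n: "1 + cos \<theta> \<noteq> 0" using that by auto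
    have "sin \<theta> * sin \<theta> = (1 + cos \<theta>) * (1 - cos \<theta>)"
      using sin_squared_eq[of \<theta>] by (simp add: power2_eq_square algebra_simps)
    then have t1: "1 + t * sin \<theta> = cos \<theta>" using n by (simp add: t_def field_simps)
    have t2: "t * (1 + cos \<theta>) = - sin \<theta>" using n by (simp add: t_def)
    let ?R = "\<lambda>w. Complex (t * Im w + Re w) (Im w)"
    let ?I = "\<lambda>w. Complex (Re w) (sin \<theta> * Re w + Im w)"
    have m: "?R \<in> borel_measurable borel" "?I \<in> borel_measurable borel"
      by (intro borel_measurable_continuous_onI continuous_intros)+
    have "cis \<theta> * w = ?R (?I (?R w))" for w
    proof (rule complex_eqI)
      have "Re (?R (?I (?R w))) = (1 + t * sin \<theta>) * Re w + (t * (1 + (1 + t * sin \<theta>))) * Im w"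
        by (simp add: algebra_simps)
      then show "Re (cis \<theta> * w) = Re (?R (?I (?R w)))" by (simp only: t1 t2) simp
      have "Im (?R (?I (?R w))) = (1 + t * sin \<theta>) * Im w + sin \<theta> * Re w"
        by (simp add: algebra_simps)
      then show "Im (cis \<theta> * w) = Im (?R (?I (?R w)))" by (simp only: t1) simp
    qed
    then have eq: "(\<lambda>w. cis \<theta> * w) = (\<lambda>w. ?R (?I (?R w)))" by (intro ext)
    have IR: "distr lborel borel (\<lambda>w. ?I (?R w)) = lborel"
      by (rule distr_lborel_comp[OF m(2,1) lborel_shear_Im lborel_shear_Re])
    have "(\<lambda>w. ?I (?R w)) \<in> borel_measurable borel"
      by (rule measurable_compose[OF m])
    then show ?thesis
      unfolding eq by (rule distr_lborel_comp[OF m(1) _ lborel_shear_Re IR])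
  qed
  show ?thesis
  proof (cases "cos \<theta> = -1")
    case True
    then have "cos (\<theta> / 2) = 0" using cos_double_cos[of "\<theta>/2"] by simp
    then have h: "distr lborel borel (\<lambda>w. cis (\<theta>/2) * w) = lborel" by (intro *) simp
    have "(\<lambda>w. cis \<theta> * w) = (\<lambda>w. cis (\<theta>/2) * (cis (\<theta>/2) * w))"
      by (simp add: mult.assoc[symmetric] cis_mult)
    then show ?thesis using distr_lborel_comp[OF _ _ h h] by simp
  qed (rule *)
qed

section \<open>The Gaussian measure on matrices\<close>

text \<open>
  Measure preserving maps of the factors give a measure preserving map of a finite product.
\<close>

lemma distr_PiM_map:
  assumes "product_sigma_finite M" "finite I"
    and f: "\<And>i. i \<in> I \<Longrightarrow> f i \<in> measurable (M i) (M i)" "\<And>i. i \<in> I \<Longrightarrow> distr (M i) (M i) (f i) = M i"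
  shows "distr (Pi\<^sub>M I M) (Pi\<^sub>M I M) (\<lambda>x. \<lambda>i\<in>I. f i (x i)) = Pi\<^sub>M I M"
proof -
  interpret product_sigma_finite M by fact
  have m: "(\<lambda>x. \<lambda>i\<in>I. f i (x i)) \<in> measurable (Pi\<^sub>M I M) (Pi\<^sub>M I M)"
  proof (rule measurable_restrict)
    fix i assume i: "i \<in> I"
    show "(\<lambda>x. f i (x i)) \<in> measurable (Pi\<^sub>M I M) (M i)"
      by (rule measurable_compose[OF measurable_component_singleton[OF i, of M] f(1)[OF i]])
  qed
  show ?thesis
  proof (rule PiM_eqI[OF \<open>finite I\<close>])
    fix A assume A: "\<And>i. i \<in> I \<Longrightarrow> A i \<in> sets (M i)"
    have *: "(\<lambda>x. \<lambda>i\<in>I. f i (x i)) -` Pi\<^sub>E I A \<inter> space (Pi\<^sub>M I M) = Pi\<^sub>E I (\<lambda>i. f i -` A i \<inter> space (M i))"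
      by (auto simp: space_PiM PiE_iff)
    have "emeasure (distr (Pi\<^sub>M I M) (Pi\<^sub>M I M) (\<lambda>x. \<lambda>i\<in>I. f i (x i))) (Pi\<^sub>E I A) =
        emeasure (Pi\<^sub>M I M) (Pi\<^sub>E I (\<lambda>i. f i -` A i \<inter> space (M i)))"
      using A \<open>finite I\<close> by (subst emeasure_distr[OF m]) (auto simp: * intro!: sets_PiM_I_finite)
    also have "\<dots> = (\<Prod>i\<in>I. emeasure (M i) (f i -` A i \<inter> space (M i)))"
      using A f(1) \<open>finite I\<close> by (intro emeasure_PiM measurable_sets) auto
    also have "\<dots> = (\<Prod>i\<in>I. emeasure (M i) (A i))"
    proof (intro prod.cong refl)
      fix i assume i: "i \<in> I"
      have "emeasure (M i) (A i) = emeasure (distr (M i) (M i) (f i)) (A i)" using f(2)[OF i] by simp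
      also have "\<dots> = emeasure (M i) (f i -` A i \<inter> space (M i))" using f(1)[OF i] A[OF i] by (rule emeasure_distr)
      finally show "emeasure (M i) (f i -` A i \<inter> space (M i)) = emeasure (M i) (A i)" by simp
    qed
    finally show "emeasure (distr (Pi\<^sub>M I M) (Pi\<^sub>M I M) (\<lambda>x. \<lambda>i\<in>I. f i (x i))) (Pi\<^sub>E I A) = (\<Prod>i\<in>I. emeasure (M i) (A i))" .
  qed simp
qed

text \<open>
  Lebesgue measure on \<open>p \<times> r\<close> matrices is the image of the product measure \<open>coord_lborel p r\<close>
  under \<open>mat_of p r\<close>, which turns a function on pairs of indices into a matrix.
\<close>

abbreviation coord_lborel :: "nat \<Rightarrow> nat \<Rightarrow> (nat \<times> nat \<Rightarrow> complex) measure" where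
  "coord_lborel p r \<equiv> Pi\<^sub>M ({..<p} \<times> {..<r}) (\<lambda>_. lborel :: complex measure)"

definition mat_of :: "nat \<Rightarrow> nat \<Rightarrow> (nat \<times> nat \<Rightarrow> complex) \<Rightarrow> cmat" where
  "mat_of p r x = (\<lambda>i j. if i < p \<and> j < r then x (i, j) else 0)"

lemma product_sigma_finite_lborel: "product_sigma_finite (\<lambda>_. lborel :: complex measure)"
  by (simp add: product_sigma_finite_def sigma_finite_lborel)

lemma borel_measurable_mat:
  fixes f :: "'a \<Rightarrow> cmat"
  assumes "\<And>i j. (\<lambda>x. f x i j) \<in> borel_measurable M"
  shows "f \<in> borel_measurable M"
  by (intro measurable_coordinatewise_then_product assms)

lemma mat_of_mats: "mat_of p r x \<in> mats p r"
  by (auto simp: mat_of_def mats_def)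

lemma measurable_mat_of: "mat_of p r \<in> measurable (coord_lborel p r) (restrict_space borel (mats p r))"
proof (rule measurable_restrict_space2)
  show "mat_of p r \<in> borel_measurable (coord_lborel p r)"
  proof (rule borel_measurable_mat)
    fix i j
    have "(\<lambda>x. x (i, j)) \<in> borel_measurable (coord_lborel p r)" if "i < p" "j < r"
      using measurable_component_singleton[of "(i, j)" "{..<p} \<times> {..<r}" "\<lambda>_. lborel :: complex measure"] that by simp
    then show "(\<lambda>x. mat_of p r x i j) \<in> borel_measurable (coord_lborel p r)"
      by (cases "i < p \<and> j < r") (auto simp: mat_of_def)
  qed
qed (simp add: mat_of_mats)

lemma lebesgue_mats_eq: "lebesgue_mats p r = distr (coord_lborel p r) (restrict_space borel (mats p r)) (mat_of p r)"
  by (simp add: lebesgue_mats_def mat_of_def[abs_def])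

lemma space_lebesgue_mats [simp]: "space (lebesgue_mats p r) = mats p r"
  and sets_lebesgue_mats [simp, measurable_cong]: "sets (lebesgue_mats p r) = sets (restrict_space borel (mats p r))"
  by (simp_all add: lebesgue_mats_def space_restrict_space)

lemma lebesgue_mats_map:
  assumes f: "\<And>i j. f i j \<in> borel_measurable borel" "\<And>i j. distr lborel borel (f i j) = lborel"
  shows "distr (lebesgue_mats p r) (lebesgue_mats p r) (\<lambda>z. mat_of p r (\<lambda>(i, j). f i j (z i j))) = lebesgue_mats p r"
proof -
  let ?I = "{..<p} \<times> {..<r}" and ?B = "restrict_space borel (mats p r)"
  let ?F = "\<lambda>x. \<lambda>k\<in>?I. f (fst k) (snd k) (x k)" and ?G = "\<lambda>z. mat_of p r (\<lambda>(i, j). f i j (z i j))"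
  have F: "?F \<in> measurable (coord_lborel p r) (coord_lborel p r)"
    using f(1) by (intro measurable_restrict measurable_compose[OF measurable_component_singleton]) auto
  have dF: "distr (coord_lborel p r) (coord_lborel p r) ?F = coord_lborel p r"
    by (rule distr_PiM_map[OF product_sigma_finite_lborel])
      (use f in \<open>auto simp: distr_cong[of lborel lborel lborel borel]\<close>)
  have G: "?G \<in> measurable ?B ?B"
  proof (rule measurable_restrict_space2)
    have e: "(\<lambda>z. z i j) \<in> borel_measurable ?B" for i j
      by (intro borel_measurable_continuous_on_restrict continuous_on_mat_entry continuous_on_id)
    have "(\<lambda>z. f i j (z i j)) \<in> borel_measurable ?B" for i j
      by (rule measurable_compose[OF e f(1)])
    then show "?G \<in> borel_measurable ?B"
      by (intro borel_measurable_mat) (simp add: mat_of_def)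
  qed (simp add: mat_of_mats)
  have "distr (lebesgue_mats p r) (lebesgue_mats p r) ?G = distr (lebesgue_mats p r) ?B ?G"
    by (rule distr_cong) auto
  also have "\<dots> = distr (coord_lborel p r) ?B (?G \<circ> mat_of p r)"
    unfolding lebesgue_mats_eq by (rule distr_distr[OF G measurable_mat_of])
  also have "\<dots> = distr (coord_lborel p r) ?B (mat_of p r \<circ> ?F)"
    by (intro distr_cong) (auto simp: mat_of_def fun_eq_iff)
  also have "\<dots> = distr (distr (coord_lborel p r) (coord_lborel p r) ?F) ?B (mat_of p r)"
    by (rule distr_distr[OF measurable_mat_of F, symmetric])
  also have "\<dots> = lebesgue_mats p r" by (simp only: dF lebesgue_mats_eq)
  finally show ?thesis .
qed

text \<open>
  The density of the Gaussian measure with respect to Lebesgue measure.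
\<close>

definition gauss_density :: "nat \<Rightarrow> nat \<Rightarrow> cmat \<Rightarrow> real" where
  "gauss_density p r z = exp (- Re (hs p r z z)) / pi ^ (p * r)"

lemma gaussian_mats_eq: "gaussian_mats p r = density (lebesgue_mats p r) (\<lambda>z. ennreal (gauss_density p r z))"
  by (simp add: gaussian_mats_def gauss_density_def)

lemma space_gaussian_mats [simp]: "space (gaussian_mats p r) = mats p r"
  and sets_gaussian_mats [simp, measurable_cong]: "sets (gaussian_mats p r) = sets (restrict_space borel (mats p r))"
  by (simp_all add: gaussian_mats_eq)

lemma measurable_gaussian_continuous:
  fixes f :: "cmat \<Rightarrow> 'b::topological_space"
  assumes "continuous_on (mats p r) f"
  shows "f \<in> borel_measurable (gaussian_mats p r)"
  using borel_measurable_continuous_on_restrict[OF assms] by (simp cong: measurable_cong_sets)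

lemma measurable_gauss_density [measurable]:
  "gauss_density p r \<in> borel_measurable (lebesgue_mats p r)"
proof -
  have "gauss_density p r \<in> borel_measurable (restrict_space borel (mats p r))"
    unfolding gauss_density_def
    by (intro borel_measurable_continuous_on_restrict continuous_on_divide continuous_on_exp continuous_on_minus
        continuous_on_Re mat_continuous_intros) simp
  then show ?thesis by (simp cong: measurable_cong_sets)
qed

lemma gauss_density_nonneg [simp]: "0 \<le> gauss_density p r z"
  by (simp add: gauss_density_def)

lemma nn_integral_exp_cmod_squared: "(\<integral>\<^sup>+ w. ennreal (exp (- (cmod w)\<^sup>2) / pi) \<partial>lborel) = 1"
proof -
  have real: "(\<integral>\<^sup>+ x. ennreal (exp (- x\<^sup>2) / sqrt pi) \<partial>lborel) = 1"
  proof -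
    interpret prob_space "density lborel (\<lambda>x. ennreal (normal_density 0 (1 / sqrt 2) x))"
      by (rule prob_space_normal_density) simp
    have "(\<integral>\<^sup>+ x. ennreal (normal_density 0 (1 / sqrt 2) x) \<partial>lborel) = 1"
      using emeasure_space_1 by (subst (asm) emeasure_density) auto
    moreover have "normal_density 0 (1 / sqrt 2) x = exp (- x\<^sup>2) / sqrt pi" for x
      by (simp add: normal_density_def power_divide)
    ultimately show ?thesis by simp
  qed
  have "(\<integral>\<^sup>+ w. (\<Prod>b\<in>(Basis::complex set). ennreal (exp (- (w \<bullet> b)\<^sup>2) / sqrt pi)) \<partial>lborel) =
      (\<Prod>b\<in>(Basis::complex set). \<integral>\<^sup>+ x. ennreal (exp (- x\<^sup>2) / sqrt pi) \<partial>lborel)"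
    by (rule nn_integral_lborel_prod) auto
  then have "(\<integral>\<^sup>+ w. (\<Prod>b\<in>(Basis::complex set). ennreal (exp (- (w \<bullet> b)\<^sup>2) / sqrt pi)) \<partial>lborel) = 1"
    by (simp add: real)
  moreover have "(\<Prod>b\<in>Basis. ennreal (exp (- (w \<bullet> b)\<^sup>2) / sqrt pi)) = ennreal (exp (- (cmod w)\<^sup>2) / pi)" for w :: complex
    by (simp add: Basis_complex_def ennreal_mult[symmetric] cmod_power2 exp_add[symmetric])
  ultimately show ?thesis by simp
qed

lemma prob_space_gaussian_mats: "prob_space (gaussian_mats p r)"
proof (rule prob_spaceI)
  let ?I = "{..<p} \<times> {..<r}"
  interpret product_sigma_finite "\<lambda>_::nat \<times> nat. lborel :: complex measure" by (rule product_sigma_finite_lborel)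
  have "emeasure (gaussian_mats p r) (space (gaussian_mats p r)) =
      (\<integral>\<^sup>+ z. ennreal (gauss_density p r z) \<partial>lebesgue_mats p r)"
    unfolding gaussian_mats_eq using sets.top[of "lebesgue_mats p r"]
    by (subst emeasure_density) (auto intro!: nn_integral_cong)
  also have "\<dots> = (\<integral>\<^sup>+ x. ennreal (gauss_density p r (mat_of p r x)) \<partial>coord_lborel p r)"
    using measurable_gauss_density[of p r] unfolding lebesgue_mats_eq
    by (subst nn_integral_distr[OF measurable_mat_of]) auto
  also have "\<dots> = (\<integral>\<^sup>+ x. (\<Prod>k\<in>?I. ennreal (exp (- (cmod (x k))\<^sup>2) / pi)) \<partial>coord_lborel p r)"
  proof (intro nn_integral_cong)
    fix x :: "nat \<times> nat \<Rightarrow> complex"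
    have "(\<Sum>i<p. \<Sum>j<r. (cmod (mat_of p r x i j))\<^sup>2) = (\<Sum>k\<in>?I. (cmod (x k))\<^sup>2)"
      by (simp add: sum.cartesian_product mat_of_def case_prod_beta)
    then have "gauss_density p r (mat_of p r x) = exp (\<Sum>k\<in>?I. - (cmod (x k))\<^sup>2) / (\<Prod>k\<in>?I. pi)"
      by (simp add: gauss_density_def hs_self sum_negf)
    also have "\<dots> = (\<Prod>k\<in>?I. exp (- (cmod (x k))\<^sup>2) / pi)"
      by (simp add: exp_sum prod_dividef)
    finally show "ennreal (gauss_density p r (mat_of p r x)) = (\<Prod>k\<in>?I. ennreal (exp (- (cmod (x k))\<^sup>2) / pi))"
      by (simp add: prod_ennreal)
  qed
  also have "\<dots> = (\<Prod>k\<in>?I. \<integral>\<^sup>+ w. ennreal (exp (- (cmod w)\<^sup>2) / pi) \<partial>lborel)"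
    by (rule product_nn_integral_prod) auto
  also have "\<dots> = 1" by (simp add: nn_integral_exp_cmod_squared)
  finally show "emeasure (gaussian_mats p r) (space (gaussian_mats p r)) = 1" .
qed

lemma measurable_mats_add:
  assumes "z0 \<in> mats p r"
  shows "(\<lambda>z. z + z0) \<in> measurable (restrict_space borel (mats p r)) (restrict_space borel (mats p r))"
  by (intro measurable_restrict_space2 borel_measurable_continuous_on_restrict mat_continuous_intros)
    (use assms in \<open>auto simp: mats_add space_restrict_space\<close>)

lemma lebesgue_mats_translate:
  assumes z0: "z0 \<in> mats p r"
  shows "distr (lebesgue_mats p r) (lebesgue_mats p r) (\<lambda>z. z + z0) = lebesgue_mats p r"
proof -
  have "distr (lebesgue_mats p r) (lebesgue_mats p r) (\<lambda>z. z + z0) =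
      distr (lebesgue_mats p r) (lebesgue_mats p r) (\<lambda>z. mat_of p r (\<lambda>(i, j). z0 i j + z i j))"
    by (intro distr_cong) (use z0 in \<open>auto simp: mat_of_def fun_eq_iff mats_iff not_less\<close>)
  also have "\<dots> = lebesgue_mats p r"
    by (intro lebesgue_mats_map[where f = "\<lambda>i j w. z0 i j + w"] lborel_distr_plus) simp
  finally show ?thesis .
qed

lemma gauss_density_translate:
  "gauss_density p r (z + z0) = gauss_density p r z * exp (- Re (hs p r z0 z0) - 2 * Re (hs p r z z0))"
proof -
  have "Re (hs p r z0 z) = Re (hs p r z z0)" using hs_cnj[of p r z z0] by (metis complex_cnj_cancel_iff cnj.simps(1))
  then show ?thesis
    by (simp add: gauss_density_def mmul_add_left mmul_add_right flip: exp_add)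
qed

text \<open>
  The Cameron-Martin formula: the Gaussian measure with the displayed density is moved to the
  Gaussian measure by the translation by \<open>z0\<close>.  The density is the square of the modulus of the
  multiplier of \<open>T\<^sup>1(0, z0)\<close>, which is why \<open>T\<^sup>1\<close> is unitary.
\<close>

lemma gaussian_translate:
  assumes z0: "z0 \<in> mats p r"
  shows "distr (density (gaussian_mats p r) (\<lambda>z. ennreal (exp (- Re (hs p r z0 z0) - 2 * Re (hs p r z z0)))))
    (gaussian_mats p r) (\<lambda>z. z + z0) = gaussian_mats p r" (is "?M = _")
proof (rule measure_eqI)
  let ?e = "\<lambda>z. exp (- Re (hs p r z0 z0) - 2 * Re (hs p r z z0))"
  show "sets ?M = sets (gaussian_mats p r)" by simp
  fix A assume "A \<in> sets ?M"
  then have A: "A \<in> sets (restrict_space borel (mats p r))" by simp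
  have e: "?e \<in> borel_measurable (gaussian_mats p r)"
    by (intro measurable_gaussian_continuous continuous_on_exp continuous_on_diff continuous_on_mult
        continuous_on_const continuous_on_Re mat_continuous_intros)
  have e': "?e \<in> borel_measurable (lebesgue_mats p r)"
    using e by (simp cong: measurable_cong_sets)
  note t = measurable_mats_add[OF z0]
  have At: "(\<lambda>z. z + z0) -` A \<inter> mats p r \<in> sets (restrict_space borel (mats p r))"
    using measurable_sets[OF t A] by (simp add: space_restrict_space)
  have t': "(\<lambda>z. z + z0) \<in> measurable (lebesgue_mats p r) (lebesgue_mats p r)"
    using t by (simp cong: measurable_cong_sets)
  have "emeasure ?M A = emeasure (density (gaussian_mats p r) (\<lambda>z. ennreal (?e z))) ((\<lambda>z. z + z0) -` A \<inter> mats p r)"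
    using A t by (subst emeasure_distr) (auto cong: measurable_cong_sets)
  also have "\<dots> = (\<integral>\<^sup>+ z. ennreal (?e z) * indicator ((\<lambda>z. z + z0) -` A \<inter> mats p r) z \<partial>gaussian_mats p r)"
    using At e by (subst emeasure_density) auto
  also have "\<dots> = (\<integral>\<^sup>+ z. ennreal (gauss_density p r z) *
      (ennreal (?e z) * indicator ((\<lambda>z. z + z0) -` A \<inter> mats p r) z) \<partial>lebesgue_mats p r)"
    unfolding gaussian_mats_eq using At e' by (subst nn_integral_density) auto
  also have "\<dots> = (\<integral>\<^sup>+ z. ennreal (gauss_density p r (z + z0)) * indicator A (z + z0) \<partial>lebesgue_mats p r)"
    by (intro nn_integral_cong)
      (auto simp: gauss_density_translate ennreal_mult' indicator_def)
  also have "\<dots> = (\<integral>\<^sup>+ z. ennreal (gauss_density p r z) * indicator A z \<partial>distr (lebesgue_mats p r) (lebesgue_mats p r) (\<lambda>z. z + z0))"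
    using A by (subst nn_integral_distr[OF t']) auto
  also have "\<dots> = emeasure (gaussian_mats p r) A"
    unfolding lebesgue_mats_translate[OF z0] gaussian_mats_eq using A by (subst emeasure_density) auto
  finally show "emeasure ?M A = emeasure (gaussian_mats p r) A" .
qed

lemma gaussian_translate_integral:
  fixes h :: "cmat \<Rightarrow> 'b::{banach, second_countable_topology}"
  assumes z0: "z0 \<in> mats p r" and h: "h \<in> borel_measurable (gaussian_mats p r)"
  shows "integrable (gaussian_mats p r) (\<lambda>z. exp (- Re (hs p r z0 z0) - 2 * Re (hs p r z z0)) *\<^sub>R h (z + z0)) \<longleftrightarrow>
      integrable (gaussian_mats p r) h"
    "(\<integral>z. exp (- Re (hs p r z0 z0) - 2 * Re (hs p r z z0)) *\<^sub>R h (z + z0) \<partial>gaussian_mats p r) =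
      (\<integral>z. h z \<partial>gaussian_mats p r)"
proof -
  let ?e = "\<lambda>z. exp (- Re (hs p r z0 z0) - 2 * Re (hs p r z z0))"
  let ?D = "density (gaussian_mats p r) (\<lambda>z. ennreal (?e z))"
  have e: "?e \<in> borel_measurable (gaussian_mats p r)"
    by (intro measurable_gaussian_continuous continuous_on_exp continuous_on_diff continuous_on_mult
        continuous_on_const continuous_on_Re mat_continuous_intros)
  have t: "(\<lambda>z. z + z0) \<in> measurable ?D (gaussian_mats p r)"
    using measurable_mats_add[OF z0] by (simp cong: measurable_cong_sets)
  have t': "(\<lambda>z. z + z0) \<in> measurable (gaussian_mats p r) (gaussian_mats p r)"
    using measurable_mats_add[OF z0] by (simp cong: measurable_cong_sets)
  have ht: "(\<lambda>z. h (z + z0)) \<in> borel_measurable (gaussian_mats p r)"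
    by (rule measurable_compose[OF t' h])
  show "integrable (gaussian_mats p r) (\<lambda>z. ?e z *\<^sub>R h (z + z0)) \<longleftrightarrow> integrable (gaussian_mats p r) h"
    using integrable_distr_eq[OF t h] integrable_density[OF ht e] by (simp add: gaussian_translate[OF z0])
  show "(\<integral>z. ?e z *\<^sub>R h (z + z0) \<partial>gaussian_mats p r) = (\<integral>z. h z \<partial>gaussian_mats p r)"
    using integral_distr[OF t h] integral_density[OF ht e] by (simp add: gaussian_translate[OF z0])
qed

text \<open>
  Multiplication of the entry in position \<open>(a, b)\<close> by \<open>c\<close>: a rotation of one coordinate plane if
  \<open>c\<close> has modulus \<open>1\<close>, and the projection that deletes the entry if \<open>c = 0\<close>.
\<close>

definition mat_rotate :: "nat \<Rightarrow> nat \<Rightarrow> complex \<Rightarrow> cmat \<Rightarrow> cmat" where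
  "mat_rotate a b c z = z(a := (z a)(b := c * z a b))"

lemma mat_rotate_mats: "z \<in> mats p r \<Longrightarrow> mat_rotate a b c z \<in> mats p r"
  by (auto simp: mat_rotate_def mats_def)

lemma measurable_mat_rotate:
  "mat_rotate a b c \<in> measurable (restrict_space borel (mats p r)) (restrict_space borel (mats p r))"
proof -
  have "continuous_on (mats p r) (mat_rotate a b c)"
    unfolding mat_rotate_def
  proof (rule continuous_on_mat)
    fix i j
    have "continuous_on (mats p r) (\<lambda>z. c * z a b)" "continuous_on (mats p r) (\<lambda>z. z i j)"
      by (intro continuous_on_mult_left continuous_on_mat_entry[OF continuous_on_id])+
    then have "continuous_on (mats p r) (\<lambda>z. if i = a \<and> j = b then c * z a b else z i j)"
      by (cases "i = a"; cases "j = b") simp_all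
    then show "continuous_on (mats p r) (\<lambda>z. (z(a := (z a)(b := c * z a b))) i j)"
      by (rule continuous_on_eq) auto
  qed
  then show ?thesis
    by (intro measurable_restrict_space2 borel_measurable_continuous_on_restrict)
      (auto simp: space_restrict_space mat_rotate_mats)
qed

lemma gaussian_rotate:
  assumes ab: "a < p" "b < r"
  shows "distr (gaussian_mats p r) (gaussian_mats p r) (mat_rotate a b (cis \<theta>)) = gaussian_mats p r"
proof -
  let ?R = "mat_rotate a b (cis \<theta>)"
  have R: "?R \<in> measurable (lebesgue_mats p r) (lebesgue_mats p r)"
    using measurable_mat_rotate by (simp cong: measurable_cong_sets)
  have "distr (lebesgue_mats p r) (lebesgue_mats p r) ?R =
      distr (lebesgue_mats p r) (lebesgue_mats p r)
        (\<lambda>z. mat_of p r (\<lambda>(i, j). (if i = a \<and> j = b then (\<lambda>w. cis \<theta> * w) else (\<lambda>w. w)) (z i j)))"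
    using ab by (intro distr_cong) (auto simp: mat_of_def fun_eq_iff mats_iff not_less mat_rotate_def)
  also have "\<dots> = lebesgue_mats p r"
    by (intro lebesgue_mats_map[where f = "\<lambda>i j. if i = a \<and> j = b then (\<lambda>w. cis \<theta> * w) else (\<lambda>w. w)"])
      (auto simp: lborel_rotate distr_id2)
  finally have L: "distr (lebesgue_mats p r) (lebesgue_mats p r) ?R = lebesgue_mats p r" .
  have inv: "gauss_density p r (?R z) = gauss_density p r z" for z
  proof -
    have "(\<Sum>i<p. \<Sum>j<r. (cmod (?R z i j))\<^sup>2) = (\<Sum>i<p. \<Sum>j<r. (cmod (z i j))\<^sup>2)"
      by (intro sum.cong refl) (auto simp: mat_rotate_def norm_mult)
    then show ?thesis by (simp only: gauss_density_def hs_self)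
  qed
  have "gaussian_mats p r = density (distr (lebesgue_mats p r) (lebesgue_mats p r) ?R) (\<lambda>z. ennreal (gauss_density p r z))"
    by (simp add: L gaussian_mats_eq)
  also have "\<dots> = distr (density (lebesgue_mats p r) (\<lambda>z. ennreal (gauss_density p r (?R z)))) (lebesgue_mats p r) ?R"
    by (rule density_distr) (use R in auto)
  also have "\<dots> = distr (gaussian_mats p r) (gaussian_mats p r) ?R"
    unfolding inv by (intro distr_cong) (auto simp: gaussian_mats_eq)
  finally show ?thesis by simp
qed

lemma gaussian_rotate_integral:
  fixes h :: "cmat \<Rightarrow> 'b::{banach, second_countable_topology}"
  assumes "a < p" "b < r" and h: "h \<in> borel_measurable (gaussian_mats p r)"
  shows "integrable (gaussian_mats p r) (\<lambda>z. h (mat_rotate a b (cis \<theta>) z)) \<longleftrightarrow> integrable (gaussian_mats p r) h"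
    "(\<integral>z. h (mat_rotate a b (cis \<theta>) z) \<partial>gaussian_mats p r) = (\<integral>z. h z \<partial>gaussian_mats p r)"
proof -
  have R: "mat_rotate a b (cis \<theta>) \<in> measurable (gaussian_mats p r) (gaussian_mats p r)"
    using measurable_mat_rotate by (simp cong: measurable_cong_sets)
  show "integrable (gaussian_mats p r) (\<lambda>z. h (mat_rotate a b (cis \<theta>) z)) \<longleftrightarrow> integrable (gaussian_mats p r) h"
    "(\<integral>z. h (mat_rotate a b (cis \<theta>) z) \<partial>gaussian_mats p r) = (\<integral>z. h z \<partial>gaussian_mats p r)"
    using integrable_distr_eq[OF R h] integral_distr[OF R h]
    by (simp_all add: gaussian_rotate[OF assms(1,2)])
qed

section \<open>The Bargmann space\<close>

text \<open>
  Lebesgue measure on the unit interval, the parameter space for averages over circles.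
\<close>

abbreviation unit_interval :: "real measure" where
  "unit_interval \<equiv> restrict_space lborel {0..1}"

lemma prob_space_unit_interval: "prob_space unit_interval"
  by (rule prob_spaceI) (simp add: emeasure_restrict_space space_restrict_space)

lemma circle_mean:
  assumes f: "f holomorphic_on UNIV"
  shows "(\<integral>t. f (cis (2 * pi * t)) \<partial>unit_interval) = f 0"
proof -
  let ?g = "\<lambda>t::real. f (cis (2 * pi * t))"
  have c: "continuous_on UNIV f" using f by (rule holomorphic_on_imp_continuous_on)
  have cg: "continuous_on {0..1} ?g"
    by (rule continuous_on_compose2[OF c]) (auto intro!: continuous_intros)
  have e: "exp (2 * complex_of_real pi * \<i> * complex_of_real t) = cis (2 * pi * t)" for t
    by (simp add: cis_conv_exp mult_ac)
  have "((\<lambda>u. f u / (u - 0)) has_contour_integral (2 * of_real pi * \<i> * f 0)) (circlepath 0 1)"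
    by (rule Cauchy_integral_circlepath_simple) (use f holomorphic_on_subset in auto)
  then have "((\<lambda>t. f (circlepath 0 1 t) / circlepath 0 1 t * vector_derivative (circlepath 0 1) (at t within {0..1}))
      has_integral (2 * of_real pi * \<i> * f 0)) {0..1}"
    by (simp add: has_contour_integral_def)
  then have "((\<lambda>t. 2 * of_real pi * \<i> * ?g t) has_integral (2 * of_real pi * \<i> * f 0)) {0..1}"
  proof (rule has_integral_eq[rotated])
    fix t :: real assume "t \<in> {0..1}"
    then have "vector_derivative (circlepath 0 1) (at t within {0..1}) = 2 * pi * \<i> * cis (2 * pi * t)"
      using vector_derivative_circlepath01[of t 0 1] by (simp add: e)
    moreover have "circlepath 0 1 t = cis (2 * pi * t)" by (simp add: circlepath e)
    ultimately show "f (circlepath 0 1 t) / circlepath 0 1 t * vector_derivative (circlepath 0 1) (at t within {0..1}) =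
        2 * of_real pi * \<i> * ?g t"
      by simp
  qed
  from has_integral_mult_right[OF this, of "1 / (2 * of_real pi * \<i>)"]
  have "(?g has_integral f 0) {0..1}" by (simp add: field_simps)
  then have "integral {0..1} ?g = f 0" by (rule integral_unique)
  moreover have "(LINT t:{0..1}|lborel. ?g t) = integral {0..1} ?g"
    by (intro set_borel_integral_eq_integral borel_integrable_atLeastAtMost' cg)
  ultimately show ?thesis
    by (simp add: integral_restrict_space set_lebesgue_integral_def)
qed

lemma holomorphic_mats_measurable:
  "holomorphic_mats p r \<phi> \<Longrightarrow> \<phi> \<in> borel_measurable (gaussian_mats p r)"
  by (auto simp: holomorphic_mats_def intro: measurable_gaussian_continuous)

lemma holomorphic_mats_rotate:
  assumes "holomorphic_mats p r \<phi>" "z \<in> mats p r" "a < p" "b < r"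
  shows "(\<lambda>c. \<phi> (mat_rotate a b c z)) holomorphic_on UNIV"
proof -
  have h: "(\<lambda>w. \<phi> (z(a := (z a)(b := w)))) holomorphic_on UNIV"
    using assms by (auto simp: holomorphic_mats_def)
  have "((\<lambda>w. \<phi> (z(a := (z a)(b := w)))) \<circ> (\<lambda>c. c * z a b)) holomorphic_on UNIV"
    by (rule holomorphic_on_compose[OF _ holomorphic_on_subset[OF h]]) (auto intro!: holomorphic_intros)
  then show ?thesis by (simp add: comp_def mat_rotate_def)
qed

text \<open>
  Averaging over the rotations of one coordinate replaces this coordinate by \<open>0\<close>, by the mean
  value property in one variable, and does not change the Gaussian integral.
\<close>

lemma gaussian_zero_coordinate:
  assumes \<phi>: "holomorphic_mats p r \<phi>" "integrable (gaussian_mats p r) \<phi>" and ab: "a < p" "b < r"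
  shows "integrable (gaussian_mats p r) (\<lambda>z. \<phi> (mat_rotate a b 0 z))"
    "(\<integral>z. \<phi> (mat_rotate a b 0 z) \<partial>gaussian_mats p r) = (\<integral>z. \<phi> z \<partial>gaussian_mats p r)"
proof -
  let ?\<mu> = "gaussian_mats p r"
  interpret K: prob_space unit_interval by (rule prob_space_unit_interval)
  interpret G: prob_space ?\<mu> by (rule prob_space_gaussian_mats)
  interpret P: pair_sigma_finite unit_interval ?\<mu> ..
  let ?R = "\<lambda>t. mat_rotate a b (cis (2 * pi * t))"
  note [measurable] = holomorphic_mats_measurable[OF \<phi>(1)]
  have sets: "sets (unit_interval \<Otimes>\<^sub>M ?\<mu>) = sets (restrict_space borel {0..1} \<Otimes>\<^sub>M restrict_space borel (mats p r))"
    by (intro sets_pair_measure_cong sets_restrict_space_cong) simp_all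
  have "(\<lambda>x. ?R (fst x) (snd x)) \<in> borel_measurable (unit_interval \<Otimes>\<^sub>M ?\<mu>)"
  proof (rule borel_measurable_mat)
    fix i j
    have e: "(\<lambda>z. z i j) \<in> borel_measurable ?\<mu>" for i j
      by (intro measurable_gaussian_continuous continuous_on_mat_entry continuous_on_id)
    have e': "(\<lambda>x. snd x i j) \<in> borel_measurable (unit_interval \<Otimes>\<^sub>M ?\<mu>)" for i j
      by (rule measurable_compose[OF measurable_snd e])
    have "(\<lambda>t. cis (2 * pi * t)) \<in> borel_measurable borel"
      by (intro borel_measurable_continuous_onI continuous_on_cis continuous_intros)
    then have "(\<lambda>t. cis (2 * pi * t)) \<in> borel_measurable unit_interval"
      by (intro measurable_restrict_space1) simp
    from measurable_compose[OF measurable_fst this]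
    have c: "(\<lambda>x. cis (2 * pi * fst x)) \<in> borel_measurable (unit_interval \<Otimes>\<^sub>M ?\<mu>)" .
    have "(\<lambda>x. if i = a \<and> j = b then cis (2 * pi * fst x) * snd x a b else snd x i j) \<in> borel_measurable (unit_interval \<Otimes>\<^sub>M ?\<mu>)"
      using borel_measurable_times[OF c e'[of a b]] e'[of i j] by simp
    then show "(\<lambda>x. ?R (fst x) (snd x) i j) \<in> borel_measurable (unit_interval \<Otimes>\<^sub>M ?\<mu>)"
      by (rule measurable_cong[THEN iffD1, rotated]) (auto simp: mat_rotate_def)
  qed
  then have "(\<lambda>x. ?R (fst x) (snd x)) \<in> measurable (unit_interval \<Otimes>\<^sub>M ?\<mu>) (restrict_space borel (mats p r))"
    by (intro measurable_restrict_space2) (auto simp: space_pair_measure mat_rotate_mats)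
  then have R: "(\<lambda>x. ?R (fst x) (snd x)) \<in> measurable (unit_interval \<Otimes>\<^sub>M ?\<mu>) ?\<mu>"
    by (simp cong: measurable_cong_sets)
  note int = gaussian_rotate_integral[OF ab]
  have I: "integrable (unit_interval \<Otimes>\<^sub>M ?\<mu>) (\<lambda>(t, z). \<phi> (?R t z))"
  proof (rule P.Fubini_integrable)
    show "(\<lambda>(t, z). \<phi> (?R t z)) \<in> borel_measurable (unit_interval \<Otimes>\<^sub>M ?\<mu>)"
      using measurable_compose[OF R holomorphic_mats_measurable[OF \<phi>(1)]] by (simp add: case_prod_beta)
    have "integrable unit_interval (\<lambda>t. \<integral>z. norm (\<phi> z) \<partial>?\<mu>)" by simp
    also have "?this \<longleftrightarrow> integrable unit_interval (\<lambda>t. \<integral>z. norm (case (t, z) of (t, z) \<Rightarrow> \<phi> (?R t z)) \<partial>?\<mu>)"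
      by (intro Bochner_Integration.integrable_cong refl)
        (simp add: space_restrict_space int(2)[where h = "\<lambda>z. norm (\<phi> z)"])
    finally show "integrable unit_interval (\<lambda>t. \<integral>z. norm (case (t, z) of (t, z) \<Rightarrow> \<phi> (?R t z)) \<partial>?\<mu>)" .
    show "AE t in unit_interval. integrable ?\<mu> (\<lambda>z. case (t, z) of (t, z) \<Rightarrow> \<phi> (?R t z))"
      using \<phi>(2) int(1)[OF holomorphic_mats_measurable[OF \<phi>(1)]] by (intro AE_I2) (simp add: space_restrict_space)
  qed
  have mean: "(\<integral>t. \<phi> (?R t z) \<partial>unit_interval) = \<phi> (mat_rotate a b 0 z)" if "z \<in> mats p r" for z
    by (rule circle_mean[OF holomorphic_mats_rotate[OF \<phi>(1) that ab]])
  have "integrable ?\<mu> (\<lambda>z. \<integral>t. \<phi> (?R t z) \<partial>unit_interval)"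
    using P.integrable_snd[OF I] .
  also have "?this \<longleftrightarrow> integrable ?\<mu> (\<lambda>z. \<phi> (mat_rotate a b 0 z))"
    by (intro Bochner_Integration.integrable_cong refl mean) simp
  finally show "integrable ?\<mu> (\<lambda>z. \<phi> (mat_rotate a b 0 z))" .
  have "(\<integral>z. \<phi> (mat_rotate a b 0 z) \<partial>?\<mu>) = (\<integral>z. \<integral>t. \<phi> (?R t z) \<partial>unit_interval \<partial>?\<mu>)"
    by (intro Bochner_Integration.integral_cong refl mean[symmetric]) simp
  also have "\<dots> = (\<integral>t. \<integral>z. \<phi> (?R t z) \<partial>?\<mu> \<partial>unit_interval)"
    by (rule P.Fubini_integral[OF I])
  also have "\<dots> = (\<integral>t. \<integral>z. \<phi> z \<partial>?\<mu> \<partial>unit_interval)"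
    by (intro Bochner_Integration.integral_cong refl int(2)) (auto simp: space_restrict_space)
  also have "\<dots> = (\<integral>z. \<phi> z \<partial>?\<mu>)"
    using K.prob_space by simp
  finally show "(\<integral>z. \<phi> (mat_rotate a b 0 z) \<partial>?\<mu>) = (\<integral>z. \<phi> z \<partial>?\<mu>)" .
qed

lemma holomorphic_mats_continuous_compose:
  assumes "holomorphic_mats p r \<phi>" "continuous_on (mats p r) h" "h ` mats p r \<subseteq> mats p r"
  shows "continuous_on (mats p r) (\<lambda>z. \<phi> (h z))"
  by (rule continuous_on_compose2[OF _ assms(2,3)]) (use assms(1) in \<open>simp add: holomorphic_mats_def\<close>)

text \<open>
  The mean value property in several variables is obtained by deleting the coordinates one at
  a time; this only uses that the function is holomorphic in each variable separately.
\<close>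

lemma gaussian_mean_value:
  assumes \<phi>: "holomorphic_mats p r \<phi>" "integrable (gaussian_mats p r) \<phi>"
  shows "(\<integral>z. \<phi> z \<partial>gaussian_mats p r) = \<phi> 0"
proof -
  let ?\<mu> = "gaussian_mats p r"
  interpret G: prob_space ?\<mu> by (rule prob_space_gaussian_mats)
  \<comment> \<open>\<open>zero A\<close> deletes the entries whose positions lie in \<open>A\<close>.\<close>
  define zero where "zero A z = (\<lambda>i j. if (i, j) \<in> A then 0 else z i j)" for A and z :: cmat
  have hol: "holomorphic_mats p r (\<lambda>z. \<phi> (zero A z))" for A
    unfolding holomorphic_mats_def
  proof (intro conjI ballI allI impI)
    have "continuous_on (mats p r) (zero A)"
      unfolding zero_def
    proof (rule continuous_on_mat)
      fix i j
      show "continuous_on (mats p r) (\<lambda>z. if (i, j) \<in> A then 0 else z i j)"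
        using continuous_on_mat_entry[OF continuous_on_id, of "mats p r" i j] by (cases "(i, j) \<in> A") simp_all
    qed
    moreover have "zero A ` mats p r \<subseteq> mats p r" by (auto simp: zero_def mats_def)
    ultimately show "continuous_on (mats p r) (\<lambda>z. \<phi> (zero A z))"
      by (rule holomorphic_mats_continuous_compose[OF \<phi>(1)])
    fix z i j assume z: "z \<in> mats p r" "i < p" "j < r"
    show "(\<lambda>w. \<phi> (zero A (z(i := (z i)(j := w))))) holomorphic_on UNIV"
    proof (cases "(i, j) \<in> A")
      case True
      then have "zero A (z(i := (z i)(j := w))) = zero A z" for w by (auto simp: zero_def fun_eq_iff)
      then show ?thesis by simp
    next
      case False
      then have "zero A (z(i := (z i)(j := w))) = (zero A z)(i := (zero A z i)(j := w))" for w
        by (auto simp: zero_def fun_eq_iff)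
      moreover have "zero A z \<in> mats p r" using z by (auto simp: zero_def mats_def)
      ultimately show ?thesis using \<phi>(1) z by (simp add: holomorphic_mats_def)
    qed
  qed
  have *: "integrable ?\<mu> (\<lambda>z. \<phi> (zero A z)) \<and> (\<integral>z. \<phi> (zero A z) \<partial>?\<mu>) = (\<integral>z. \<phi> z \<partial>?\<mu>)"
    if "finite A" "A \<subseteq> {..<p} \<times> {..<r}" for A
    using that
  proof (induction A rule: finite_induct)
    case empty
    then show ?case using \<phi>(2) by (simp add: zero_def)
  next
    case (insert k A)
    obtain a b where k: "k = (a, b)" by (cases k)
    have "zero A (mat_rotate a b 0 z) = zero (insert k A) z" for z
      by (auto simp: zero_def mat_rotate_def k fun_eq_iff)
    then show ?case
      using gaussian_zero_coordinate[OF hol[of A], of a b] insert by (auto simp: k)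
  qed
  have "(\<integral>z. \<phi> z \<partial>?\<mu>) = (\<integral>z. \<phi> (zero ({..<p} \<times> {..<r}) z) \<partial>?\<mu>)"
    using *[of "{..<p} \<times> {..<r}"] by simp
  also have "\<dots> = (\<integral>z. \<phi> 0 \<partial>?\<mu>)"
  proof (intro Bochner_Integration.integral_cong refl)
    fix z assume "z \<in> space ?\<mu>"
    then have "zero ({..<p} \<times> {..<r}) z = 0" by (auto simp: zero_def mats_def fun_eq_iff)
    then show "\<phi> (zero ({..<p} \<times> {..<r}) z) = \<phi> 0" by simp
  qed
  finally show ?thesis using G.prob_space by simp
qed

lemma bargmann_vectors:
  "\<phi> \<in> vectors (bargmann p q) \<longleftrightarrow> holomorphic_mats p (q - p) \<phi> \<and> \<phi> \<in> L2 (gaussian_mats p (q - p))"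
  by (auto simp: bargmann_def L2_def holomorphic_mats_measurable)

lemma bargmann_inner: "inner_prod (bargmann p q) \<phi> \<psi> = (\<integral>z. \<phi> z * cnj (\<psi> z) \<partial>gaussian_mats p (q - p))"
  by (simp add: bargmann_def)

lemma bargmann_norm_squared: "(vnorm (bargmann p q) \<phi>)\<^sup>2 = sqnorm (gaussian_mats p (q - p)) \<phi>"
proof -
  have "(\<integral>z. \<phi> z * cnj (\<phi> z) \<partial>gaussian_mats p (q - p)) =
      (\<integral>z. complex_of_real ((cmod (\<phi> z))\<^sup>2) \<partial>gaussian_mats p (q - p))"
    by (simp add: complex_norm_square del: of_real_power)
  then have "inner_prod (bargmann p q) \<phi> \<phi> = complex_of_real (sqnorm (gaussian_mats p (q - p)) \<phi>)"
    by (simp add: bargmann_inner sqnorm_def del: of_real_power)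
  then show ?thesis by (simp add: vnorm_def sqnorm_nonneg)
qed

lemma holomorphic_mats_cong:
  assumes "\<And>z. z \<in> mats p r \<Longrightarrow> \<phi> z = \<psi> z"
  shows "holomorphic_mats p r \<phi> \<longleftrightarrow> holomorphic_mats p r \<psi>"
proof -
  have "(\<lambda>w. \<phi> (z(i := (z i)(j := w)))) = (\<lambda>w. \<psi> (z(i := (z i)(j := w))))"
    if "z \<in> mats p r" "i < p" "j < r" for z i j
    using assms mats_upd[OF that] by blast
  moreover have "continuous_on (mats p r) \<phi> \<longleftrightarrow> continuous_on (mats p r) \<psi>"
    by (rule continuous_on_cong[OF refl]) (rule assms)
  ultimately show ?thesis unfolding holomorphic_mats_def by auto
qed

lemma holomorphic_mats_const: "holomorphic_mats p r (\<lambda>z. c)"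
  by (simp add: holomorphic_mats_def)

lemma holomorphic_mats_diff:
  "holomorphic_mats p r \<phi> \<Longrightarrow> holomorphic_mats p r \<psi> \<Longrightarrow> holomorphic_mats p r (\<lambda>z. \<phi> z - \<psi> z)"
  by (auto simp: holomorphic_mats_def intro!: continuous_on_diff holomorphic_on_diff)

lemma holomorphic_mats_mult:
  "holomorphic_mats p r \<phi> \<Longrightarrow> holomorphic_mats p r \<psi> \<Longrightarrow> holomorphic_mats p r (\<lambda>z. \<phi> z * \<psi> z)"
  by (auto simp: holomorphic_mats_def intro!: continuous_on_mult holomorphic_on_mult)

lemma holomorphic_mats_translate:
  assumes \<phi>: "holomorphic_mats p r \<phi>" and z0: "z0 \<in> mats p r"
  shows "holomorphic_mats p r (\<lambda>z. \<phi> (z + z0))"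
  unfolding holomorphic_mats_def
proof (intro conjI ballI allI impI)
  have "continuous_on (mats p r) (\<lambda>z. z + z0)" by (intro mat_continuous_intros)
  moreover have "(\<lambda>z. z + z0) ` mats p r \<subseteq> mats p r" using z0 by (auto simp: mats_add)
  ultimately show "continuous_on (mats p r) (\<lambda>z. \<phi> (z + z0))"
    by (rule holomorphic_mats_continuous_compose[OF \<phi>])
  fix z i j assume z: "z \<in> mats p r" "i < p" "j < r"
  then have h: "(\<lambda>w. \<phi> ((z + z0)(i := ((z + z0) i)(j := w)))) holomorphic_on UNIV"
    using \<phi> mats_add[OF z(1) z0] by (auto simp: holomorphic_mats_def simp del: plus_fun_apply)
  have "((\<lambda>w. \<phi> ((z + z0)(i := ((z + z0) i)(j := w)))) \<circ> (\<lambda>w. w + z0 i j)) holomorphic_on UNIV"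
    by (rule holomorphic_on_compose[OF _ holomorphic_on_subset[OF h]]) (auto intro!: holomorphic_intros)
  moreover have "z(i := (z i)(j := w)) + z0 = (z + z0)(i := ((z + z0) i)(j := w + z0 i j))" for w
    by (auto simp: fun_eq_iff)
  ultimately show "(\<lambda>w. \<phi> (z(i := (z i)(j := w)) + z0)) holomorphic_on UNIV"
    by (simp add: comp_def del: plus_fun_apply)
qed

lemma holomorphic_mats_exp_hs: "holomorphic_mats p r (\<lambda>z. exp (c + d * hs p r z z0))"
  unfolding holomorphic_mats_def
proof (intro conjI ballI allI impI)
  show "continuous_on (mats p r) (\<lambda>z. exp (c + d * hs p r z z0))"
    by (intro continuous_on_exp continuous_on_add continuous_on_mult continuous_on_const mat_continuous_intros)
  fix z :: cmat and i j assume "z \<in> mats p r" "i < p" "j < r"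
  have "(\<lambda>w. if a = i \<and> b = j then w else z a b) holomorphic_on UNIV" for a b
    by (cases "a = i"; cases "b = j") simp_all
  then have "(\<lambda>w. \<Sum>a<p. \<Sum>b<r. (if a = i \<and> b = j then w else z a b) * cnj (z0 a b)) holomorphic_on UNIV"
    by (intro holomorphic_on_sum holomorphic_on_mult holomorphic_on_const)
  moreover have "hs p r (z(i := (z i)(j := w))) z0 = (\<Sum>a<p. \<Sum>b<r. (if a = i \<and> b = j then w else z a b) * cnj (z0 a b))" for w
    unfolding hs_sum by (intro sum.cong refl) auto
  ultimately show "(\<lambda>w. exp (c + d * hs p r (z(i := (z i)(j := w))) z0)) holomorphic_on UNIV"
    by (simp only:) (intro holomorphic_on_exp' holomorphic_on_add holomorphic_on_mult holomorphic_on_const)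
qed

lemma heisenberg_rep_holomorphic:
  assumes g: "g \<in> carrier (NG p q)" and \<phi>: "holomorphic_mats p (q - p) \<phi>"
  shows "holomorphic_mats p (q - p) (heisenberg_rep p q g \<phi>)"
proof -
  obtain n z0 where g': "g = (n, z0)" by (cases g)
  have z0: "z0 \<in> mats p (q - p)" using g by (simp add: g' NG_carrier)
  have "holomorphic_mats p (q - p) (\<lambda>z. exp ((mtrace p n - 1/2 * hs p (q - p) z0 z0) + (-1) * hs p (q - p) z z0) * \<phi> (z + z0))"
    by (intro holomorphic_mats_mult holomorphic_mats_exp_hs holomorphic_mats_translate \<phi> z0)
  then show ?thesis by (simp add: heisenberg_rep_def g')
qed

lemma cmod_heisenberg_rep:
  assumes "(n, z0) \<in> carrier (NG p q)"
  shows "(cmod (heisenberg_rep p q (n, z0) \<phi> z))\<^sup>2 =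
    exp (- Re (hs p (q - p) z0 z0) - 2 * Re (hs p (q - p) z z0)) *\<^sub>R (cmod (\<phi> (z + z0)))\<^sup>2"
proof -
  have "Re (mtrace p n) = 0" using assms by (intro mtrace_skew) (simp add: NG_carrier)
  then show ?thesis
    by (simp add: heisenberg_rep_def norm_mult power_mult_distrib flip: exp_double)
qed

text \<open>
  No holomorphy is needed here: \<open>T\<^sup>1(g)\<close> is isometric on all of \<open>L\<^sup>2(Z, \<mu>)\<close>.
\<close>

lemma heisenberg_rep_isometry:
  assumes g: "g \<in> carrier (NG p q)" and \<phi>: "\<phi> \<in> borel_measurable (gaussian_mats p (q - p))"
  shows "sqnorm (gaussian_mats p (q - p)) (heisenberg_rep p q g \<phi>) = sqnorm (gaussian_mats p (q - p)) \<phi>"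
    "integrable (gaussian_mats p (q - p)) (\<lambda>z. (cmod (heisenberg_rep p q g \<phi> z))\<^sup>2) \<longleftrightarrow>
      integrable (gaussian_mats p (q - p)) (\<lambda>z. (cmod (\<phi> z))\<^sup>2)"
proof -
  obtain n z0 where g': "g = (n, z0)" by (cases g)
  have z0: "z0 \<in> mats p (q - p)" using g by (simp add: g' NG_carrier)
  have m: "(\<lambda>z. (cmod (\<phi> z))\<^sup>2) \<in> borel_measurable (gaussian_mats p (q - p))" using \<phi> by measurable
  show "sqnorm (gaussian_mats p (q - p)) (heisenberg_rep p q g \<phi>) = sqnorm (gaussian_mats p (q - p)) \<phi>"
    "integrable (gaussian_mats p (q - p)) (\<lambda>z. (cmod (heisenberg_rep p q g \<phi> z))\<^sup>2) \<longleftrightarrow>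
      integrable (gaussian_mats p (q - p)) (\<lambda>z. (cmod (\<phi> z))\<^sup>2)"
    using gaussian_translate_integral[OF z0 m] g
    unfolding sqnorm_def g' by (simp_all add: cmod_heisenberg_rep[OF g[unfolded g']])
qed

lemma heisenberg_rep_bargmann:
  assumes g: "g \<in> carrier (NG p q)" and \<phi>: "\<phi> \<in> vectors (bargmann p q)"
  shows "heisenberg_rep p q g \<phi> \<in> vectors (bargmann p q)"
proof -
  have h: "holomorphic_mats p (q - p) (heisenberg_rep p q g \<phi>)"
    using \<phi> by (intro heisenberg_rep_holomorphic[OF g]) (simp add: bargmann_vectors)
  then show ?thesis
    using \<phi> heisenberg_rep_isometry(2)[OF g, of \<phi>] holomorphic_mats_measurable[OF h]
    by (auto simp: bargmann_vectors L2_def)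
qed

lemma bargmann_const: "(\<lambda>z. c) \<in> vectors (bargmann p q)"
proof -
  interpret prob_space "gaussian_mats p (q - p)" by (rule prob_space_gaussian_mats)
  show ?thesis by (simp add: bargmann_vectors holomorphic_mats_const L2_def)
qed

lemma sqnorm_gaussian_const: "sqnorm (gaussian_mats p r) (\<lambda>z. c) = (cmod c)\<^sup>2"
proof -
  interpret prob_space "gaussian_mats p r" by (rule prob_space_gaussian_mats)
  show ?thesis using prob_space by (simp add: sqnorm_def)
qed

lemma bargmann_diff: "\<phi> \<in> vectors (bargmann p q) \<Longrightarrow> \<psi> \<in> vectors (bargmann p q) \<Longrightarrow> (\<lambda>z. \<phi> z - \<psi> z) \<in> vectors (bargmann p q)"
  by (auto simp: bargmann_vectors intro: holomorphic_mats_diff L2_diff)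

lemma bargmann_scale: "\<phi> \<in> vectors (bargmann p q) \<Longrightarrow> (\<lambda>z. c * \<phi> z) \<in> vectors (bargmann p q)"
  by (auto simp: bargmann_vectors intro: holomorphic_mats_mult holomorphic_mats_const L2_scale)

lemma bargmann_integrable:
  assumes "\<phi> \<in> vectors (bargmann p q)"
  shows "integrable (gaussian_mats p (q - p)) \<phi>"
proof -
  interpret prob_space "gaussian_mats p (q - p)" by (rule prob_space_gaussian_mats)
  have \<phi>: "\<phi> \<in> L2 (gaussian_mats p (q - p))" using assms by (simp add: bargmann_vectors)
  note m = L2_measurable[OF \<phi>]
  have "integrable (gaussian_mats p (q - p)) (\<lambda>z. cmod (\<phi> z))"
    by (rule square_integrable_imp_integrable[OF measurable_compose[OF m borel_measurable_norm] L2_integrable[OF \<phi>]])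
  then show ?thesis using integrable_norm_iff[OF m] by simp
qed

lemma bargmann_mean_value:
  "\<phi> \<in> vectors (bargmann p q) \<Longrightarrow> (\<integral>z. \<phi> z \<partial>gaussian_mats p (q - p)) = \<phi> 0"
  by (intro gaussian_mean_value bargmann_integrable) (simp add: bargmann_vectors)

text \<open>
  The reproducing kernel at \<open>z0\<close> is a multiple of the coherent state \<open>T\<^sup>1(0, -z0) \<one>\<close>.
\<close>

lemma bargmann_kernel:
  assumes z0: "z0 \<in> mats p (q - p)"
  shows "(\<lambda>z. exp (hs p (q - p) z z0)) \<in> vectors (bargmann p q)"
proof -
  let ?r = "q - p"
  have "(0, - z0) \<in> carrier (NG p q)" using z0 by (auto simp: NG_carrier intro: mats_intros)
  from heisenberg_rep_bargmann[OF this bargmann_const, of 1]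
  have "(\<lambda>z. exp (1/2 * hs p ?r z0 z0) * heisenberg_rep p q (0, - z0) (\<lambda>z. 1) z) \<in> vectors (bargmann p q)"
    by (rule bargmann_scale)
  moreover have "exp (1/2 * hs p ?r z0 z0) * heisenberg_rep p q (0, - z0) (\<lambda>z. 1) z = exp (hs p ?r z z0)" for z
    by (simp add: heisenberg_rep_def mmul_uminus_left mmul_uminus_right flip: exp_add)
  ultimately show ?thesis by simp
qed

text \<open>
  The mean value property for the function \<open>T\<^sup>1(0, z0) \<phi>\<close>, whose value at the origin is a multiple
  of \<open>\<phi>(z0)\<close>, followed by a translation of the variable of integration.
\<close>

lemma bargmann_reproducing:
  assumes \<phi>: "\<phi> \<in> vectors (bargmann p q)" and z0: "z0 \<in> mats p (q - p)"
  shows "\<phi> z0 = inner_prod (bargmann p q) \<phi> (\<lambda>z. exp (hs p (q - p) z z0))"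
proof -
  let ?r = "q - p" let ?\<mu> = "gaussian_mats p ?r" let ?h = "hs p ?r"
  have g: "(0, z0) \<in> carrier (NG p q)" using z0 by (auto simp: NG_carrier intro: mats_intros)
  \<comment> \<open>After the translation, \<open>h\<close> is the integrand of the mean value of \<open>T\<^sup>1(0, z0) \<phi>\<close>.\<close>
  define h where "h z = exp (- (1/2) * ?h z0 z0) * (\<phi> z * cnj (exp (?h z z0)))" for z
  have "(\<lambda>z. cnj (exp (?h z z0))) \<in> borel_measurable ?\<mu>"
    by (intro measurable_gaussian_continuous continuous_on_cnj continuous_on_exp mat_continuous_intros)
  moreover have "\<phi> \<in> borel_measurable ?\<mu>"
    using \<phi> by (auto simp: bargmann_vectors L2_def)
  ultimately have h: "h \<in> borel_measurable ?\<mu>"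
    unfolding h_def by (intro borel_measurable_times borel_measurable_const)
  have real: "?h z0 z0 = complex_of_real (Re (?h z0 z0))" by (simp add: hs_self)
  have eq: "heisenberg_rep p q (0, z0) \<phi> z = exp (- Re (?h z0 z0) - 2 * Re (?h z z0)) *\<^sub>R h (z + z0)" for z
  proof -
    have Re2: "2 * complex_of_real (Re (?h z z0)) = ?h z z0 + cnj (?h z z0)" by (simp add: complex_add_cnj)
    have "?h (z + z0) z0 = ?h z z0 + ?h z0 z0" by (simp add: mmul_add_left)
    then have "cnj (?h (z + z0) z0) = cnj (?h z z0) + ?h z0 z0" using hs_cnj[of p ?r z0 z0] by simp
    moreover have "complex_of_real (- Re (?h z0 z0) - 2 * Re (?h z z0)) = - ?h z0 z0 - (?h z z0 + cnj (?h z z0))"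
      using Re2 real by simp
    ultimately have "complex_of_real (- Re (?h z0 z0) - 2 * Re (?h z z0)) + - (1/2) * ?h z0 z0 + cnj (?h (z + z0) z0) =
        - (1/2) * ?h z0 z0 - ?h z z0"
      by (simp add: algebra_simps)
    then have "exp (complex_of_real (- Re (?h z0 z0) - 2 * Re (?h z z0))) * (exp (- (1/2) * ?h z0 z0) * exp (cnj (?h (z + z0) z0))) =
        exp (- (1/2) * ?h z0 z0 - ?h z z0)"
      by (simp only: exp_add[symmetric] add.assoc)
    then show ?thesis
      by (simp add: heisenberg_rep_def h_def scaleR_conv_of_real exp_of_real[symmetric] exp_cnj mult_ac del: exp_of_real)
  qed
  have "exp (- (1/2) * ?h z0 z0) * \<phi> z0 = heisenberg_rep p q (0, z0) \<phi> 0"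
    by (simp add: heisenberg_rep_def mmul_zero)
  also have "\<dots> = (\<integral>z. heisenberg_rep p q (0, z0) \<phi> z \<partial>?\<mu>)"
    by (rule bargmann_mean_value[OF heisenberg_rep_bargmann[OF g \<phi>], symmetric])
  also have "\<dots> = (\<integral>z. h z \<partial>?\<mu>)"
    unfolding eq by (rule gaussian_translate_integral(2)[OF z0 h])
  also have "\<dots> = exp (- (1/2) * ?h z0 z0) * inner_prod (bargmann p q) \<phi> (\<lambda>z. exp (?h z z0))"
    unfolding h_def bargmann_inner by simp
  finally show ?thesis by simp
qed

text \<open>
  The displacement of the vacuum: \<open>\<parallel>T\<^sup>1(g)\<one> - \<one>\<parallel>\<^sup>2 = 2 (1 - Re \<langle>T\<^sup>1(g)\<one>, \<one>\<rangle>)\<close>, and the inner product is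
  the value of \<open>T\<^sup>1(g)\<one>\<close> at the origin.
\<close>

lemma vacuum_displacement:
  assumes g: "(n, z0) \<in> carrier (NG p q)"
  shows "sqnorm (gaussian_mats p (q - p)) (\<lambda>z. heisenberg_rep p q (n, z0) (\<lambda>z. 1) z - 1) =
    2 * (1 - Re (exp (mtrace p n - 1/2 * hs p (q - p) z0 z0)))"
proof -
  let ?\<mu> = "gaussian_mats p (q - p)" let ?u = "heisenberg_rep p q (n, z0) (\<lambda>z. 1)"
  interpret prob_space ?\<mu> by (rule prob_space_gaussian_mats)
  have u: "?u \<in> vectors (bargmann p q)" by (rule heisenberg_rep_bargmann[OF g bargmann_const])
  then have i: "integrable ?\<mu> (\<lambda>z. (cmod (?u z))\<^sup>2)" "integrable ?\<mu> ?u"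
    by (auto simp: bargmann_vectors L2_def intro: bargmann_integrable)
  have "(cmod (?u z - 1))\<^sup>2 = (cmod (?u z))\<^sup>2 + 1 - 2 * Re (?u z)" for z
    unfolding cmod_power2 by (simp add: power2_eq_square algebra_simps)
  then have "sqnorm ?\<mu> (\<lambda>z. ?u z - 1) = (\<integral>z. (cmod (?u z))\<^sup>2 + 1 - 2 * Re (?u z) \<partial>?\<mu>)"
    by (simp add: sqnorm_def)
  also have "\<dots> = sqnorm ?\<mu> ?u + 1 - 2 * Re (\<integral>z. ?u z \<partial>?\<mu>)"
    using i prob_space by (simp add: sqnorm_def)
  also have "sqnorm ?\<mu> ?u = 1"
    using heisenberg_rep_isometry(1)[OF g, of "\<lambda>z. 1"] by (simp add: sqnorm_gaussian_const)
  also have "(\<integral>z. ?u z \<partial>?\<mu>) = ?u 0" by (rule bargmann_mean_value[OF u])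
  finally show ?thesis by (simp add: heisenberg_rep_def mmul_zero)
qed

section \<open>Square integrable functions with values in the Bargmann space\<close>

text \<open>
  The function of two variables that belongs to a field of functions on \<open>S\<close>.
\<close>

definition unc :: "(cmat \<Rightarrow> cmat \<Rightarrow> complex) \<Rightarrow> cmat \<times> cmat \<Rightarrow> complex" where
  "unc F = (\<lambda>x. F (fst x) (snd x))"

lemma L2_iff_nn_integral:
  assumes "f \<in> borel_measurable M"
  shows "f \<in> L2 M \<longleftrightarrow> (\<integral>\<^sup>+ x. ennreal ((cmod (f x))\<^sup>2) \<partial>M) < \<infinity>"
  using assms by (simp add: L2_def integrable_iff_bounded)

lemma nn_integral_sqnorm: "f \<in> L2 M \<Longrightarrow> (\<integral>\<^sup>+ x. ennreal ((cmod (f x))\<^sup>2) \<partial>M) = ennreal (sqnorm M f)"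
  unfolding sqnorm_def by (intro nn_integral_eq_integral L2_integrable) auto

lemma countable_dense_mats:
  obtains e :: "nat \<Rightarrow> cmat"
  where "\<And>k. e k \<in> mats p r" "\<And>z \<epsilon>. z \<in> mats p r \<Longrightarrow> 0 < \<epsilon> \<Longrightarrow> \<exists>k. dist z (e k) < \<epsilon>"
proof -
  obtain D :: "cmat set" where D: "countable D" "\<And>X. open X \<Longrightarrow> X \<noteq> {} \<Longrightarrow> \<exists>d\<in>D. d \<in> X"
    using countable_dense_setE by blast
  define P :: "cmat \<Rightarrow> cmat" where "P z = (\<lambda>i j. if i < p \<and> j < r then z i j else 0)" for z
  have "continuous_on UNIV P"
    unfolding P_def
  proof (rule continuous_on_mat)
    fix i j
    show "continuous_on UNIV (\<lambda>z. if i < p \<and> j < r then z i j else (0::complex))"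
      using continuous_on_mat_entry[OF continuous_on_id, of UNIV i j] by (cases "i < p"; cases "j < r") simp_all
  qed
  then have "open (P -` ball z \<epsilon>)" for z \<epsilon> by (intro open_vimage) auto
  then have *: "\<exists>d\<in>D. P d \<in> ball z \<epsilon>" if "z \<in> mats p r" "0 < \<epsilon>" for z \<epsilon>
  proof -
    have "P z = z" using that by (auto simp: P_def mats_def fun_eq_iff)
    then have "z \<in> P -` ball z \<epsilon>" using that by simp
    then show ?thesis using D(2)[OF \<open>open (P -` ball z \<epsilon>)\<close>] by blast
  qed
  have "D \<noteq> {}" using D(2)[of UNIV] by auto
  show ?thesis
  proof (rule that[of "\<lambda>k. P (from_nat_into D k)"])
    show "P (from_nat_into D k) \<in> mats p r" for k by (auto simp: P_def mats_def)
    fix z and \<epsilon> :: real assume "z \<in> mats p r" "0 < \<epsilon>"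
    then obtain d where "d \<in> D" "P d \<in> ball z \<epsilon>" using * by blast
    then show "\<exists>k. dist z (P (from_nat_into D k)) < \<epsilon>"
      using from_nat_into_surj[OF D(1)] by (metis mem_ball)
  qed
qed

text \<open>
  A sigma finite Borel measure on the lower triangular group; \<open>K\<close> is the Bargmann space and \<open>H\<close> is
  \<open>L\<^sup>2(S, \<nu>; K)\<close>.
\<close>

locale lt_measure =
  fixes p q :: nat and \<nu> :: "cmat measure"
  assumes sets_nu: "sets \<nu> = sets (restrict_space borel (carrier (SG p)))"
    and sigma_finite_nu: "sigma_finite_measure \<nu>"
begin

abbreviation "\<mu> \<equiv> gaussian_mats p (q - p)"
abbreviation "M \<equiv> \<nu> \<Otimes>\<^sub>M \<mu>"
abbreviation "K \<equiv> bargmann p q"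
abbreviation "H \<equiv> L2_bargmann p q \<nu>"
abbreviation "Z \<equiv> mats p (q - p)"

lemma space_nu: "space \<nu> = carrier (SG p)"
  using sets_eq_imp_space_eq[OF sets_nu] by (simp add: space_restrict_space)

lemma space_M: "space M = carrier (SG p) \<times> Z"
  by (simp add: space_pair_measure space_nu)

sublocale nu: sigma_finite_measure \<nu> by (rule sigma_finite_nu)
sublocale mu: prob_space \<mu> by (rule prob_space_gaussian_mats)
sublocale P: pair_sigma_finite \<nu> \<mu> ..

lemma sigma_finite_M: "sigma_finite_measure M"
  by (rule P.sigma_finite_measure_axioms)

text \<open>
  A function that is measurable in \<open>s\<close> and continuous in \<open>z\<close> is jointly measurable: it is the
  pointwise limit of the functions obtained by replacing \<open>z\<close> by the first point of a dense
  sequence at distance less than \<open>1 / (n + 1)\<close>.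
\<close>

lemma measurable_caratheodory:
  assumes meas: "\<And>z. z \<in> Z \<Longrightarrow> (\<lambda>s. F s z) \<in> borel_measurable \<nu>"
    and cont: "\<And>s. s \<in> carrier (SG p) \<Longrightarrow> continuous_on Z (F s)"
  shows "unc F \<in> borel_measurable M"
proof -
  obtain e :: "nat \<Rightarrow> cmat" where e: "\<And>k. e k \<in> Z"
    "\<And>z \<epsilon>. z \<in> Z \<Longrightarrow> 0 < \<epsilon> \<Longrightarrow> \<exists>k. dist z (e k) < \<epsilon>"
    using countable_dense_mats[of p "q - p"] by blast
  define k where "k n z = (LEAST k. dist z (e k) < 1 / real (Suc n))" for n z
  have k: "dist z (e (k n z)) < 1 / real (Suc n)" if "z \<in> Z" for n z
    unfolding k_def by (rule LeastI_ex) (use e(2)[OF that] in auto)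
  show ?thesis
  proof (rule borel_measurable_LIMSEQ_metric)
    fix n
    have "(\<lambda>z. k n z) \<in> measurable \<mu> (count_space UNIV)"
      unfolding k_def
    proof (rule measurable_Least)
      fix i
      have "(\<lambda>z. dist z (e i)) \<in> borel_measurable \<mu>"
        by (intro measurable_gaussian_continuous continuous_on_dist continuous_on_id continuous_on_const)
      then show "Measurable.pred \<mu> (\<lambda>z. dist z (e i) < 1 / real (Suc n))"
        by measurable
    qed
    then have kn: "(\<lambda>x. k n (snd x)) \<in> measurable M (count_space UNIV)"
      by (rule measurable_compose[OF measurable_snd])
    have Fi: "(\<lambda>x. F (fst x) (e i)) \<in> borel_measurable M" for i
      by (rule measurable_compose[OF measurable_fst meas[OF e(1)]])
    show "(\<lambda>x. F (fst x) (e (k n (snd x)))) \<in> borel_measurable M"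
      by (rule measurable_compose_countable[where f = "\<lambda>i x. F (fst x) (e i)", OF Fi kn])
  next
    fix x assume "x \<in> space M"
    then have x: "fst x \<in> carrier (SG p)" "snd x \<in> Z" by (auto simp: space_M)
    have "(\<lambda>n. e (k n (snd x))) \<longlonglongrightarrow> snd x"
    proof (rule metric_tendsto_imp_tendsto[OF LIMSEQ_inverse_real_of_nat])
      have "dist (e (k n (snd x))) (snd x) \<le> dist (inverse (real (Suc n))) 0" for n
        using k[OF x(2), of n] by (simp add: dist_commute inverse_eq_divide)
      then show "\<forall>\<^sub>F n in sequentially. dist (e (k n (snd x))) (snd x) \<le> dist (inverse (real (Suc n))) 0"
        by simp
    qed
    then show "(\<lambda>n. F (fst x) (e (k n (snd x)))) \<longlonglongrightarrow> unc F x"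
      unfolding unc_def by (intro continuous_on_tendsto_compose[OF cont[OF x(1)]]) (use e(1) x in auto)
  qed
qed

lemma unc_section:
  assumes "unc F \<in> borel_measurable M" "s \<in> carrier (SG p)"
  shows "F s \<in> borel_measurable \<mu>"
  using measurable_compose[OF measurable_Pair1' assms(1), of s] assms(2) by (simp add: unc_def space_nu)

text \<open>
  Weak measurability is the same as joint measurability: the values \<open>F s z\<close> are inner products of
  \<open>F s\<close> with the reproducing kernel, and so are measurable in \<open>s\<close> and continuous in \<open>z\<close>.
\<close>

lemma H_vectors:
  "F \<in> vectors H \<longleftrightarrow> (\<forall>s\<in>carrier (SG p). F s \<in> vectors K) \<and> unc F \<in> L2 M"
proof
  assume "F \<in> vectors H"
  then have F: "\<And>s. s \<in> carrier (SG p) \<Longrightarrow> F s \<in> vectors K"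
    "\<And>\<phi>. \<phi> \<in> vectors K \<Longrightarrow> (\<lambda>s. inner_prod K (F s) \<phi>) \<in> borel_measurable \<nu>"
    "integrable \<nu> (\<lambda>s. sqnorm \<mu> (F s))"
    by (auto simp: L2_bargmann_def K_measurable_def space_nu bargmann_norm_squared)
  have m: "unc F \<in> borel_measurable M"
  proof (rule measurable_caratheodory)
    fix z assume z: "z \<in> Z"
    have "(\<lambda>s. inner_prod K (F s) (\<lambda>w. exp (hs p (q - p) w z))) \<in> borel_measurable \<nu>"
      by (intro F bargmann_kernel z)
    then show "(\<lambda>s. F s z) \<in> borel_measurable \<nu>"
      by (rule measurable_cong[THEN iffD1, rotated])
        (simp add: space_nu bargmann_reproducing[OF F(1) z])
  next
    fix s assume "s \<in> carrier (SG p)"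
    then show "continuous_on Z (F s)" using F(1)[of s] by (simp add: bargmann_vectors holomorphic_mats_def)
  qed
  have "integrable M (\<lambda>x. (cmod (unc F x))\<^sup>2)"
  proof (rule P.Fubini_integrable)
    show "(\<lambda>x. (cmod (unc F x))\<^sup>2) \<in> borel_measurable M" using m by measurable
    show "integrable \<nu> (\<lambda>s. \<integral>z. norm ((cmod (unc F (s, z)))\<^sup>2) \<partial>\<mu>)"
      using F(3) by (simp add: sqnorm_def unc_def)
    show "AE s in \<nu>. integrable \<mu> (\<lambda>z. (cmod (unc F (s, z)))\<^sup>2)"
      using F(1) by (intro AE_I2) (simp add: space_nu unc_def bargmann_vectors L2_integrable)
  qed
  then show "(\<forall>s\<in>carrier (SG p). F s \<in> vectors K) \<and> unc F \<in> L2 M" using m F(1) by (simp add: L2_def)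
next
  assume F: "(\<forall>s\<in>carrier (SG p). F s \<in> vectors K) \<and> unc F \<in> L2 M"
  then have m: "unc F \<in> borel_measurable M" by (auto simp: L2_def)
  have "(\<lambda>s. inner_prod K (F s) \<phi>) \<in> borel_measurable \<nu>" if "\<phi> \<in> vectors K" for \<phi>
  proof -
    have [measurable]: "\<phi> \<in> borel_measurable \<mu>" using that by (auto simp: bargmann_vectors L2_def)
    have "(\<lambda>x. cnj (\<phi> (snd x))) \<in> borel_measurable M"
      by (rule measurable_compose[OF _ borel_measurable_continuous_onI[OF continuous_on_cnj[OF continuous_on_id]]]) measurable
    then have "(\<lambda>(s, z). F s z * cnj (\<phi> z)) \<in> borel_measurable M"
      using m by (simp add: unc_def case_prod_beta)
    then show ?thesis
      unfolding bargmann_inner by (rule mu.borel_measurable_lebesgue_integral)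
  qed
  moreover have "integrable \<nu> (\<lambda>s. sqnorm \<mu> (F s))"
    using P.integrable_fst'[of "\<lambda>x. (cmod (unc F x))\<^sup>2"] F by (simp add: L2_def sqnorm_def unc_def)
  ultimately show "F \<in> vectors H"
    using F by (simp add: L2_bargmann_def K_measurable_def space_nu bargmann_norm_squared)
qed

lemma H_norm:
  assumes "F \<in> vectors H"
  shows "vnorm H F = sqrt (sqnorm M (unc F))"
proof -
  have i: "integrable M (\<lambda>x. (cmod (unc F x))\<^sup>2)" using assms by (simp add: H_vectors L2_def)
  have "inner_prod K (F s) (F s) = complex_of_real (sqnorm \<mu> (F s))" for s
    unfolding bargmann_inner sqnorm_def complex_norm_square[symmetric] by (simp del: of_real_power)
  then have "inner_prod H F F = complex_of_real (\<integral>s. sqnorm \<mu> (F s) \<partial>\<nu>)"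
    by (simp add: L2_bargmann_def)
  also have "(\<integral>s. sqnorm \<mu> (F s) \<partial>\<nu>) = sqnorm M (unc F)"
    using P.integral_fst'[OF i] by (simp add: sqnorm_def unc_def)
  finally show ?thesis by (simp add: vnorm_def)
qed

lemma H_diff: "F \<in> vectors H \<Longrightarrow> G \<in> vectors H \<Longrightarrow> F - G \<in> vectors H"
  unfolding H_vectors using bargmann_diff[of _ p q] L2_diff(1)[of "unc F" M "unc G"]
  by (auto simp: unc_def fun_diff_def)

lemma veq_iff:
  assumes "F - G \<in> vectors H"
  shows "veq H F G \<longleftrightarrow> sqnorm M (unc (F - G)) = 0"
  using assms by (simp add: veq_def H_norm)

text \<open>
  Fields that agree on \<open>S \<times> Z\<close> represent the same vector, whether or not they are square integrable.
\<close>

lemma veq_pointwise: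
  assumes eq: "\<And>s z. s \<in> carrier (SG p) \<Longrightarrow> z \<in> Z \<Longrightarrow> F s z = G s z"
  shows "veq H F G"
proof -
  have 0: "unc (F - G) x = 0" if "x \<in> space M" for x using eq that by (auto simp: unc_def space_M)
  have "(F - G) s \<in> vectors K" if "s \<in> carrier (SG p)" for s
  proof -
    have e: "(F - G) s z = 0" if "z \<in> Z" for z using eq \<open>s \<in> carrier (SG p)\<close> that by simp
    have "holomorphic_mats p (q - p) ((F - G) s) \<longleftrightarrow> holomorphic_mats p (q - p) (\<lambda>z. 0)"
      by (rule holomorphic_mats_cong) (rule e)
    moreover have "(F - G) s \<in> L2 \<mu> \<longleftrightarrow> (\<lambda>z. 0) \<in> L2 \<mu>"
      by (rule L2_cong) (simp only: space_gaussian_mats e)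
    ultimately show ?thesis using bargmann_const[of 0 p q] by (simp only: bargmann_vectors)
  qed
  moreover have "unc (F - G) \<in> L2 M \<longleftrightarrow> (\<lambda>x. 0) \<in> L2 M" by (rule L2_cong) (rule 0)
  ultimately have "F - G \<in> vectors H" by (simp add: H_vectors L2_def)
  moreover have "sqnorm M (unc (F - G)) = sqnorm M (\<lambda>x. 0)" by (rule sqnorm_cong) (rule 0)
  ultimately show ?thesis by (simp add: veq_iff sqnorm_def)
qed

end

section \<open>The representation of the Iwasawa group\<close>

lemma heisenberg_rep_isometry_nn:
  assumes g: "g \<in> carrier (NG p q)" and \<phi>: "\<phi> \<in> borel_measurable (gaussian_mats p (q - p))"
  shows "(\<integral>\<^sup>+ z. ennreal ((cmod (heisenberg_rep p q g \<phi> z))\<^sup>2) \<partial>gaussian_mats p (q - p)) =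
    (\<integral>\<^sup>+ z. ennreal ((cmod (\<phi> z))\<^sup>2) \<partial>gaussian_mats p (q - p))"
proof -
  let ?\<mu> = "gaussian_mats p (q - p)" let ?h = "hs p (q - p)"
  obtain n z0 where g': "g = (n, z0)" by (cases g)
  have z0: "z0 \<in> mats p (q - p)" using g by (simp add: g' NG_carrier)
  let ?e = "\<lambda>z. exp (- Re (?h z0 z0) - 2 * Re (?h z z0))"
  have e: "(\<lambda>z. ennreal (?e z)) \<in> borel_measurable ?\<mu>"
    by (intro measurable_compose[OF _ measurable_ennreal] measurable_gaussian_continuous continuous_on_exp
        continuous_on_diff continuous_on_mult continuous_on_const continuous_on_Re mat_continuous_intros)
  have t: "(\<lambda>z. z + z0) \<in> measurable ?\<mu> ?\<mu>"
    using measurable_mats_add[OF z0] by (simp cong: measurable_cong_sets)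
  have t': "(\<lambda>z. z + z0) \<in> measurable (density ?\<mu> (\<lambda>z. ennreal (?e z))) ?\<mu>"
    using t by (simp cong: measurable_cong_sets)
  have m: "(\<lambda>z. ennreal ((cmod (\<phi> z))\<^sup>2)) \<in> borel_measurable ?\<mu>" using \<phi> by measurable
  have "(\<integral>\<^sup>+ z. ennreal ((cmod (heisenberg_rep p q g \<phi> z))\<^sup>2) \<partial>?\<mu>) =
      (\<integral>\<^sup>+ z. ennreal (?e z) * ennreal ((cmod (\<phi> (z + z0)))\<^sup>2) \<partial>?\<mu>)"
    unfolding g' by (simp add: cmod_heisenberg_rep[OF g[unfolded g']] ennreal_mult')
  also have "\<dots> = (\<integral>\<^sup>+ z. ennreal ((cmod (\<phi> (z + z0)))\<^sup>2) \<partial>density ?\<mu> (\<lambda>z. ennreal (?e z)))"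
    by (rule nn_integral_density[symmetric, OF e measurable_compose[OF t m]])
  also have "\<dots> = (\<integral>\<^sup>+ z. ennreal ((cmod (\<phi> z))\<^sup>2) \<partial>distr (density ?\<mu> (\<lambda>z. ennreal (?e z))) ?\<mu> (\<lambda>z. z + z0))"
    using m by (intro nn_integral_distr[symmetric] t') simp
  finally show ?thesis by (simp only: gaussian_translate[OF z0])
qed

lemma iwasawa_rep_apply:
  "iwasawa_rep p q (g, s0) F s z = heisenberg_rep p q (heisenberg_act p s g) (F (mmul p s s0)) z"
  by (simp add: iwasawa_rep_def)

lemma heisenberg_rep_linear:
  "heisenberg_rep p q g (\<lambda>z. \<phi> z + \<psi> z) z = heisenberg_rep p q g \<phi> z + heisenberg_rep p q g \<psi> z"
  "heisenberg_rep p q g (\<lambda>z. \<phi> z - \<psi> z) z = heisenberg_rep p q g \<phi> z - heisenberg_rep p q g \<psi> z"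
  "heisenberg_rep p q g (\<lambda>z. c * \<phi> z) z = c * heisenberg_rep p q g \<phi> z"
  by (simp_all add: heisenberg_rep_def case_prod_beta algebra_simps)

lemma iwasawa_rep_add: "iwasawa_rep p q x (F + G) = iwasawa_rep p q x F + iwasawa_rep p q x G"
  by (cases x) (simp add: fun_eq_iff iwasawa_rep_apply plus_fun_def heisenberg_rep_linear)

lemma iwasawa_rep_diff: "iwasawa_rep p q x (F - G) = iwasawa_rep p q x F - iwasawa_rep p q x G"
  by (cases x) (simp add: fun_eq_iff iwasawa_rep_apply fun_diff_def heisenberg_rep_linear)

lemma iwasawa_rep_scale: "iwasawa_rep p q x (\<lambda>s z. c * F s z) = (\<lambda>s z. c * iwasawa_rep p q x F s z)"
  by (cases x) (simp add: fun_eq_iff iwasawa_rep_apply heisenberg_rep_linear)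

text \<open>
  An identity between functions on all matrices, without hypotheses on \<open>x\<close>, \<open>y\<close> or \<open>F\<close>.
\<close>

lemma iwasawa_rep_mult:
  "iwasawa_rep p q (x \<otimes>\<^bsub>PG p q\<^esub> y) F = iwasawa_rep p q x (iwasawa_rep p q y F)"
proof -
  obtain g s g' s' where [simp]: "x = (g, s)" "y = (g', s')" by (cases x; cases y)
  have "iwasawa_rep p q (x \<otimes>\<^bsub>PG p q\<^esub> y) F t z = iwasawa_rep p q x (iwasawa_rep p q y F) t z" for t z
  proof -
    have "iwasawa_rep p q y F (mmul p t s) = heisenberg_rep p q (heisenberg_act p (mmul p t s) g') (F (mmul p t (mmul p s s')))"
      by (simp add: fun_eq_iff iwasawa_rep_apply mmul_assoc)
    then show ?thesis
      by (simp add: iwasawa_rep_apply act_mult act_act heisenberg_rep_mult del: NG_simps)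
  qed
  then show ?thesis by (simp add: fun_eq_iff)
qed

lemma iwasawa_rep_one:
  assumes "s \<in> carrier (SG p)"
  shows "iwasawa_rep p q \<one>\<^bsub>PG p q\<^esub> F s z = F s z"
  using assms by (simp add: iwasawa_rep_apply act_one heisenberg_rep_def mmul_zero mmul_mone_right[of _ p p] SG_mats)

context lt_measure
begin

lemma measurable_nu_act:
  assumes "s0 \<in> carrier (SG p)"
  shows "(\<lambda>s. mmul p s s0) \<in> measurable \<nu> \<nu>"
proof -
  have "(\<lambda>s. mmul p s s0) \<in> measurable (restrict_space borel (carrier (SG p))) (restrict_space borel (carrier (SG p)))"
    by (intro measurable_restrict_space2 borel_measurable_continuous_on_restrict mat_continuous_intros)
      (use assms in \<open>auto simp: space_restrict_space SG_mmul\<close>)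
  then show ?thesis using sets_nu by (simp cong: measurable_cong_sets)
qed

text \<open>
  \<open>T(x)F\<close> is measurable jointly in the group element and the point of \<open>S \<times> Z\<close>, being the product of
  a continuous function and of \<open>F\<close> composed with a continuous map.
\<close>

lemma measurable_iwasawa_rep_joint:
  assumes F: "unc F \<in> borel_measurable M"
  shows "(\<lambda>y. unc (iwasawa_rep p q (fst y) F) (snd y)) \<in>
    borel_measurable (restrict_space borel (carrier (PG p q)) \<Otimes>\<^sub>M M)"
proof -
  let ?N = "restrict_space borel (carrier (PG p q)) :: ((cmat \<times> cmat) \<times> cmat) measure"
  have n: "(\<lambda>s. s) \<in> borel_measurable \<nu>" "(\<lambda>z. z) \<in> borel_measurable \<mu>" "(\<lambda>x. x) \<in> borel_measurable ?N"
    using measurable_restrict_space1[OF measurable_ident_sets[OF refl], of borel "carrier (SG p)"]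
      measurable_restrict_space1[OF measurable_ident_sets[OF refl], of borel "Z"]
      measurable_restrict_space1[OF measurable_ident_sets[OF refl], of borel "carrier (PG p q)"]
    by (simp_all add: sets_nu cong: measurable_cong_sets)
  have "(\<lambda>y. (fst y, (fst (snd y), snd (snd y)))) \<in> measurable (?N \<Otimes>\<^sub>M M) (borel \<Otimes>\<^sub>M (borel \<Otimes>\<^sub>M borel))"
    by (intro measurable_Pair measurable_compose[OF measurable_fst n(3)]
        measurable_compose[OF measurable_compose[OF measurable_snd measurable_fst] n(1)]
        measurable_compose[OF measurable_compose[OF measurable_snd measurable_snd] n(2)])
  then have id: "(\<lambda>y. y) \<in> borel_measurable (?N \<Otimes>\<^sub>M M)"
    by (simp add: borel_prod)
  have cont: "f \<in> borel_measurable (?N \<Otimes>\<^sub>M M)" if "continuous_on UNIV f"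
    for f :: "((cmat \<times> cmat) \<times> cmat) \<times> cmat \<times> cmat \<Rightarrow> 'b::topological_space"
    by (rule measurable_compose[OF id borel_measurable_continuous_onI[OF that]])
  \<comment> \<open>The multiplier of \<open>T\<^sub>s(g)\<close> at the point \<open>z\<close>, where \<open>y = ((g, s0), (s, z))\<close>.\<close>
  define E where "E y = (let a = heisenberg_act p (fst (snd y)) (fst (fst y)) in
      exp (mtrace p (fst a) - 1/2 * hs p (q - p) (snd a) (snd a) - hs p (q - p) (snd (snd y)) (snd a)))"
    for y :: "((cmat \<times> cmat) \<times> cmat) \<times> cmat \<times> cmat"
  have E: "E \<in> borel_measurable (?N \<Otimes>\<^sub>M M)"
    unfolding E_def Let_def
    by (intro cont continuous_on_exp continuous_on_diff continuous_on_mult continuous_on_const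
        mat_continuous_intros continuous_on_act)
  have s: "(\<lambda>y. mmul p (fst (snd y)) (snd (fst y))) \<in> measurable (?N \<Otimes>\<^sub>M M) \<nu>"
  proof -
    have "(\<lambda>y. mmul p (fst (snd y)) (snd (fst y))) \<in> measurable (?N \<Otimes>\<^sub>M M) (restrict_space borel (carrier (SG p)))"
      by (intro measurable_restrict_space2 cont mat_continuous_intros)
        (auto simp: space_pair_measure space_nu space_restrict_space intro: SG_mmul)
    then show ?thesis using sets_nu by (simp cong: measurable_cong_sets)
  qed
  have z: "(\<lambda>y. snd (snd y) + snd (heisenberg_act p (fst (snd y)) (fst (fst y)))) \<in> measurable (?N \<Otimes>\<^sub>M M) \<mu>"
  proof -
    have "(\<lambda>y. snd (snd y) + snd (heisenberg_act p (fst (snd y)) (fst (fst y)))) \<in> measurable (?N \<Otimes>\<^sub>M M) (restrict_space borel Z)"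
    proof (intro measurable_restrict_space2 cont mat_continuous_intros continuous_on_act Pi_I)
      fix y assume y: "y \<in> space (?N \<Otimes>\<^sub>M M)"
      have "heisenberg_act p (fst (snd y)) (fst (fst y)) \<in> carrier (NG p q)"
        using y by (intro act_closed) (auto simp: space_pair_measure space_nu space_restrict_space)
      then have "snd (heisenberg_act p (fst (snd y)) (fst (fst y))) \<in> Z"
        by (metis NG_carrier prod.collapse)
      then show "snd (snd y) + snd (heisenberg_act p (fst (snd y)) (fst (fst y))) \<in> Z"
        using y by (intro mats_add) (auto simp: space_pair_measure)
    qed
    then show ?thesis by (simp cong: measurable_cong_sets)
  qed
  have "(\<lambda>y. unc F (mmul p (fst (snd y)) (snd (fst y)), snd (snd y) + snd (heisenberg_act p (fst (snd y)) (fst (fst y)))))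
      \<in> borel_measurable (?N \<Otimes>\<^sub>M M)"
    by (rule measurable_compose[OF measurable_Pair[OF s z] F])
  from borel_measurable_times[OF E this] show ?thesis
    by (simp add: unc_def E_def iwasawa_rep_def heisenberg_rep_def case_prod_beta Let_def)
qed

lemma measurable_iwasawa_rep:
  assumes "x \<in> carrier (PG p q)" and F: "unc F \<in> borel_measurable M"
  shows "unc (iwasawa_rep p q x F) \<in> borel_measurable M"
  using measurable_compose[OF measurable_Pair1' measurable_iwasawa_rep_joint[OF F], of x] assms(1)
  by (simp add: space_restrict_space del: PG_simps)

lemma nn_integral_iwasawa_rep:
  assumes "g \<in> carrier (NG p q)" "s0 \<in> carrier (SG p)" and F: "unc F \<in> borel_measurable M"
  shows "(\<integral>\<^sup>+ x. ennreal ((cmod (unc (iwasawa_rep p q (g, s0) F) x))\<^sup>2) \<partial>M) =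
    (\<integral>\<^sup>+ s. \<integral>\<^sup>+ z. ennreal ((cmod (F (mmul p s s0) z))\<^sup>2) \<partial>\<mu> \<partial>\<nu>)"
proof -
  have "unc (iwasawa_rep p q (g, s0) F) \<in> borel_measurable M"
    by (rule measurable_iwasawa_rep) (use assms in auto)
  then have "(\<lambda>x. ennreal ((cmod (unc (iwasawa_rep p q (g, s0) F) x))\<^sup>2)) \<in> borel_measurable M"
    by measurable
  from mu.nn_integral_fst[OF this]
  have "(\<integral>\<^sup>+ x. ennreal ((cmod (unc (iwasawa_rep p q (g, s0) F) x))\<^sup>2) \<partial>M) =
      (\<integral>\<^sup>+ s. \<integral>\<^sup>+ z. ennreal ((cmod (unc (iwasawa_rep p q (g, s0) F) (s, z)))\<^sup>2) \<partial>\<mu> \<partial>\<nu>)" by simp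
  also have "\<dots> = (\<integral>\<^sup>+ s. \<integral>\<^sup>+ z. ennreal ((cmod (F (mmul p s s0) z))\<^sup>2) \<partial>\<mu> \<partial>\<nu>)"
  proof (rule nn_integral_cong)
    fix s assume "s \<in> space \<nu>"
    then have s: "s \<in> carrier (SG p)" by (simp add: space_nu)
    show "(\<integral>\<^sup>+ z. ennreal ((cmod (unc (iwasawa_rep p q (g, s0) F) (s, z)))\<^sup>2) \<partial>\<mu>) =
        (\<integral>\<^sup>+ z. ennreal ((cmod (F (mmul p s s0) z))\<^sup>2) \<partial>\<mu>)"
      unfolding unc_def fst_conv snd_conv iwasawa_rep_apply
      by (rule heisenberg_rep_isometry_nn[OF act_closed[OF s assms(1)] unc_section[OF F SG_mmul[OF s assms(2)]]])
  qed
  finally show ?thesis .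
qed

lemma iwasawa_rep_K:
  assumes "x \<in> carrier (PG p q)" "s \<in> carrier (SG p)" "\<And>s. s \<in> carrier (SG p) \<Longrightarrow> F s \<in> vectors K"
  shows "iwasawa_rep p q x F s \<in> vectors K"
proof -
  obtain g s0 where x: "x = (g, s0)" by (cases x)
  have "heisenberg_rep p q (heisenberg_act p s g) (F (mmul p s s0)) \<in> vectors K"
    using assms x by (intro heisenberg_rep_bargmann act_closed assms(3) SG_mmul) auto
  moreover have "iwasawa_rep p q x F s = heisenberg_rep p q (heisenberg_act p s g) (F (mmul p s s0))"
    by (simp add: x fun_eq_iff iwasawa_rep_apply)
  ultimately show ?thesis by simp
qed

end

text \<open>
  From here on the measure is almost invariant.
\<close>

locale almost_invariant_measure = lt_measure +
  assumes almost_inv: "almost_invariant p \<nu>"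
begin

text \<open>
  The integral of \<open>h (s s0)\<close> is the integral of \<open>h\<close> against the translate of \<open>\<nu>\<close> by \<open>s0\<^sup>-\<^sup>1\<close>, which has
  a bounded density.
\<close>

lemma nn_integral_translate_le:
  assumes s0: "s0 \<in> carrier (SG p)"
  shows "\<exists>C\<ge>0. \<forall>h\<in>borel_measurable \<nu>. (\<integral>\<^sup>+ s. h (mmul p s s0) \<partial>\<nu>) \<le> ennreal C * (\<integral>\<^sup>+ s. h s \<partial>\<nu>)"
proof -
  interpret S: group "SG p" by (rule group_SG)
  let ?s = "inv\<^bsub>SG p\<^esub> s0" let ?R = "right_translate p \<nu> ?s"
  have R: "?R = distr \<nu> \<nu> (\<lambda>s. mmul p s s0)"
    using s0 by (simp add: right_translate_def)
  obtain C where ac: "absolutely_continuous \<nu> ?R" and C: "AE s in \<nu>. RN_deriv \<nu> ?R s \<le> ennreal C"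
    using almost_inv s0 unfolding almost_invariant_def by (meson S.inv_closed)
  have dens: "density \<nu> (RN_deriv \<nu> ?R) = ?R"
    by (rule nu.density_RN_deriv[OF ac]) (simp add: right_translate_def)
  have "(\<integral>\<^sup>+ s. h (mmul p s s0) \<partial>\<nu>) \<le> ennreal (max C 0) * (\<integral>\<^sup>+ s. h s \<partial>\<nu>)" if h: "h \<in> borel_measurable \<nu>" for h
  proof -
    have "(\<integral>\<^sup>+ s. h (mmul p s s0) \<partial>\<nu>) = (\<integral>\<^sup>+ s. h s \<partial>?R)"
      unfolding R using h by (intro nn_integral_distr[symmetric] measurable_nu_act[OF s0]) simp
    also have "\<dots> = (\<integral>\<^sup>+ s. RN_deriv \<nu> ?R s * h s \<partial>\<nu>)"
      by (subst dens[symmetric], rule nn_integral_density) (use h in auto)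
    also have "\<dots> \<le> (\<integral>\<^sup>+ s. ennreal (max C 0) * h s \<partial>\<nu>)"
    proof (rule nn_integral_mono_AE)
      show "AE s in \<nu>. RN_deriv \<nu> ?R s * h s \<le> ennreal (max C 0) * h s"
        using C by eventually_elim (auto intro!: mult_right_mono order_trans[OF _ ennreal_leI])
    qed
    also have "\<dots> = ennreal (max C 0) * (\<integral>\<^sup>+ s. h s \<partial>\<nu>)" by (rule nn_integral_cmult[OF h])
    finally show ?thesis .
  qed
  then show ?thesis by (intro exI[of _ "max C 0"]) auto
qed

text \<open>
  The operators are bounded on all of \<open>L\<^sup>2(S \<times> Z, \<nu> \<otimes> \<mu>)\<close>; the values of \<open>F\<close> need not be holomorphic.
\<close>

lemma iwasawa_rep_bounded:
  assumes x: "x \<in> carrier (PG p q)"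
  shows "\<exists>C\<ge>0. \<forall>F. unc F \<in> L2 M \<longrightarrow>
    unc (iwasawa_rep p q x F) \<in> L2 M \<and> sqnorm M (unc (iwasawa_rep p q x F)) \<le> C * sqnorm M (unc F)"
proof -
  obtain g s0 where x': "x = (g, s0)" by (cases x)
  have g: "g \<in> carrier (NG p q)" "s0 \<in> carrier (SG p)" using x x' by auto
  obtain C where C: "0 \<le> C" "\<forall>h\<in>borel_measurable \<nu>. (\<integral>\<^sup>+ s. h (mmul p s s0) \<partial>\<nu>) \<le> ennreal C * (\<integral>\<^sup>+ s. h s \<partial>\<nu>)"
    using nn_integral_translate_le[OF g(2)] by blast
  have "unc (iwasawa_rep p q x F) \<in> L2 M \<and> sqnorm M (unc (iwasawa_rep p q x F)) \<le> C * sqnorm M (unc F)"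
    if F: "unc F \<in> L2 M" for F
  proof -
    have m: "unc F \<in> borel_measurable M" using F by (simp add: L2_def)
    then have m2: "(\<lambda>x. ennreal ((cmod (unc F x))\<^sup>2)) \<in> borel_measurable M" by measurable
    define h where "h s = (\<integral>\<^sup>+ z. ennreal ((cmod (unc F (s, z)))\<^sup>2) \<partial>\<mu>)" for s
    have h: "h \<in> borel_measurable \<nu>"
      unfolding h_def using mu.borel_measurable_nn_integral_fst[OF m2] by simp
    have "(\<integral>\<^sup>+ x'. ennreal ((cmod (unc (iwasawa_rep p q x F) x'))\<^sup>2) \<partial>M) = (\<integral>\<^sup>+ s. h (mmul p s s0) \<partial>\<nu>)"
      using nn_integral_iwasawa_rep[OF g m] by (simp add: h_def x' unc_def)
    also have "\<dots> \<le> ennreal C * (\<integral>\<^sup>+ s. h s \<partial>\<nu>)" using C(2) h by blast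
    also have "(\<integral>\<^sup>+ s. h s \<partial>\<nu>) = ennreal (sqnorm M (unc F))"
      unfolding h_def nn_integral_sqnorm[OF F, symmetric] by (rule mu.nn_integral_fst[OF m2])
    finally have le: "(\<integral>\<^sup>+ x'. ennreal ((cmod (unc (iwasawa_rep p q x F) x'))\<^sup>2) \<partial>M) \<le> ennreal (C * sqnorm M (unc F))"
      using C(1) by (simp add: ennreal_mult' sqnorm_nonneg)
    then have L: "unc (iwasawa_rep p q x F) \<in> L2 M"
      by (subst L2_iff_nn_integral[OF measurable_iwasawa_rep[OF x m]]) (simp add: le_less_trans)
    then show ?thesis
      using le C(1) by (simp add: nn_integral_sqnorm sqnorm_nonneg)
  qed
  then show ?thesis using C(1) by blast
qed

lemma iwasawa_rep_vectors:
  assumes "x \<in> carrier (PG p q)" "F \<in> vectors H"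
  shows "iwasawa_rep p q x F \<in> vectors H"
  using iwasawa_rep_bounded[OF assms(1)] iwasawa_rep_K[OF assms(1)] assms(2) unfolding H_vectors by blast

end

section \<open>Strong continuity\<close>

text \<open>
  The finite intersections of members of a countable basis, cut down to \<open>C\<close>, generate the Borel sets
  of \<open>C\<close>.
\<close>

lemma restrict_borel_countable_generator:
  fixes C :: "'a::second_countable_topology set"
  shows "\<exists>\<A>. countable \<A> \<and> Int_stable \<A> \<and> \<A> \<subseteq> Pow C \<and> C \<in> \<A> \<and>
    sets (restrict_space borel C) = sigma_sets C \<A>"
proof -
  obtain B :: "'a set set" where B: "countable B" "topological_basis B"
    using ex_countable_basis by blast
  define \<A> where "\<A> = (\<lambda>F. C \<inter> \<Inter>F) ` {F. finite F \<and> F \<subseteq> B}"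
  have 1: "countable \<A>"
    unfolding \<A>_def using countable_Collect_finite_subset[OF B(1)] by (rule countable_image)
  have 2: "Int_stable \<A>"
  proof (rule Int_stableI)
    fix a b assume "a \<in> \<A>" "b \<in> \<A>"
    then obtain F G where "a = C \<inter> \<Inter>F" "b = C \<inter> \<Inter>G" "finite F" "finite G" "F \<subseteq> B" "G \<subseteq> B"
      by (auto simp: \<A>_def)
    then show "a \<inter> b \<in> \<A>"
      unfolding \<A>_def by (intro image_eqI[of _ _ "F \<union> G"]) auto
  qed
  have 3: "\<A> \<subseteq> Pow C" by (auto simp: \<A>_def)
  have 4: "C \<in> \<A>" unfolding \<A>_def by (intro image_eqI[of _ _ "{}"]) auto
  have b: "b \<in> B \<Longrightarrow> open b" for b using B(2) by (rule topological_basis_open)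
  have "sets (restrict_space borel C) = sigma_sets C \<A>"
  proof (intro equalityI subsetI)
    fix X assume "X \<in> sets (restrict_space borel C)"
    then obtain Y where Y: "X = C \<inter> Y" "Y \<in> sigma_sets UNIV B"
      by (auto simp: sets_restrict_space borel_eq_countable_basis[OF B])
    from Y(2) have "C \<inter> Y \<in> sigma_sets C \<A>"
    proof (induction rule: sigma_sets.induct)
      case (Basic a)
      then show ?case unfolding \<A>_def by (intro sigma_sets.Basic image_eqI[of _ _ "{a}"]) auto
    next
      case Empty
      then show ?case by (simp add: sigma_sets.Empty)
    next
      case (Compl a)
      moreover have "C \<inter> (UNIV - a) = C - C \<inter> a" by auto
      ultimately show ?case by (simp add: sigma_sets.Compl)
    next
      case (Union a)
      then have "(\<Union>i. C \<inter> a i) \<in> sigma_sets C \<A>" by (intro sigma_sets.Union)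
      then show ?case by (simp only: Int_UN_distrib)
    qed
    then show "X \<in> sigma_sets C \<A>" using Y(1) by simp
  next
    fix X assume "X \<in> sigma_sets C \<A>"
    then show "X \<in> sets (restrict_space borel C)"
    proof (induction rule: sigma_sets.induct)
      case (Basic a)
      then obtain F where "a = C \<inter> \<Inter>F" "finite F" "F \<subseteq> B" by (auto simp: \<A>_def)
      moreover have "open (\<Inter>F)" using calculation b by (intro open_Inter) auto
      ultimately show ?case by (auto simp: sets_restrict_space)
    next
      case (Compl a)
      then show ?case using sets.compl_sets[of a "restrict_space borel C"] by (simp add: space_restrict_space)
    qed auto
  qed
  then show ?thesis using 1 2 3 4 by blast
qed

context lt_measure
begin

lemma separable_M:
  "\<exists>D. countable D \<and> D \<subseteq> L2 M \<and> (\<forall>f\<in>L2 M. \<forall>e>0. \<exists>d\<in>D. sqnorm M (\<lambda>x. f x - d x) < e)"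
proof -
  let ?S = "carrier (SG p)"
  obtain A where A: "countable A" "Int_stable A" "A \<subseteq> Pow ?S" "?S \<in> A" "sets \<nu> = sigma_sets ?S A"
    using restrict_borel_countable_generator[of ?S] sets_nu by blast
  obtain B where B: "countable B" "Int_stable B" "B \<subseteq> Pow Z" "Z \<in> B" "sets \<mu> = sigma_sets Z B"
    using restrict_borel_countable_generator[of Z] sets_gaussian_mats by blast
  let ?E = "{a \<times> b |a b. a \<in> A \<and> b \<in> B}"
  have "countable ((\<lambda>(a, b). a \<times> b) ` (A \<times> B))" using A(1) B(1) by auto
  also have "(\<lambda>(a, b). a \<times> b) ` (A \<times> B) = ?E" by auto
  finally have "countable ?E" .
  moreover have "Int_stable ?E"
  proof (rule Int_stableI)
    fix x y assume "x \<in> ?E" "y \<in> ?E"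
    then obtain a b a' b' where "x = a \<times> b" "y = a' \<times> b'" "a \<in> A" "a' \<in> A" "b \<in> B" "b' \<in> B" by blast
    moreover have "a \<inter> a' \<in> A" "b \<inter> b' \<in> B"
      using calculation A(2) B(2) by (auto simp: Int_stable_def)
    ultimately show "x \<inter> y \<in> ?E" by (auto simp: Times_Int_Times)
  qed
  moreover have E: "?E \<subseteq> Pow (?S \<times> Z)" using A(3) B(3) by blast
  moreover have "?S \<times> Z \<in> ?E" using A(4) B(4) by blast
  moreover have "sets M = sigma_sets (?S \<times> Z) ?E"
  proof -
    have "sets M = sets (sigma (space \<nu> \<times> space \<mu>) ?E)"
      by (rule sets_pair_eq[of A \<nu> "{?S}" B \<mu> "{Z}"])
        (use A(3,4) B(3,4) in \<open>auto simp: space_nu A(5) B(5)[simplified]\<close>)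
    also have "\<dots> = sets (sigma (?S \<times> Z) ?E)" by (simp add: space_nu)
    finally show ?thesis using E by (simp only: sets_measure_of)
  qed
  ultimately show ?thesis
    using L2_separable[OF sigma_finite_M, of ?E] by (simp only: space_M)
qed

lemma unc_diff: "unc (F - G) = (\<lambda>x. unc F x - unc G x)"
  by (simp add: unc_def fun_eq_iff)

lemma unc_add: "unc (F + G) = (\<lambda>x. unc F x + unc G x)"
  by (simp add: unc_def fun_eq_iff)

end

context almost_invariant_measure
begin

text \<open>
  A jointly measurable cocycle is continuous at the unit.  The set \<open>W m\<close> consists of those \<open>x\<close> for
  which \<open>T(x)\<close> is bounded below on the countable dense set \<open>D\<close>, so it is Borel; these sets cover
  the group because every \<open>T(x)\<close> has a bounded inverse.  The sets \<open>E k\<close> consist of those \<open>x\<close> for which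
  \<open>\<beta>(x)\<close> is close to the \<open>k\<close>-th member of \<open>D\<close>.
\<close>

lemma cocycle_tends_to_0:
  fixes \<beta> :: "(cmat \<times> cmat) \<times> cmat \<Rightarrow> cmat \<Rightarrow> cmat \<Rightarrow> complex"
  assumes joint: "(\<lambda>y. unc (\<beta> (fst y)) (snd y)) \<in> borel_measurable (restrict_space borel (carrier (PG p q)) \<Otimes>\<^sub>M M)"
    and L2: "\<And>x. x \<in> carrier (PG p q) \<Longrightarrow> unc (\<beta> x) \<in> L2 M"
    and mult: "\<And>x y. x \<in> carrier (PG p q) \<Longrightarrow> y \<in> carrier (PG p q) \<Longrightarrow>
      sqnorm M (unc (\<beta> (x \<otimes>\<^bsub>PG p q\<^esub> y) - \<beta> x)) = sqnorm M (unc (iwasawa_rep p q x (\<beta> y)))"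
  shows "((\<lambda>x. sqnorm M (unc (\<beta> x))) \<longlongrightarrow> 0) (at \<one>\<^bsub>PG p q\<^esub> within carrier (PG p q))"
proof -
  let ?G = "PG p q" let ?N = "restrict_space borel (carrier ?G)"
  interpret G: group ?G by (rule group_PG)
  obtain D where D: "countable D" "D \<subseteq> L2 M" "\<And>f e. f \<in> L2 M \<Longrightarrow> 0 < e \<Longrightarrow> \<exists>d\<in>D. sqnorm M (\<lambda>x. f x - d x) < e"
    using separable_M by blast
  have "(\<lambda>x. 0) \<in> L2 M" by (simp add: L2_def)
  then have "D \<noteq> {}" using D(3)[of "\<lambda>x. 0" 1] by auto
  \<comment> \<open>Members of \<open>D\<close> are functions on \<open>S \<times> Z\<close>, but \<open>T\<close> acts on fields.\<close>
  define cur :: "(cmat \<times> cmat \<Rightarrow> complex) \<Rightarrow> cmat \<Rightarrow> cmat \<Rightarrow> complex" where "cur d = (\<lambda>s z. d (s, z))" for d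
  have unc_cur [simp]: "unc (cur d) = d" for d by (simp add: unc_def cur_def)
  have space_N: "space ?N = carrier ?G" by (simp add: space_restrict_space del: PG_simps)
  have sq_meas: "(\<lambda>x. sqnorm M (\<lambda>w. h (x, w))) \<in> borel_measurable ?N"
    if h: "h \<in> borel_measurable (?N \<Otimes>\<^sub>M M)" for h
  proof -
    have "(\<lambda>(x, w). (cmod (h (x, w)))\<^sup>2) \<in> borel_measurable (?N \<Otimes>\<^sub>M M)" using h by simp
    then show ?thesis unfolding sqnorm_def by (rule sigma_finite_measure.borel_measurable_lebesgue_integral[OF sigma_finite_M])
  qed
  define W where "W m = {x \<in> carrier ?G. \<forall>d\<in>D. sqnorm M d \<le> real m * sqnorm M (unc (iwasawa_rep p q x (cur d)))}" for m :: nat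
  have W_sets: "W m \<in> sets ?N" for m
  proof -
    have "{x \<in> space ?N. \<forall>d\<in>D. sqnorm M d \<le> real m * sqnorm M (unc (iwasawa_rep p q x (cur d)))} \<in> sets ?N"
    proof (rule sets.sets_Collect_countable_All'[OF _ D(1)])
      fix d assume "d \<in> D"
      then have "unc (cur d) \<in> borel_measurable M" using D(2) by (auto simp: L2_def)
      from sq_meas[OF measurable_iwasawa_rep_joint[OF this]]
      have [measurable]: "(\<lambda>x. sqnorm M (unc (iwasawa_rep p q x (cur d)))) \<in> borel_measurable ?N" by simp
      show "{x \<in> space ?N. sqnorm M d \<le> real m * sqnorm M (unc (iwasawa_rep p q x (cur d)))} \<in> sets ?N"
        by measurable
    qed
    then show ?thesis by (simp only: W_def space_N)
  qed
  \<comment> \<open>The lower bound extends from \<open>D\<close> to its closure, at the price of the factor 4, which comes from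
    using the inequality for \<open>\<parallel>f + g\<parallel>\<^sup>2\<close> twice.\<close>
  have W_bound: "sqnorm M (unc F) \<le> 4 * real m * sqnorm M (unc (iwasawa_rep p q b F))"
    if b: "b \<in> W m" and F: "unc F \<in> L2 M" for b m F
  proof (rule field_le_epsilon)
    fix e :: real assume e: "0 < e"
    have bG: "b \<in> carrier ?G" using b by (simp add: W_def)
    obtain C where C: "0 \<le> C" "\<And>F. unc F \<in> L2 M \<Longrightarrow> unc (iwasawa_rep p q b F) \<in> L2 M"
      "\<And>F. unc F \<in> L2 M \<Longrightarrow> sqnorm M (unc (iwasawa_rep p q b F)) \<le> C * sqnorm M (unc F)"
      using iwasawa_rep_bounded[OF bG] by blast
    define \<epsilon> where "\<epsilon> = e / (2 + 4 * real m * C)"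
    have pos: "0 < 2 + 4 * real m * C" using C(1) by (simp add: add_pos_nonneg)
    then have \<epsilon>: "0 < \<epsilon>" "(2 + 4 * real m * C) * \<epsilon> = e" using e by (simp_all add: \<epsilon>_def)
    obtain d where d: "d \<in> D" "sqnorm M (\<lambda>x. unc F x - d x) < \<epsilon>" using D(3)[OF F \<epsilon>(1)] by blast
    have dL: "unc (cur d) \<in> L2 M" using d D(2) by auto
    have FL: "unc (cur d - F) \<in> L2 M" using L2_diff(1)[OF dL F] by (simp add: unc_diff)
    have eq: "iwasawa_rep p q b (cur d) = iwasawa_rep p q b F + iwasawa_rep p q b (cur d - F)"
      by (simp add: iwasawa_rep_diff)
    have "sqnorm M (unc F) \<le> 2 * sqnorm M (\<lambda>x. unc F x - d x) + 2 * sqnorm M d"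
      using L2_add(2)[OF L2_diff(1)[OF F dL] dL] by simp
    also have "\<dots> \<le> 2 * \<epsilon> + 2 * (real m * sqnorm M (unc (iwasawa_rep p q b (cur d))))"
      using b d by (intro add_mono mult_left_mono) (auto simp: W_def)
    also have "\<dots> \<le> 2 * \<epsilon> + 2 * (real m * (2 * sqnorm M (unc (iwasawa_rep p q b F)) + 2 * (C * \<epsilon>)))"
    proof -
      have "sqnorm M (unc (iwasawa_rep p q b (cur d))) \<le>
          2 * sqnorm M (unc (iwasawa_rep p q b F)) + 2 * sqnorm M (unc (iwasawa_rep p q b (cur d - F)))"
        unfolding eq unc_add by (rule L2_add(2)[OF C(2)[OF F] C(2)[OF FL]])
      also have "sqnorm M (unc (iwasawa_rep p q b (cur d - F))) \<le> C * sqnorm M (unc (cur d - F))"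
        by (rule C(3)[OF FL])
      also have "sqnorm M (unc (cur d - F)) \<le> \<epsilon>"
        using d(2) sqnorm_minus_commute[of M "unc F" d] by (simp add: unc_diff)
      finally show ?thesis using C(1) by (intro add_left_mono mult_left_mono) (auto simp: mult_left_mono)
    qed
    also have "\<dots> = 4 * real m * sqnorm M (unc (iwasawa_rep p q b F)) + (2 + 4 * real m * C) * \<epsilon>"
      by (simp add: algebra_simps)
    finally show "sqnorm M (unc F) \<le> 4 * real m * sqnorm M (unc (iwasawa_rep p q b F)) + e"
      by (simp only: \<epsilon>(2))
  qed
  have W_cover: "carrier ?G \<subseteq> (\<Union>m. W m)"
  proof
    fix x assume x: "x \<in> carrier ?G"
    obtain C where C: "0 \<le> C" "\<And>F. unc F \<in> L2 M \<Longrightarrow> sqnorm M (unc (iwasawa_rep p q (inv\<^bsub>?G\<^esub> x) F)) \<le> C * sqnorm M (unc F)"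
      using iwasawa_rep_bounded[OF G.inv_closed[OF x]] by blast
    obtain m :: nat where m: "C \<le> real m" using real_arch_simple by blast
    have "sqnorm M d \<le> real m * sqnorm M (unc (iwasawa_rep p q x (cur d)))" if d: "d \<in> D" for d
    proof -
      have dL: "unc (cur d) \<in> L2 M" using d D(2) by auto
      have L: "unc (iwasawa_rep p q x (cur d)) \<in> L2 M" using iwasawa_rep_bounded[OF x] dL by blast
      have "sqnorm M d = sqnorm M (unc (iwasawa_rep p q (inv\<^bsub>?G\<^esub> x) (iwasawa_rep p q x (cur d))))"
      proof (rule sqnorm_cong)
        fix w assume "w \<in> space M"
        then have "fst w \<in> carrier (SG p)" by (auto simp: space_M)
        then have "unc (iwasawa_rep p q \<one>\<^bsub>?G\<^esub> (cur d)) w = d w"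
          unfolding unc_def by (subst iwasawa_rep_one) (auto simp: cur_def)
        then show "d w = unc (iwasawa_rep p q (inv\<^bsub>?G\<^esub> x) (iwasawa_rep p q x (cur d))) w"
          using x by (simp add: iwasawa_rep_mult[symmetric] del: PG_simps)
      qed
      also have "\<dots> \<le> C * sqnorm M (unc (iwasawa_rep p q x (cur d)))" by (rule C(2)[OF L])
      also have "\<dots> \<le> real m * sqnorm M (unc (iwasawa_rep p q x (cur d)))"
        by (intro mult_right_mono m sqnorm_nonneg)
      finally show ?thesis .
    qed
    then have "x \<in> W m" using x by (simp add: W_def)
    then show "x \<in> (\<Union>m. W m)" by blast
  qed
  show ?thesis
  proof (rule automatic_continuity[OF group_PG completely_metrizable_PG _ _ W_sets W_cover,
        where \<delta> = "\<lambda>a b. 4 * sqnorm M (unc (\<beta> a - \<beta> b))"])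
    show "continuous_on (carrier ?G) (\<lambda>b. x \<otimes>\<^bsub>?G\<^esub> b)" for x
      by (intro continuous_on_PG_mult continuous_on_const continuous_on_id)
    show "continuous_on (carrier ?G) (\<lambda>b. b \<otimes>\<^bsub>?G\<^esub> x)" for x
      by (intro continuous_on_PG_mult continuous_on_const continuous_on_id)
    show "sqnorm M (unc (\<beta> x)) \<le> real m * (4 * sqnorm M (unc (\<beta> (b \<otimes>\<^bsub>?G\<^esub> x) - \<beta> b)))"
      if "b \<in> W m" "x \<in> carrier ?G" for m b x
    proof -
      have "b \<in> carrier ?G" using that(1) by (simp add: W_def)
      then show ?thesis using W_bound[OF that(1) L2[OF that(2)]] mult[of b x] that(2) by simp
    qed
    show "0 \<le> sqnorm M (unc (\<beta> x))" for x by (rule sqnorm_nonneg)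
    fix e :: real assume e: "0 < e"
    define E where "E k = {x \<in> carrier ?G. sqnorm M (\<lambda>w. unc (\<beta> x) w - from_nat_into D k w) < e / 16}" for k
    have dD: "from_nat_into D k \<in> L2 M" for k using D(2) from_nat_into[OF \<open>D \<noteq> {}\<close>] by blast
    have E_sets: "E k \<in> sets ?N" for k
    proof -
      have "(\<lambda>y. from_nat_into D k (snd y)) \<in> borel_measurable (?N \<Otimes>\<^sub>M M)"
        using dD[of k] by (intro measurable_compose[OF measurable_snd]) (simp add: L2_def)
      from sq_meas[OF borel_measurable_diff[OF joint this]]
      have [measurable]: "(\<lambda>x. sqnorm M (\<lambda>w. unc (\<beta> x) w - from_nat_into D k w)) \<in> borel_measurable ?N" by simp
      have "{x \<in> space ?N. sqnorm M (\<lambda>w. unc (\<beta> x) w - from_nat_into D k w) < e / 16} \<in> sets ?N"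
        by measurable
      then show ?thesis by (simp only: E_def space_N)
    qed
    have E_cover: "carrier ?G \<subseteq> (\<Union>k. E k)"
    proof
      fix x assume x: "x \<in> carrier ?G"
      obtain d where d: "d \<in> D" "sqnorm M (\<lambda>w. unc (\<beta> x) w - d w) < e / 16"
        using D(3)[OF L2[OF x], of "e / 16"] e by auto
      obtain k where "from_nat_into D k = d" using from_nat_into_surj[OF D(1) d(1)] by blast
      then show "x \<in> (\<Union>k. E k)" using d(2) x by (auto simp: E_def)
    qed
    have "4 * sqnorm M (unc (\<beta> a - \<beta> b)) \<le> e" if "a \<in> E k" "b \<in> E k" for a b k
    proof -
      let ?d = "from_nat_into D k"
      have a: "a \<in> carrier ?G" "sqnorm M (\<lambda>w. unc (\<beta> a) w - ?d w) < e / 16"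
        and b: "b \<in> carrier ?G" "sqnorm M (\<lambda>w. unc (\<beta> b) w - ?d w) < e / 16"
        using that by (auto simp: E_def)
      have "sqnorm M (unc (\<beta> a - \<beta> b)) \<le> 2 * sqnorm M (\<lambda>w. unc (\<beta> a) w - ?d w) + 2 * sqnorm M (\<lambda>w. ?d w - unc (\<beta> b) w)"
        unfolding unc_diff by (rule sqnorm_diff_triangle[OF L2[OF a(1)] dD L2[OF b(1)]])
      then show ?thesis using a(2) b(2) sqnorm_minus_commute[of M ?d "unc (\<beta> b)"] by simp
    qed
    then show "\<exists>E::nat \<Rightarrow> ((cmat \<times> cmat) \<times> cmat) set. (\<forall>k. E k \<in> sets ?N) \<and> carrier ?G \<subseteq> (\<Union>k. E k) \<and>
        (\<forall>k. \<forall>a\<in>E k. \<forall>b\<in>E k. 4 * sqnorm M (unc (\<beta> a - \<beta> b)) \<le> e)"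
      by (intro exI[of _ E] conjI allI ballI E_sets E_cover)
  qed
qed

text \<open>
  Continuity at \<open>g\<close> follows from continuity at the unit, as \<open>\<beta>(h) - \<beta>(g) = T(g) \<beta>(g\<^sup>-\<^sup>1 h)\<close>.
\<close>

lemma cocycle_continuous:
  fixes \<beta> :: "(cmat \<times> cmat) \<times> cmat \<Rightarrow> cmat \<Rightarrow> cmat \<Rightarrow> complex"
  assumes joint: "(\<lambda>y. unc (\<beta> (fst y)) (snd y)) \<in> borel_measurable (restrict_space borel (carrier (PG p q)) \<Otimes>\<^sub>M M)"
    and vec: "\<And>x. x \<in> carrier (PG p q) \<Longrightarrow> \<beta> x \<in> vectors H"
    and mult: "\<And>x y. x \<in> carrier (PG p q) \<Longrightarrow> y \<in> carrier (PG p q) \<Longrightarrow>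
      \<beta> (x \<otimes>\<^bsub>PG p q\<^esub> y) = iwasawa_rep p q x (\<beta> y) + \<beta> x"
  shows "continuous_into (PG p q) H \<beta>"
  unfolding continuous_into_def
proof
  let ?G = "PG p q"
  interpret G: group ?G by (rule group_PG)
  have L2: "unc (\<beta> x) \<in> L2 M" if "x \<in> carrier ?G" for x using vec[OF that] by (simp add: H_vectors)
  have lim1: "((\<lambda>x. sqnorm M (unc (\<beta> x))) \<longlongrightarrow> 0) (at \<one>\<^bsub>?G\<^esub> within carrier ?G)"
    by (rule cocycle_tends_to_0[OF joint L2]) (simp_all add: mult del: PG_simps)
  fix g assume g: "g \<in> carrier ?G"
  let ?k = "\<lambda>h. inv\<^bsub>?G\<^esub> g \<otimes>\<^bsub>?G\<^esub> h"
  obtain C where C: "0 \<le> C" "\<And>F. unc F \<in> L2 M \<Longrightarrow> sqnorm M (unc (iwasawa_rep p q g F)) \<le> C * sqnorm M (unc F)"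
    using iwasawa_rep_bounded[OF g] by blast
  have "continuous_on (carrier ?G) ?k"
    by (intro continuous_on_PG_mult continuous_on_const continuous_on_id)
  then have "(?k \<longlongrightarrow> ?k g) (at g within carrier ?G)" using g unfolding continuous_on_def by blast
  then have "(?k \<longlongrightarrow> \<one>\<^bsub>?G\<^esub>) (at g within carrier ?G)" by (simp only: G.l_inv[OF g])
  moreover have "\<forall>\<^sub>F h in at g within carrier ?G. ?k h \<in> carrier ?G \<and> ?k h \<noteq> \<one>\<^bsub>?G\<^esub>"
    unfolding eventually_at_filter
  proof (intro always_eventually allI impI conjI)
    fix h assume h: "h \<noteq> g" "h \<in> carrier ?G"
    show "?k h \<in> carrier ?G" using g h by (simp del: PG_simps)
    show "?k h \<noteq> \<one>\<^bsub>?G\<^esub>" using g h G.inv_solve_left'[of \<open>\<one>\<^bsub>?G\<^esub>\<close> g h] by (auto simp del: PG_simps)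
  qed
  ultimately have "filterlim ?k (at \<one>\<^bsub>?G\<^esub> within carrier ?G) (at g within carrier ?G)"
    by (simp add: filterlim_at del: PG_simps)
  from filterlim_compose[OF lim1 this]
  have "((\<lambda>h. sqrt (C * sqnorm M (unc (\<beta> (?k h))))) \<longlongrightarrow> sqrt (C * 0)) (at g within carrier ?G)"
    by (intro tendsto_intros)
  then have lim: "((\<lambda>h. sqrt (C * sqnorm M (unc (\<beta> (?k h))))) \<longlongrightarrow> 0) (at g within carrier ?G)" by simp
  have nrm: "vnorm H (\<beta> h - \<beta> g) = sqrt (sqnorm M (unc (\<beta> h - \<beta> g)))" if "h \<in> carrier ?G" for h
    by (rule H_norm[OF H_diff[OF vec[OF that] vec[OF g]]])
  show "((\<lambda>h. vnorm H (\<beta> h - \<beta> g)) \<longlongrightarrow> 0) (at g within carrier ?G)"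
  proof (rule tendsto_sandwich[OF _ _ tendsto_const lim])
    show "\<forall>\<^sub>F h in at g within carrier ?G. 0 \<le> vnorm H (\<beta> h - \<beta> g)"
      unfolding eventually_at_filter
      by (intro always_eventually) (simp add: nrm sqnorm_nonneg del: PG_simps)
    have "vnorm H (\<beta> h - \<beta> g) \<le> sqrt (C * sqnorm M (unc (\<beta> (?k h))))" if h: "h \<in> carrier ?G" for h
    proof -
      have k: "?k h \<in> carrier ?G" "g \<otimes>\<^bsub>?G\<^esub> ?k h = h"
        using g h G.m_assoc[of g "inv\<^bsub>?G\<^esub> g" h] by (simp_all del: PG_simps)
      have "\<beta> h - \<beta> g = iwasawa_rep p q g (\<beta> (?k h))"
        using mult[OF g k(1)] k(2) by (simp del: PG_simps)
      then show ?thesis using C(2)[OF L2[OF k(1)]] nrm[OF h] by simp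
    qed
    then show "\<forall>\<^sub>F h in at g within carrier ?G. vnorm H (\<beta> h - \<beta> g) \<le> sqrt (C * sqnorm M (unc (\<beta> (?k h))))"
      unfolding eventually_at_filter by (intro always_eventually) (simp del: PG_simps)
  qed
qed

lemma measurable_coboundary_joint:
  assumes F: "unc F \<in> borel_measurable M"
  shows "(\<lambda>y. unc (iwasawa_rep p q (fst y) F - F) (snd y)) \<in>
    borel_measurable (restrict_space borel (carrier (PG p q)) \<Otimes>\<^sub>M M)"
  unfolding unc_diff
  by (intro borel_measurable_diff measurable_iwasawa_rep_joint F measurable_compose[OF measurable_snd F])

lemma coboundary_mult:
  "iwasawa_rep p q (x \<otimes>\<^bsub>PG p q\<^esub> y) F - F =
    iwasawa_rep p q x (iwasawa_rep p q y F - F) + (iwasawa_rep p q x F - F)"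
  by (simp add: iwasawa_rep_mult iwasawa_rep_diff del: PG_simps)

text \<open>
  The norms of the operators \<open>T(g)\<close> are not assumed to be locally bounded.  Strong continuity is
  the continuity of the measurable cocycles \<open>T(g)x - x\<close>.
\<close>

lemma representation_iwasawa: "representation (PG p q) H (iwasawa_rep p q)"
  unfolding representation_def
proof (intro conjI ballI allI)
  fix g assume g: "g \<in> carrier (PG p q)"
  show "iwasawa_rep p q g x \<in> vectors H" if "x \<in> vectors H" for x by (rule iwasawa_rep_vectors[OF g that])
  show "veq H (iwasawa_rep p q g (x + y)) (iwasawa_rep p q g x + iwasawa_rep p q g y)" for x y
    by (rule veq_pointwise) (simp add: iwasawa_rep_add)
  show "veq H (iwasawa_rep p q g (scale H c x)) (scale H c (iwasawa_rep p q g x))" for c x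
    by (rule veq_pointwise) (simp add: L2_bargmann_def iwasawa_rep_scale)
  obtain C where C: "0 \<le> C" "\<And>F. unc F \<in> L2 M \<Longrightarrow> sqnorm M (unc (iwasawa_rep p q g F)) \<le> C * sqnorm M (unc F)"
    using iwasawa_rep_bounded[OF g] by blast
  have "vnorm H (iwasawa_rep p q g x) \<le> sqrt C * vnorm H x" if x: "x \<in> vectors H" for x
    unfolding H_norm[OF x] H_norm[OF iwasawa_rep_vectors[OF g x]] real_sqrt_mult[symmetric]
    using C(2)[of x] x by (intro real_sqrt_le_mono) (simp add: H_vectors)
  then show "\<exists>C. \<forall>x\<in>vectors H. vnorm H (iwasawa_rep p q g x) \<le> C * vnorm H x" by blast
  show "veq H (iwasawa_rep p q (g \<otimes>\<^bsub>PG p q\<^esub> h) x) (iwasawa_rep p q g (iwasawa_rep p q h x))" for h x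
    by (rule veq_pointwise) (simp add: iwasawa_rep_mult del: PG_simps)
next
  show "veq H (iwasawa_rep p q \<one>\<^bsub>PG p q\<^esub> x) x" for x
    by (rule veq_pointwise) (rule iwasawa_rep_one)
next
  fix x assume x: "x \<in> vectors H"
  have "unc x \<in> borel_measurable M" using x by (auto simp: H_vectors L2_def)
  from measurable_coboundary_joint[OF this]
  have "continuous_into (PG p q) H (\<lambda>g. iwasawa_rep p q g x - x)"
    by (rule cocycle_continuous[OF _ H_diff[OF iwasawa_rep_vectors[OF _ x] x] coboundary_mult])
  then show "continuous_into (PG p q) H (\<lambda>g. iwasawa_rep p q g x)"
    by (simp add: continuous_into_def del: PG_simps)
qed

end

section \<open>The vacuum cocycle\<close>

text \<open>
  The exponent of the vacuum expectation of \<open>T\<^sub>s(n, z)\<close>.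
\<close>

lemma mtrace_act:
  "mtrace p (mmul p (mmul p s n) (madj s)) - 1/2 * hs p r (mmul p s z) (mmul p s z) =
    mtrace p (mmul p (mmul p s (n - mscale (1/2) (mmul r z (madj z)))) (madj s))"
  by (simp add: madj_mmul mmul_assoc mmul_diff_left mmul_diff_right mmul_mscale_left mmul_mscale_right)

lemma exp_fractions_eq_1:
  assumes "\<And>n::nat. exp (\<i> * complex_of_real (1 / real (Suc n) * c)) = 1"
  shows "c = 0"
proof -
  obtain n :: nat where "\<bar>c\<bar> < real n" using reals_Archimedean2 by blast
  then have small: "\<bar>1 / real (Suc n) * c\<bar> < 1" by (simp add: abs_mult field_simps)
  obtain k :: int where k: "1 / real (Suc n) * c = 2 * real_of_int k * pi"
    using assms[of n] by (auto simp: exp_eq_1)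
  have "k = 0"
  proof (rule ccontr)
    assume "k \<noteq> 0"
    then have "1 \<le> \<bar>real_of_int k\<bar>" by linarith
    then have "2 * pi \<le> 2 * pi * \<bar>real_of_int k\<bar>" by simp
    also have "\<dots> = \<bar>1 / real (Suc n) * c\<bar>" unfolding k by (simp add: abs_mult)
    finally show False using small pi_gt3 by linarith
  qed
  then show ?thesis using k by simp
qed

context almost_invariant_measure
begin

lemma central_element:
  "((mscale (\<i> * complex_of_real t) (mone p), 0), mone p) \<in> carrier (PG p q)"
  by (auto simp: NG_carrier SG_mone mats_0 mats_mscale mone_mats)
    (auto simp: mscale_def madj_def mone_def fun_eq_iff)

lemma iwasawa_rep_central:
  assumes "s \<in> carrier (SG p)"
  shows "iwasawa_rep p q ((mscale (\<i> * complex_of_real t) (mone p), 0), mone p) F s z =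
    exp (\<i> * complex_of_real (t * Re (hs p p s s))) * F s z"
proof -
  have "hs p p s s = complex_of_real (Re (hs p p s s))" by (simp add: hs_self)
  then have e: "\<i> * complex_of_real t * hs p p s s = \<i> * complex_of_real (t * Re (hs p p s s))"
    by (metis mult.assoc of_real_mult)
  have "iwasawa_rep p q ((mscale (\<i> * complex_of_real t) (mone p), 0), mone p) F s z =
      exp (\<i> * complex_of_real t * hs p p s s) * F s z"
    using assms by (simp add: iwasawa_rep_apply heisenberg_act_def heisenberg_rep_def mmul_zero
        mmul_mscale_left mmul_mscale_right mmul_mone_right[of _ p p] SG_mats)
  then show ?thesis by (simp only: e)
qed

lemma hs_self_pos:
  assumes "s \<in> carrier (SG p)" "1 \<le> p"
  shows "0 < Re (hs p p s s)"
proof -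
  have 0: "0 < Re (s 0 0)" using assms by (simp add: SG_carrier)
  have "0 < (cmod (s 0 0))\<^sup>2" using 0 by auto
  also have "\<dots> \<le> (\<Sum>j<p. (cmod (s 0 j))\<^sup>2)"
    using assms(2) by (intro member_le_sum) auto
  also have "\<dots> \<le> (\<Sum>i<p. \<Sum>j<p. (cmod (s i j))\<^sup>2)"
    using assms(2) by (intro member_le_sum[of 0 "{..<p}" "\<lambda>i. \<Sum>j<p. (cmod (s i j))\<^sup>2"]) (auto intro: sum_nonneg)
  finally show ?thesis by (simp add: hs_self)
qed

text \<open>
  For fixed \<open>s\<close>, the numbers \<open>exp (i t tr s s*)\<close> with \<open>t = 1 / (n + 1)\<close> cannot all be \<open>1\<close>.  Using
  only countably many \<open>t\<close> keeps the exceptional set a null set.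
\<close>

lemma fixed_by_center_imp_0:
  assumes p: "1 \<le> p" and F: "unc F \<in> borel_measurable M"
    and fixed: "\<And>t. AE x in M. unc (iwasawa_rep p q ((mscale (\<i> * complex_of_real t) (mone p), 0), mone p) F - F) x = 0"
  shows "AE x in M. unc F x = 0"
proof -
  have "AE x in M. \<forall>n::nat. unc (iwasawa_rep p q
      ((mscale (\<i> * complex_of_real (1 / real (Suc n))) (mone p), 0), mone p) F - F) x = 0"
    unfolding AE_all_countable by (intro allI fixed)
  with AE_space show ?thesis
  proof eventually_elim
    case (elim x)
    then have s: "fst x \<in> carrier (SG p)" by (auto simp: space_M)
    let ?c = "Re (hs p p (fst x) (fst x))"
    show ?case
    proof (rule ccontr)
      assume F0: "unc F x \<noteq> 0"
      have "exp (\<i> * complex_of_real (1 / real (Suc n) * ?c)) = 1" for n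
      proof -
        have "exp (\<i> * complex_of_real (1 / real (Suc n) * ?c)) * unc F x = unc F x"
          using elim(2)[rule_format, of n]
          by (simp only: unc_def minus_apply iwasawa_rep_central[OF s] right_minus_eq)
        then show ?thesis using F0 by simp
      qed
      from exp_fractions_eq_1[OF this] show False using hs_self_pos[OF s p] by simp
    qed
  qed
qed

lemma sqnorm_eq_0: "f \<in> L2 M \<Longrightarrow> sqnorm M f = 0 \<Longrightarrow> AE x in M. f x = 0"
  using integral_nonneg_eq_0_iff_AE[of M "\<lambda>x. (cmod (f x))\<^sup>2"] by (simp add: sqnorm_def L2_integrable)

context
  fixes f :: "cmat \<Rightarrow> real"
  assumes f: "f \<in> borel_measurable \<nu>"
begin

lemma vacuum_field_measurable: "unc (vacuum_field f) \<in> borel_measurable M"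
proof -
  have "(\<lambda>x. complex_of_real (f (fst x))) \<in> borel_measurable M"
    by (rule measurable_compose[OF measurable_compose[OF measurable_fst f] borel_measurable_of_real])
  then show ?thesis by (simp add: unc_def[abs_def] vacuum_field_def)
qed

text \<open>
  The value of the cocycle at \<open>g s0\<close> is \<open>T(g)A + B\<close>, where \<open>A\<close> is the increment of \<open>f\<close> under the
  translation by \<open>s0\<close>, times the vacuum, and \<open>B\<close> is the value of the cocycle at \<open>g\<close>.
\<close>

lemma vacuum_cocycle_vectors:
  assumes trans: "\<And>s0. s0 \<in> carrier (SG p) \<Longrightarrow> integrable \<nu> (\<lambda>s. \<bar>f (mmul p s s0) - f s\<bar>\<^sup>2)"
    and displ: "\<And>n0 z0. (n0, z0) \<in> carrier (NG p q) \<Longrightarrow>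
      integrable \<nu> (\<lambda>s. (1 - Re (exp (mtrace p
           (mmul p (mmul p s (n0 - mscale (1/2) (mmul (q - p) z0 (madj z0)))) (madj s))))) * (f s)\<^sup>2)"
    and x: "x \<in> carrier (PG p q)"
  shows "iwasawa_rep p q x (vacuum_field f) - vacuum_field f \<in> vectors H"
proof -
  obtain n0 z0 s0 where x': "x = ((n0, z0), s0)" by (metis prod.collapse)
  have g: "(n0, z0) \<in> carrier (NG p q)" and s0: "s0 \<in> carrier (SG p)" using x by (auto simp: x')
  let ?g = "((n0, z0), mone p)"
  have g': "?g \<in> carrier (PG p q)" using g by (simp add: SG_mone)
  define A where "A = (\<lambda>s (z::cmat). complex_of_real (f (mmul p s s0) - f s))"
  define B where "B = iwasawa_rep p q ?g (vacuum_field f) - vacuum_field f"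
  have decomp: "(iwasawa_rep p q x (vacuum_field f) - vacuum_field f) s z = iwasawa_rep p q ?g A s z + B s z"
    if "s \<in> carrier (SG p)" for s z
    using that by (simp add: x' A_def B_def iwasawa_rep_apply vacuum_field_def heisenberg_rep_linear
        mmul_mone_right[of _ p p] SG_mats)
  have A_meas: "unc A \<in> borel_measurable M"
  proof -
    have "(\<lambda>s. complex_of_real (f (mmul p s s0) - f s)) \<in> borel_measurable \<nu>"
      by (intro measurable_compose[OF _ borel_measurable_of_real] borel_measurable_diff f
          measurable_compose[OF measurable_nu_act[OF s0] f])
    then show ?thesis unfolding unc_def A_def by (rule measurable_compose[OF measurable_fst])
  qed
  have A: "unc A \<in> L2 M"
  proof (subst L2_iff_nn_integral[OF A_meas])
    have "(\<lambda>x. ennreal ((cmod (unc A x))\<^sup>2)) \<in> borel_measurable M" using A_meas by measurable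
    from mu.nn_integral_fst[OF this, symmetric]
    have "(\<integral>\<^sup>+ x. ennreal ((cmod (unc A x))\<^sup>2) \<partial>M) = (\<integral>\<^sup>+ s. ennreal (\<bar>f (mmul p s s0) - f s\<bar>\<^sup>2) \<partial>\<nu>)"
      using mu.emeasure_space_1 by (simp add: unc_def A_def del: of_real_diff)
    also have "\<dots> < \<infinity>"
      using trans[OF s0] by (simp add: integrable_iff_bounded)
    finally show "(\<integral>\<^sup>+ x. ennreal ((cmod (unc A x))\<^sup>2) \<partial>M) < \<infinity>" .
  qed
  have B_meas: "unc B \<in> borel_measurable M"
    unfolding B_def unc_diff
    by (intro borel_measurable_diff measurable_iwasawa_rep[OF g'] vacuum_field_measurable)
  have B: "unc B \<in> L2 M"
  proof (subst L2_iff_nn_integral[OF B_meas])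
    let ?E = "\<lambda>s. 1 - Re (exp (mtrace p
           (mmul p (mmul p s (n0 - mscale (1/2) (mmul (q - p) z0 (madj z0)))) (madj s))))"
    have "(\<lambda>x. ennreal ((cmod (unc B x))\<^sup>2)) \<in> borel_measurable M" using B_meas by measurable
    from mu.nn_integral_fst[OF this, symmetric]
    have "(\<integral>\<^sup>+ x. ennreal ((cmod (unc B x))\<^sup>2) \<partial>M) =
        (\<integral>\<^sup>+ s. \<integral>\<^sup>+ z. ennreal ((cmod (unc B (s, z)))\<^sup>2) \<partial>\<mu> \<partial>\<nu>)" .
    also have "\<dots> = (\<integral>\<^sup>+ s. ennreal (2 * (?E s * (f s)\<^sup>2)) \<partial>\<nu>)"
    proof (rule nn_integral_cong)
      fix s assume "s \<in> space \<nu>"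
      then have s: "s \<in> carrier (SG p)" by (simp add: space_nu)
      let ?a = "heisenberg_act p s (n0, z0)"
      let ?u = "\<lambda>z. heisenberg_rep p q ?a (\<lambda>z. 1) z - 1"
      have a: "?a \<in> carrier (NG p q)" by (rule act_closed[OF s g])
      have "?u \<in> vectors K"
        by (intro bargmann_diff heisenberg_rep_bargmann[OF a] bargmann_const)
      then have fu: "(\<lambda>z. complex_of_real (f s) * ?u z) \<in> L2 \<mu>" "?u \<in> L2 \<mu>"
        using bargmann_scale[of ?u p q "complex_of_real (f s)"] by (simp_all add: bargmann_vectors)
      have Bs: "unc B (s, z) = complex_of_real (f s) * ?u z" for z
        using s heisenberg_rep_linear(3)[of p q ?a "complex_of_real (f s)" "\<lambda>z. 1" z]
        by (simp add: B_def unc_def iwasawa_rep_apply vacuum_field_def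
            mmul_mone_right[of _ p p] SG_mats right_diff_distrib)
      have "sqnorm \<mu> ?u = 2 * ?E s"
        using vacuum_displacement[of "fst ?a" "snd ?a" p q] a mtrace_act[of p s n0 "q - p" z0]
        by (simp add: heisenberg_act_def)
      then have "sqnorm \<mu> (\<lambda>z. complex_of_real (f s) * ?u z) = 2 * (?E s * (f s)\<^sup>2)"
        using L2_scale(2)[OF fu(2), of "complex_of_real (f s)"] by simp
      then show "(\<integral>\<^sup>+ z. ennreal ((cmod (unc B (s, z)))\<^sup>2) \<partial>\<mu>) = ennreal (2 * (?E s * (f s)\<^sup>2))"
        unfolding Bs nn_integral_sqnorm[OF fu(1)] by simp
    qed
    also have "\<dots> \<le> (\<integral>\<^sup>+ s. ennreal (norm (2 * (?E s * (f s)\<^sup>2))) \<partial>\<nu>)"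
      by (intro nn_integral_mono ennreal_leI) simp
    also have "\<dots> < \<infinity>"
      using integrable_mult_right[OF displ[OF g], of 2] unfolding integrable_iff_bounded by blast
    finally show "(\<integral>\<^sup>+ x. ennreal ((cmod (unc B x))\<^sup>2) \<partial>M) < \<infinity>" .
  qed
  have "unc (iwasawa_rep p q ?g A) \<in> L2 M" using iwasawa_rep_bounded[OF g'] A by blast
  from L2_add(1)[OF this B]
  have "(\<lambda>w. unc (iwasawa_rep p q ?g A) w + unc B w) \<in> L2 M" .
  also have "?this \<longleftrightarrow> unc (iwasawa_rep p q x (vacuum_field f) - vacuum_field f) \<in> L2 M"
    by (rule L2_cong) (simp add: unc_def space_M mem_Times_iff decomp del: minus_apply)
  finally have L2: "unc (iwasawa_rep p q x (vacuum_field f) - vacuum_field f) \<in> L2 M" .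
  have v: "vacuum_field f s \<in> vectors K" for s
    unfolding vacuum_field_def by (rule bargmann_const)
  have "(iwasawa_rep p q x (vacuum_field f) - vacuum_field f) s \<in> vectors K" if "s \<in> carrier (SG p)" for s
    using bargmann_diff[OF iwasawa_rep_K[OF x that, of "vacuum_field f"] v[of s]] v
    by (simp add: fun_diff_def)
  then show ?thesis using L2 by (simp add: H_vectors)
qed

text \<open>
  If the cocycle were the coboundary of \<open>\<xi>\<close>, then \<open>f\<one> - \<xi>\<close> would be fixed by the centre of \<open>N\<close>, hence
  \<open>0\<close>, and \<open>f\<one>\<close> would be square integrable.
\<close>

lemma vacuum_cocycle_nontrivial:
  assumes p: "1 \<le> p" and inf: "(\<integral>\<^sup>+ s. ennreal ((f s)\<^sup>2) \<partial>\<nu>) = \<infinity>"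
    and vec: "\<And>x. x \<in> carrier (PG p q) \<Longrightarrow> iwasawa_rep p q x (vacuum_field f) - vacuum_field f \<in> vectors H"
    and \<xi>: "\<xi> \<in> vectors H"
    and eq: "\<And>x. x \<in> carrier (PG p q) \<Longrightarrow>
      veq H (iwasawa_rep p q x (vacuum_field f) - vacuum_field f) (iwasawa_rep p q x \<xi> - \<xi>)"
  shows False
proof -
  let ?F = "vacuum_field f"
  have \<xi>L: "unc \<xi> \<in> L2 M" using \<xi> by (simp add: H_vectors)
  have m: "unc (?F - \<xi>) \<in> borel_measurable M"
    unfolding unc_diff by (intro borel_measurable_diff vacuum_field_measurable L2_measurable \<xi>L)
  have "AE w in M. unc (?F - \<xi>) w = 0"
  proof (rule fixed_by_center_imp_0[OF p m])
    fix t
    let ?x = "((mscale (\<i> * complex_of_real t) (mone p), 0), mone p)"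
    note x = central_element[of t]
    let ?d = "(iwasawa_rep p q ?x ?F - ?F) - (iwasawa_rep p q ?x \<xi> - \<xi>)"
    have d: "?d \<in> vectors H" by (intro H_diff vec[OF x] iwasawa_rep_vectors[OF x] \<xi>)
    then have "sqnorm M (unc ?d) = 0" using eq[OF x] veq_iff[OF d] by simp
    then have "AE w in M. unc ?d w = 0" using d by (intro sqnorm_eq_0) (simp_all add: H_vectors)
    moreover have "?d = iwasawa_rep p q ?x (?F - \<xi>) - (?F - \<xi>)"
      by (simp add: iwasawa_rep_diff)
    ultimately show "AE w in M. unc (iwasawa_rep p q ?x (?F - \<xi>) - (?F - \<xi>)) w = 0" by simp
  qed
  then have "(\<integral>\<^sup>+ w. ennreal ((cmod (unc ?F w))\<^sup>2) \<partial>M) = (\<integral>\<^sup>+ w. ennreal ((cmod (unc \<xi> w))\<^sup>2) \<partial>M)"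
    by (intro nn_integral_cong_AE) (auto simp: unc_diff elim!: eventually_mono)
  also have "\<dots> < \<infinity>" using \<xi>L L2_iff_nn_integral[OF L2_measurable[OF \<xi>L]] by simp
  finally have "(\<integral>\<^sup>+ w. ennreal ((cmod (unc ?F w))\<^sup>2) \<partial>M) < \<infinity>" .
  moreover have "(\<integral>\<^sup>+ w. ennreal ((cmod (unc ?F w))\<^sup>2) \<partial>M) = (\<integral>\<^sup>+ s. ennreal ((f s)\<^sup>2) \<partial>\<nu>)"
  proof -
    have "(\<lambda>x. ennreal ((cmod (unc ?F x))\<^sup>2)) \<in> borel_measurable M" using vacuum_field_measurable by measurable
    from mu.nn_integral_fst[OF this, symmetric] show ?thesis
      using mu.emeasure_space_1 by (simp add: unc_def vacuum_field_def)
  qed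
  ultimately show False using inf by simp
qed

end

end

theorem theorem9:
  fixes p q :: nat and \<nu> :: "cmat measure" and f :: "cmat \<Rightarrow> real"
  assumes "1 \<le> p" and "p \<le> q"
    and "sets \<nu> = sets (restrict_space borel (carrier (lower_triangular_group p)))"
    and "sigma_finite_measure \<nu>"
    and "almost_invariant p \<nu>"
    and "f \<in> borel_measurable \<nu>"
    and "\<And>s. s \<in> carrier (lower_triangular_group p) \<Longrightarrow> 0 < f s"
    and "(\<integral>\<^sup>+ s. ennreal ((f s)\<^sup>2) \<partial>\<nu>) = \<infinity>"
    and "\<And>s0. s0 \<in> carrier (lower_triangular_group p) \<Longrightarrow>
      integrable \<nu> (\<lambda>s. \<bar>f (s \<otimes>\<^bsub>lower_triangular_group p\<^esub> s0) - f s\<bar>\<^sup>2)"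
    and "\<And>n0 z0. (n0, z0) \<in> carrier (heisenberg_group p q) \<Longrightarrow>
      integrable \<nu> (\<lambda>s.
        (1 - Re (exp (mtrace p
           (mmul p (mmul p s (n0 - mscale (1/2) (mmul (q - p) z0 (madj z0)))) (madj s))))) * (f s)\<^sup>2)"
  shows "nontrivial_cocycle (iwasawa_group p q) (L2_bargmann p q \<nu>) (iwasawa_rep p q)
           (\<lambda>g. iwasawa_rep p q g (vacuum_field f) - vacuum_field f)
       \<and> special_representation (iwasawa_group p q) (L2_bargmann p q \<nu>) (iwasawa_rep p q)"
proof -
  interpret almost_invariant_measure p q \<nu>
    using assms(3,4,5)
    by (simp add: almost_invariant_measure_def lt_measure_def almost_invariant_measure_axioms_def)
  let ?\<beta> = "\<lambda>g. iwasawa_rep p q g (vacuum_field f) - vacuum_field f"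
  note f = assms(6)
  have vec: "?\<beta> x \<in> vectors H" if "x \<in> carrier (PG p q)" for x
    by (rule vacuum_cocycle_vectors[OF f _ assms(10) that]) (use assms(9) in simp)
  have "continuous_into (PG p q) H ?\<beta>"
    by (rule cocycle_continuous[OF measurable_coboundary_joint[OF vacuum_field_measurable[OF f]] vec coboundary_mult])
  then have "cocycle (PG p q) H (iwasawa_rep p q) ?\<beta>"
    unfolding cocycle_def using vec by (auto intro!: veq_pointwise simp: coboundary_mult simp del: PG_simps)
  moreover have "\<not> (\<exists>\<xi>\<in>vectors H. \<forall>g\<in>carrier (PG p q). veq H (?\<beta> g) (iwasawa_rep p q g \<xi> - \<xi>))"
    using vacuum_cocycle_nontrivial[OF f assms(1) assms(8) vec] by blast
  ultimately have "nontrivial_cocycle (PG p q) H (iwasawa_rep p q) ?\<beta>"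
    by (simp add: nontrivial_cocycle_def del: PG_simps)
  then show ?thesis
    using representation_iwasawa by (auto simp: special_representation_def)
qed

end
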